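(* Let $k\ge 2$ and let $\boldsymbol X$ be a Kotz Type III elliptical random vector in $\mathbb R^k$, i.e. $\boldsymbol X\stackrel{d}{=}A^\top R\,\boldsymbol U$, where $A\in\mathbb R^{k\times k}$ is a non-singular matrix such that $\Sigma:=A^\top A$ is a correlation matrix, $\boldsymbol U$ is uniformly distributed on the unit sphere of $\mathbb R^k$, and $R>0$ is a random variable independent of $\boldsymbol U$ with $$\boldsymbol P\{R>u\}=(1+o(1))\,p\,u^{N}\exp(-q u^{\delta}),\quad u\to\infty,$$ for some constants $\delta>0$, $p>0$, $q>0$, $N\in\mathbb R$. Let $t_n$, $n\ge 1$, be positive constants with $\lim_{n\to\infty}t_n=\infty$ and let $\boldsymbol a\in\mathbb R^k\setminus(-\infty,0]^k$. Let $I$ be the minimal index set of the quadratic programming problem $\boldsymbol Q(\Sigma,\boldsymbol a)$, let $J:=\{1,\dots,k\}\setminus I$, $m:=|I|$, and $\|\boldsymbol a_I\|:=(\boldsymbol a_I^\top\Sigma_{II}^{-1}\boldsymbol a_I)^{1/2}$. Define $\boldsymbol v_n\in\mathbb R^k$ by $$(\boldsymbol v_n)_I:=q\delta\,(t_n\|\boldsymbol a_I\|)^{\delta-1}\boldsymbol 1_I,\qquad\text{and, if } m<k,\quad (\boldsymbol v_n)_J:=\sqrt{q\delta}\,(t_n\|\boldsymbol a_I\|)^{\delta/2-1}\boldsymbol 1_J .$$ Then for any $\boldsymbol x\in\mathbb R^k$, as $n\to\infty$, $$\begin{aligned}\boldsymbol P\{\boldsymbol X>t_n\boldsymbol a+\boldsymbol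 x/\boldsymbol v_n\}=(1+o(1))\;& p\,(q\delta)^{1-(k+m)/2}\,\|\boldsymbol a_I\|^{\,m+N+\delta(1-(k+m)/2)}\;\frac{\Gamma(k/2)\,2^{k/2-1}}{(2\pi)^{m/2}\,|\Sigma_{II}|^{1/2}\prod_{i\in I}\boldsymbol a_I^\top\Sigma_{II}^{-1}\boldsymbol e_i}\;\exp\bigl(-\boldsymbol x_I^\top\Sigma_{II}^{-1}\boldsymbol a_I/\|\boldsymbol a_I\|\bigr)\\ &\times \boldsymbol P\{\boldsymbol Z_J>\infty(\boldsymbol a_J-\Sigma_{JI}\Sigma_{II}^{-1}\boldsymbol a_I)+\boldsymbol x_J\mid\boldsymbol Z_I=\boldsymbol 0_I\}\; t_n^{N+\delta(1-(k+m)/2)}\exp\bigl(-q\|\boldsymbol a_I\|^{\delta}t_n^{\delta}\bigr),\end{aligned}$$ where $\boldsymbol Z$ is a mean-zero Gaussian random vector in $\mathbb R^k$ with covariance matrix $\Sigma$. Here $\infty\cdot 0$ is interpreted as $0$, and the conditional probability is set to $1$ if $J$ is empty.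
   Context: Notation. For $\boldsymbol x\in\mathbb R^k$ and a non-empty $K\subset\{1,\dots,k\}$, $\boldsymbol x_K=(x_i,i\in K)^\top$ is the subvector. For index sets $K,L$, $\Sigma_{KL}$ is the submatrix of $\Sigma$ with rows in $K$ and columns in $L$; $\Sigma_{II}^{-1}$ means $(\Sigma_{II})^{-1}$, and $|\Sigma_{II}|$ is the determinant. Inequalities between vectors are componentwise ($\boldsymbol x>\boldsymbol y$ means $x_i>y_i$ for all $i$; similarly $\ge$). $\boldsymbol x/\boldsymbol v$ is the componentwise quotient. $\boldsymbol 0$ and $\boldsymbol 1$ are the vectors of zeros and ones. $\boldsymbol e_i$, $i\in I$, is the unit vector of $\mathbb R^{|I|}$ (coordinates indexed by $I$) in the direction of index $i$. A correlation matrix here is a positive definite symmetric matrix with all diagonal entries equal to 1. $\Gamma$ is the Gamma function. Minimal index set. The problem $\boldsymbol Q(\Sigma,\boldsymbol a)$, $\boldsymbol a\in\mathbb R^k\setminus(-\infty,0]^k$, is: minimise $\boldsymbol x^\top\Sigma^{-1}\boldsymbol x$ under the linear constraint $\boldsymbol x\ge\boldsymbol a$. It has a unique solution $\widetilde{\boldsymbol a}$, and it determines a unique non-empty index set $I\subset\{1,\dots,k\}$, called the minimal index set, such that, with $J=\{1,\dots,k\}\setminus I$: $\widetilde{\boldsymbol a}_I=\boldsymbol a_I$, $\Sigma_{II}^{-1}\boldsymbol a_I>\boldsymbol 0_I$, and (if $J\neq\emptyset$) $\widetilde{\boldsymbol a}_J=\Sigma_{JI}\Sigma_{II}^{-1}\boldsymbol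 a_I\ge\boldsymbol a_J$; the minimum is $\boldsymbol a_I^\top\Sigma_{II}^{-1}\boldsymbol a_I>0$. Convention. Since $\boldsymbol a_J-\Sigma_{JI}\Sigma_{II}^{-1}\boldsymbol a_I\le\boldsymbol 0_J$, the vector $\infty(\boldsymbol a_J-\Sigma_{JI}\Sigma_{II}^{-1}\boldsymbol a_I)$ has components $-\infty$ (where the component of the difference is negative) or $0$ (where it is zero). The conditional law of $\boldsymbol Z_J$ given $\boldsymbol Z_I=\boldsymbol 0_I$ is the centered Gaussian law with covariance matrix $\Sigma_{JJ}-\Sigma_{JI}\Sigma_{II}^{-1}\Sigma_{IJ}$. *)

theory Defs
  imports "HOL-Probability.Probability" "HOL-Library.Landau_Symbols"
begin

text \<open>
  Index sets. For \<open>K\<close>, \<open>L\<close> subsets of the finite index type, a vector indexed by \<open>K\<close> is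
  represented by the vector that is extended by zero off \<open>K\<close>, and a matrix with rows \<open>K\<close> and
  columns \<open>L\<close> by the matrix that is extended by zero off \<open>K \<times> L\<close>.
  Under this identification the library operations \<open>*v\<close>, \<open>**\<close>, \<open>+\<close>, \<open>-\<close> and the inner product are
  the usual operations on the smaller vectors and matrices.
\<close>

definition subvec :: "'n set \<Rightarrow> real ^ 'n \<Rightarrow> real ^ 'n" where
  "subvec K x = (\<chi> i. if i \<in> K then x $ i else 0)"

definition submat :: "'n set \<Rightarrow> 'n set \<Rightarrow> real ^ 'n ^ 'n \<Rightarrow> real ^ 'n ^ 'n" where
  "submat K L S = (\<chi> i j. if i \<in> K \<and> j \<in> L then S $ i $ j else 0)"

text \<open>
  The determinant and the inverse of the principal submatrix \<open>S\<^sub>K\<^sub>K\<close>: up to the order of the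
  indices, \<open>pad_one K S\<close> is the block diagonal matrix with blocks \<open>S\<^sub>K\<^sub>K\<close> and the identity, so its
  determinant is that of \<open>S\<^sub>K\<^sub>K\<close> and the \<open>K \<times> K\<close> block of its inverse is the inverse of \<open>S\<^sub>K\<^sub>K\<close>.
\<close>

definition pad_one :: "'n set \<Rightarrow> real ^ 'n ^ 'n \<Rightarrow> real ^ 'n ^ 'n" where
  "pad_one K S = (\<chi> i j. if i \<in> K \<and> j \<in> K then S $ i $ j else if i = j then 1 else 0)"

definition subdet :: "'n::finite set \<Rightarrow> real ^ 'n ^ 'n \<Rightarrow> real" where
  "subdet K S = det (pad_one K S)"

definition subinv :: "'n::finite set \<Rightarrow> real ^ 'n ^ 'n \<Rightarrow> real ^ 'n ^ 'n" where
  "subinv K S = submat K K (matrix_inv (pad_one K S))"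

definition correlation_matrix :: "real ^ 'n::finite ^ 'n \<Rightarrow> bool" where
  "correlation_matrix S \<longleftrightarrow>
     transpose S = S \<and> (\<forall>x. x \<noteq> 0 \<longrightarrow> x \<bullet> (S *v x) > 0) \<and> (\<forall>i. S $ i $ i = 1)"

definition qp_solution :: "real ^ 'n::finite ^ 'n \<Rightarrow> real ^ 'n \<Rightarrow> real ^ 'n \<Rightarrow> bool" where
  "qp_solution S a = is_arg_min (\<lambda>x. x \<bullet> (matrix_inv S *v x)) (\<lambda>x. \<forall>i. x $ i \<ge> a $ i)"

definition minimal_index_set :: "real ^ 'n::finite ^ 'n \<Rightarrow> real ^ 'n \<Rightarrow> 'n set \<Rightarrow> bool" where
  "minimal_index_set S a I \<longleftrightarrow> I \<noteq> {} \<and>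
     (\<exists>b. qp_solution S a b \<and>
        (\<forall>i\<in>I. b $ i = a $ i \<and> (subinv I S *v subvec I a) $ i > 0) \<and>
        (\<forall>j\<in>-I. b $ j = (submat (-I) I S *v (subinv I S *v subvec I a)) $ j \<and> b $ j \<ge> a $ j))"

text \<open>
  The uniform distribution on the unit sphere is the normalised surface measure, given in polar
  coordinates: the mass of a Borel set \<open>B\<close> of the sphere is the proportion of the volume of the
  unit ball that lies in the cone over \<open>B\<close>.
\<close>

definition uniform_sphere :: "(real ^ 'n::finite) measure" where
  "uniform_sphere = distr (uniform_measure lborel (ball 0 1)) borel (\<lambda>x. x /\<^sub>R norm x)"

text \<open>The library's \<open>indep_var\<close> requires both random variables to have the same type.\<close>

definition indep_rv :: "'w measure \<Rightarrow> ('w \<Rightarrow> 'b::topological_space) \<Rightarrow>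
    ('w \<Rightarrow> 'c::topological_space) \<Rightarrow> bool" where
  "indep_rv M R U \<longleftrightarrow> prob_space.indep_set M
     {R -` B \<inter> space M | B. B \<in> sets borel} {U -` B \<inter> space M | B. B \<in> sets borel}"

text \<open>
  Centered Gaussian law with covariance the positive definite matrix \<open>C\<^sub>K\<^sub>K\<close>, as a measure on the
  functions on \<open>K\<close>, given by its Lebesgue density.
\<close>

definition gaussian_law :: "'n::finite set \<Rightarrow> real ^ 'n ^ 'n \<Rightarrow> ('n \<Rightarrow> real) measure" where
  "gaussian_law K C = density (Pi\<^sub>M K (\<lambda>_. lborel))
     (\<lambda>z. ennreal (exp (- (subvec K (\<chi> i. z i) \<bullet> (subinv K C *v subvec K (\<chi> i. z i))) / 2) /
                   sqrt ((2 * pi) ^ card K * subdet K C)))"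

text \<open>
  The conditional law of \<open>Z\<^sub>J\<close> given \<open>Z\<^sub>I = 0\<close>, where \<open>J\<close> is the complement of \<open>I\<close> and \<open>Z\<close> is
  a centered Gaussian vector with covariance matrix \<open>S\<close>.
\<close>

definition cond_gaussian_law :: "real ^ 'n::finite ^ 'n \<Rightarrow> 'n set \<Rightarrow> ('n \<Rightarrow> real) measure" where
  "cond_gaussian_law S I = (let J = -I in
     gaussian_law J (submat J J S - submat J I S ** subinv I S ** submat I J S))"

text \<open>
  The conditional probability of \<open>Z\<^sub>J > \<infinity> c\<^sub>J + x\<^sub>J\<close> given \<open>Z\<^sub>I = 0\<close>, used for \<open>c\<^sub>J \<le> 0\<close>. In the
  extended reals, \<open>\<infinity> * 0 = 0\<close> and \<open>\<infinity> * c = -\<infinity>\<close> for \<open>c < 0\<close>.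
\<close>

definition cond_gaussian_prob ::
    "real ^ 'n::finite ^ 'n \<Rightarrow> 'n set \<Rightarrow> real ^ 'n \<Rightarrow> real ^ 'n \<Rightarrow> real" where
  "cond_gaussian_prob S I c x = (if -I = {} then 1 else
     measure (cond_gaussian_law S I)
       {z \<in> space (cond_gaussian_law S I).
          \<forall>j\<in>-I. ereal (z j) > \<infinity> * ereal (c $ j) + ereal (x $ j)})"

end

theory Submission
  imports Defs "HOL-Real_Asymp.Real_Asymp"
begin

text \<open>
  Why the expansion holds. Put \<open>J = -I\<close>, \<open>s = t * nrm\<close> and \<open>\<eta> = 1 / (q * \<delta> * s powr \<delta>)\<close>. Suppose first that
  \<open>R\<close> has the tail \<open>G u = p * u powr \<nu> * exp (- q * u powr \<delta>)\<close> exactly, at least for large \<open>u\<close>. By polar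
  coordinates (\<open>nn_integral_polar\<close>) the vector \<open>z = R *\<^sub>R U\<close> has a Lebesgue density that depends on
  \<open>norm z\<close> only, so the probability is an integral over the cone \<open>A\<^sup>T z > t a + x / v\<close>, which is dominated by
  the point of least norm; the transpose of \<open>A\<close> sends it to the minimiser of the quadratic program. Near this point, coordinates \<open>y\<close> are
  used that eliminate \<open>I\<close> from \<open>J\<close> by block elimination (\<open>whitening\<close>), scaled by \<open>s * \<eta>\<close> along \<open>I\<close> and by
  \<open>s * sqrt \<eta>\<close> along \<open>J\<close>. These scalings are \<open>1 / v\<close>. In them
  \<open>(norm z)\<^sup>2 = s\<^sup>2 * (1 + 2 * \<eta> * ell y + \<eta>\<^sup>2 * kap y)\<close>, where \<open>ell\<close> is linear with positive coefficients in
  \<open>y\<^sub>I\<close> and is half the inverse conditional covariance form in \<open>y\<^sub>J\<close>. Therefore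
  \<open>q * norm z powr \<delta> - q * s powr \<delta>\<close> tends to \<open>ell y\<close>. The cone becomes \<open>y\<^sub>I > x\<^sub>I\<close> together with \<open>y\<^sub>j > x\<^sub>j\<close>
  for the tight constraints \<open>j\<close>; the slack constraints disappear. So the limit is a product of
  exponential integrals over \<open>y\<^sub>I\<close> and a conditional Gaussian probability (\<open>limit_integral\<close>), and all other
  factors come from the Jacobian and from the density at distance \<open>s\<close> (\<open>scale_eq\<close>).

  The limit is taken by dominated convergence, for which \<open>radial_ratio_bound\<close> gives polynomial decay of
  arbitrary order in \<open>ell y\<close>, uniformly in \<open>\<eta>\<close>, and \<open>shadow_bound\<close> shows that \<open>ell\<close> grows linearly on the
  region of integration.

  In general the law of \<open>R\<close> has no density, and its tail is known up to a factor \<open>1 + o(1)\<close> only. Since \<open>a\<close> can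
  have negative components, a ray may leave the cone again, so the probability is not a monotone
  function of \<open>R\<close> along a ray. But the cone is convex, so each ray meets it in an interval. The
  probabilities for \<open>R\<close> and for the exact tail then differ by at most \<open>2 * \<epsilon>\<close> times the mass of the
  \<open>shadow\<close> of the cone, the union of its dilations by factors at least \<open>1\<close> (\<open>radial_mass_comparison\<close>). The
  linear growth of \<open>ell\<close> is proved on the whole shadow, so the mass of the shadow has the same order as that
  of the cone, and the difference is negligible.
\<close>

section \<open>Block matrices\<close>

text \<open>
  Restricting rows or columns to \<open>K\<close> is multiplication by the coordinate projection, so identities
  between submatrices become identities of the matrix algebra, with \<open>coord_proj I\<close> and
  \<open>coord_proj (-I)\<close> as complementary idempotents.
\<close>

definition coord_proj :: "'n set \<Rightarrow> real ^ 'n::finite ^ 'n" where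
  "coord_proj K = (\<chi> i j. if i = j \<and> i \<in> K then 1 else 0)"

lemma coord_proj_mult_nth: "(coord_proj K ** M) $ i $ j = (if i \<in> K then M $ i $ j else 0)"
  by (simp add: coord_proj_def matrix_matrix_mult_def if_distrib[where f = "\<lambda>c. c * _"]
      sum.If_cases Int_def cong: if_cong)

lemma mult_coord_proj_nth: "(M ** coord_proj K) $ i $ j = (if j \<in> K then M $ i $ j else 0)"
  by (cases "j \<in> K") (simp_all add: coord_proj_def matrix_matrix_mult_def if_distrib[where f = "\<lambda>c. _ * c"]
      sum.delta' cong: if_cong conj_cong)

lemma coord_proj_vec: "coord_proj K *v x = subvec K x"
  by (simp add: coord_proj_def matrix_vector_mult_def subvec_def vec_eq_iff
      if_distrib[where f = "\<lambda>c. c * _"] sum.If_cases Int_def cong: if_cong)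

lemma submat_eq: "submat K L M = coord_proj K ** M ** coord_proj L"
  by (auto simp: vec_eq_iff mult_coord_proj_nth coord_proj_mult_nth submat_def)

lemma pad_one_eq: "pad_one K M = coord_proj K ** M ** coord_proj K + coord_proj (- K)"
  by (auto simp: vec_eq_iff mult_coord_proj_nth coord_proj_mult_nth pad_one_def)
     (auto simp: coord_proj_def)

lemma coord_proj_mult: "coord_proj K ** coord_proj L = coord_proj (K \<inter> L)"
  by (auto simp: vec_eq_iff coord_proj_mult_nth) (auto simp: coord_proj_def)

lemma coord_proj_idem: "coord_proj K ** coord_proj K = coord_proj K"
  and coord_proj_compl: "coord_proj K ** coord_proj (-K) = 0" "coord_proj (-K) ** coord_proj K = 0"
  by (simp_all add: coord_proj_mult) (simp_all add: coord_proj_def vec_eq_iff)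

lemma coord_proj_add_compl: "coord_proj K + coord_proj (-K) = mat 1"
  by (simp add: coord_proj_def mat_def vec_eq_iff)

lemma transpose_coord_proj: "transpose (coord_proj K) = coord_proj K"
  by (auto simp: coord_proj_def transpose_def vec_eq_iff)

lemma matrix_mult_simps:
  fixes A B C :: "real ^ 'n::finite ^ 'n"
  shows "(A + B) ** C = A ** C + B ** C" "C ** (A + B) = C ** A + C ** B"
    "(A - B) ** C = A ** C - B ** C" "C ** (A - B) = C ** A - C ** B"
    "(- A) ** C = - (A ** C)" "C ** (- A) = - (C ** A)"
  by (simp_all add: vec_eq_iff matrix_matrix_mult_def algebra_simps sum.distrib sum_subtractf sum_negf)

lemma transpose_add: "transpose (A + B) = transpose A + transpose B"
  by (simp add: transpose_def vec_eq_iff)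

lemma matrix_inv_mult:
  fixes M :: "real ^ 'n::finite ^ 'n"
  assumes "invertible M"
  shows "M ** matrix_inv M = mat 1" "matrix_inv M ** M = mat 1"
  using assms someI_ex[of "\<lambda>A'. M ** A' = mat 1 \<and> A' ** M = mat 1"]
  unfolding invertible_def matrix_inv_def by blast+

lemma transpose_matrix_inv:
  fixes M :: "real ^ 'n::finite ^ 'n"
  assumes "invertible M" "transpose M = M"
  shows "transpose (matrix_inv M) = matrix_inv M"
proof -
  have "transpose (matrix_inv M) ** M = mat 1"
    using arg_cong[OF matrix_inv_mult(1)[OF assms(1)], of transpose] assms(2)
    by (simp add: matrix_transpose_mul)
  then have "transpose (matrix_inv M) ** (M ** matrix_inv M) = matrix_inv M"
    by (simp add: matrix_mul_assoc)
  then show ?thesis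
    by (simp add: matrix_inv_mult assms)
qed

lemma pad_one_commute: "coord_proj K ** pad_one K M = pad_one K M ** coord_proj K"
  by (auto simp: vec_eq_iff mult_coord_proj_nth coord_proj_mult_nth pad_one_def)

text \<open>
  The padded matrix is block diagonal, so it commutes with the projection, and then so does its
  inverse; the block of the inverse can be cut out from either side.
\<close>

lemma subinv_eq:
  fixes M :: "real ^ 'n::finite ^ 'n"
  assumes "invertible (pad_one K M)"
  shows "subinv K M = matrix_inv (pad_one K M) ** coord_proj K"
    and "subinv K M = coord_proj K ** matrix_inv (pad_one K M)"
proof -
  let ?P = "coord_proj K" and ?M = "pad_one K M" and ?N = "matrix_inv (pad_one K M)"
  have "?N ** ?P = ?N ** ?P ** (?M ** ?N)"
    by (simp add: matrix_inv_mult assms)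
  also have "\<dots> = ?N ** (?P ** ?M) ** ?N"
    by (simp add: matrix_mul_assoc)
  also have "\<dots> = (?N ** ?M) ** ?P ** ?N"
    by (simp only: pad_one_commute) (simp add: matrix_mul_assoc)
  also have "\<dots> = ?P ** ?N"
    by (simp add: matrix_inv_mult assms)
  finally have comm: "?N ** ?P = ?P ** ?N" .
  have "subinv K M = ?P ** (?N ** ?P)"
    by (simp add: subinv_def submat_eq matrix_mul_assoc)
  also have "\<dots> = ?P ** ?P ** ?N"
    by (simp only: comm matrix_mul_assoc)
  finally show "subinv K M = ?P ** ?N"
    by (simp only: coord_proj_idem)
  then show "subinv K M = ?N ** ?P"
    by (simp only: comm)
qed

lemma subinv_coord_proj:
  fixes M :: "real ^ 'n::finite ^ 'n"
  shows "coord_proj K ** subinv K M = subinv K M" "subinv K M ** coord_proj K = subinv K M"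
  by (simp_all add: subinv_def submat_eq matrix_mul_assoc coord_proj_idem)
     (simp add: coord_proj_idem flip: matrix_mul_assoc)

lemma subinv_mult:
  fixes M :: "real ^ 'n::finite ^ 'n"
  assumes "invertible (pad_one K M)"
  shows "subinv K M ** submat K K M = coord_proj K" "submat K K M ** subinv K M = coord_proj K"
proof -
  let ?P = "coord_proj K" and ?M = "pad_one K M" and ?N = "matrix_inv (pad_one K M)"
  have s: "?P ** ?M = submat K K M" "?M ** ?P = submat K K M"
    by (simp_all add: pad_one_eq submat_eq matrix_mult_simps matrix_mul_assoc coord_proj_idem
          coord_proj_compl) (simp_all add: coord_proj_idem coord_proj_compl flip: matrix_mul_assoc)
  have ps: "?P ** submat K K M = submat K K M" "submat K K M ** ?P = submat K K M"
    by (simp_all add: submat_eq matrix_mul_assoc coord_proj_idem)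
      (simp_all add: coord_proj_idem coord_proj_compl flip: matrix_mul_assoc)
  have "subinv K M ** submat K K M = ?N ** (?P ** submat K K M)"
    by (simp add: subinv_eq(1)[OF assms] matrix_mul_assoc)
  also have "\<dots> = (?N ** ?M) ** ?P"
    by (simp only: ps(1)) (simp only: s(2)[symmetric] matrix_mul_assoc)
  finally show "subinv K M ** submat K K M = ?P"
    by (simp add: matrix_inv_mult assms)
  have "submat K K M ** subinv K M = (submat K K M ** ?P) ** ?N"
    by (simp add: subinv_eq(2)[OF assms] matrix_mul_assoc)
  also have "\<dots> = ?P ** (?M ** ?N)"
    by (simp only: ps) (simp add: matrix_mul_assoc s)
  finally show "submat K K M ** subinv K M = ?P"
    by (simp add: matrix_inv_mult assms)
qed

lemma transpose_pad_one: "transpose M = M \<Longrightarrow> transpose (pad_one K M) = pad_one K M"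
  by (auto simp: vec_eq_iff transpose_def pad_one_def)

lemma transpose_subinv:
  fixes M :: "real ^ 'n::finite ^ 'n"
  assumes "invertible (pad_one K M)" "transpose M = M"
  shows "transpose (subinv K M) = subinv K M"
  unfolding subinv_eq(1)[OF assms(1)] matrix_transpose_mul transpose_coord_proj
  by (simp only: transpose_matrix_inv[OF assms(1) transpose_pad_one[OF assms(2)]]
      subinv_eq[OF assms(1), symmetric])

definition pos_def :: "real ^ 'n::finite ^ 'n \<Rightarrow> bool" where
  "pos_def M \<longleftrightarrow> (\<forall>x. x \<noteq> 0 \<longrightarrow> x \<bullet> (M *v x) > 0)"

lemma pos_def_invertible:
  fixes M :: "real ^ 'n::finite ^ 'n"
  assumes "pos_def M"
  shows "invertible M"
proof -
  have "\<forall>x. M *v x = 0 \<longrightarrow> x = 0"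
    using assms by (force simp: pos_def_def)
  then show ?thesis
    by (simp add: invertible_left_inverse matrix_left_invertible_ker)
qed

text \<open>
  The segment from the identity to \<open>M\<close> consists of positive definite, hence invertible, matrices, so
  the determinant keeps its sign along it.
\<close>

lemma pos_def_det:
  fixes M :: "real ^ 'n::finite ^ 'n"
  assumes "pos_def M"
  shows "det M > 0"
proof (rule ccontr)
  assume neg: "\<not> det M > 0"
  define G where "G \<tau> = (1 - \<tau>) *\<^sub>R mat 1 + \<tau> *\<^sub>R M" for \<tau> :: real
  have cont: "continuous_on {0..1} (\<lambda>\<tau>. det (G \<tau>))"
    unfolding det_def G_def by (intro continuous_intros)
  have "\<exists>\<tau>\<ge>0. \<tau> \<le> 1 \<and> det (G \<tau>) = 0"
    using neg by (intro IVT2' cont) (auto simp: G_def)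
  then obtain \<tau> where \<tau>: "0 \<le> \<tau>" "\<tau> \<le> 1" "det (G \<tau>) = 0" by blast
  have "pos_def (G \<tau>)"
    unfolding pos_def_def
  proof (intro allI impI)
    fix x :: "real ^ 'n" assume "x \<noteq> 0"
    then have "x \<bullet> (M *v x) > 0" "x \<bullet> x > 0"
      using assms by (auto simp: pos_def_def)
    moreover have "x \<bullet> (G \<tau> *v x) = (1 - \<tau>) * (x \<bullet> x) + \<tau> * (x \<bullet> (M *v x))"
      by (simp add: G_def matrix_vector_mult_add_rdistrib inner_add_right
          flip: scaleR_matrix_vector_assoc)
    ultimately show "x \<bullet> (G \<tau> *v x) > 0"
      using \<tau> by (cases "\<tau> = 0") (auto intro!: add_nonneg_pos)
  qed
  then show False
    using \<tau>(3) pos_def_invertible invertible_det_nz by blast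
qed

lemma subvec_add_compl: "subvec K x + subvec (- K) x = x"
  by (simp add: subvec_def vec_eq_iff)

lemma subvec_subvec [simp]: "subvec K (subvec K x) = subvec K x"
  by (simp add: subvec_def vec_eq_iff)

lemma inner_subvec: "subvec K x \<bullet> y = x \<bullet> subvec K y"
  unfolding subvec_def inner_vec_def by (intro sum.cong) auto

lemma pos_def_pad_one:
  fixes M :: "real ^ 'n::finite ^ 'n"
  assumes "pos_def M"
  shows "pos_def (pad_one K M)"
  unfolding pos_def_def
proof (intro allI impI)
  fix x :: "real ^ 'n" assume "x \<noteq> 0"
  have eq: "x \<bullet> (pad_one K M *v x) = subvec K x \<bullet> (M *v subvec K x) + subvec (-K) x \<bullet> subvec (-K) x"
    by (simp add: pad_one_eq matrix_vector_mult_add_rdistrib coord_proj_vec inner_add_right inner_subvec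
        flip: matrix_vector_mul_assoc)
  have nn: "subvec K x \<bullet> (M *v subvec K x) \<ge> 0" "subvec (-K) x \<bullet> subvec (-K) x \<ge> 0"
    using assms by (cases "subvec K x = 0"; force simp: pos_def_def)+
  show "x \<bullet> (pad_one K M *v x) > 0"
  proof (cases "subvec K x = 0")
    case True
    then have "subvec (-K) x \<noteq> 0"
      using \<open>x \<noteq> 0\<close> subvec_add_compl[of K x] by auto
    then show ?thesis using nn eq by (simp add: add_nonneg_pos)
  next
    case False
    then have "subvec K x \<bullet> (M *v subvec K x) > 0"
      using assms by (auto simp: pos_def_def)
    then show ?thesis unfolding eq using nn by (intro add_pos_nonneg)
  qed
qed


text \<open>
  For a Gaussian vector \<open>Z\<close> with covariance \<open>S\<close>, the vector \<open>regression S I *v Z\<^sub>I\<close> is the conditional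
  mean of \<open>Z\<^sub>J\<close> given \<open>Z\<^sub>I\<close>, where \<open>J = -I\<close>, and \<open>schur_complement S I\<close> is the conditional covariance.
\<close>

definition regression :: "real ^ 'n::finite ^ 'n \<Rightarrow> 'n set \<Rightarrow> real ^ 'n ^ 'n" where
  "regression S I = submat (-I) I S ** subinv I S"

definition schur_complement :: "real ^ 'n::finite ^ 'n \<Rightarrow> 'n set \<Rightarrow> real ^ 'n ^ 'n" where
  "schur_complement S I =
     submat (-I) (-I) S - submat (-I) I S ** subinv I S ** submat I (-I) S"

definition shear :: "real ^ 'n::finite ^ 'n \<Rightarrow> 'n set \<Rightarrow> real ^ 'n ^ 'n" where
  "shear S I = mat 1 + regression S I"

definition block_diag :: "real ^ 'n::finite ^ 'n \<Rightarrow> 'n set \<Rightarrow> real ^ 'n ^ 'n" where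
  "block_diag S I = submat I I S + schur_complement S I"

lemma subinv_mult_S:
  fixes S :: "real ^ 'n::finite ^ 'n"
  assumes "invertible (pad_one I S)"
  shows "subinv I S ** (S ** coord_proj I) = coord_proj I"
    and "coord_proj I ** (S ** subinv I S) = coord_proj I"
proof -
  have "subinv I S ** (S ** coord_proj I) = subinv I S ** coord_proj I ** (S ** coord_proj I)"
    by (simp only: subinv_coord_proj)
  also have "\<dots> = subinv I S ** submat I I S"
    by (simp add: submat_eq matrix_mul_assoc)
  finally show "subinv I S ** (S ** coord_proj I) = coord_proj I"
    by (simp only: subinv_mult[OF assms])
  have "coord_proj I ** (S ** subinv I S) = coord_proj I ** S ** (coord_proj I ** subinv I S)"
    by (simp only: subinv_coord_proj matrix_mul_assoc)
  also have "\<dots> = submat I I S ** subinv I S"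
    by (simp add: submat_eq matrix_mul_assoc)
  finally show "coord_proj I ** (S ** subinv I S) = coord_proj I"
    by (simp only: subinv_mult[OF assms])
qed

text \<open>
  Block elimination: subtracting the regression on the coordinates in \<open>I\<close> decorrelates the two
  blocks, so \<open>S\<close> is congruent, through a shear, to the block diagonal matrix with blocks \<open>S\<^sub>I\<^sub>I\<close> and
  the Schur complement.
\<close>

lemma block_ldl:
  fixes S :: "real ^ 'n::finite ^ 'n"
  assumes inv: "invertible (pad_one I S)" and sym: "transpose S = S"
  shows "S = shear S I ** block_diag S I ** transpose (shear S I)"
proof -
  define p j Q where "p = coord_proj I" and "j = coord_proj (-I)" and "Q = subinv I S"
  \<comment> \<open>With all products bracketed to the right, these rules rewrite inside longer products.\<close>
  have ab: "X ** (Y ** Z) = V ** Z" if "X ** Y = V" for X Y V Z :: "real ^ 'n ^ 'n"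
    using that by (simp add: matrix_mul_assoc)
  have ab3: "X ** (Y ** (Y' ** Z)) = V ** Z" if "X ** (Y ** Y') = V" for X Y Y' V Z :: "real ^ 'n ^ 'n"
    using that by (metis matrix_mul_assoc)
  have r0: "p ** p = p" "j ** j = j" "p ** j = 0" "j ** p = 0" "p ** Q = Q" "Q ** p = Q"
    unfolding p_def j_def Q_def by (simp_all only: coord_proj_idem coord_proj_compl subinv_coord_proj)
  have r1: "Q ** (S ** p) = p" "p ** (S ** Q) = p"
    unfolding p_def j_def Q_def by (rule subinv_mult_S[OF inv])+
  have r2: "j ** Q = 0" "Q ** j = 0"
    using r0 by (metis matrix_mul_assoc times0_left times0_right)+
  have r3: "Q ** (S ** Q) = Q"
    using r0 r1 by (metis matrix_mul_assoc)
  note rs = r0 r1 r2 r3 r0[THEN ab] r2[THEN ab] r1[THEN ab3] r3[THEN ab3]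
  have tr: "transpose Q = Q" "transpose j = j"
    by (simp_all add: Q_def j_def transpose_subinv inv sym transpose_coord_proj)
  have B: "regression S I = j ** (S ** Q)"
    by (simp add: regression_def submat_eq rs flip: p_def j_def Q_def matrix_mul_assoc)
  have E: "block_diag S I = p ** (S ** p) + (j ** (S ** j) - j ** (S ** (Q ** (S ** j))))"
    by (simp add: block_diag_def schur_complement_def submat_eq rs flip: p_def j_def Q_def matrix_mul_assoc)
  have Bt: "transpose (shear S I) = mat 1 + Q ** (S ** j)"
    by (simp add: shear_def B transpose_add matrix_transpose_mul tr sym flip: matrix_mul_assoc)
  have pj: "p + j = mat 1"
    by (simp add: p_def j_def coord_proj_add_compl)
  have "S = (p + j) ** (S ** (p + j))"
    by (simp add: pj)
  also have "\<dots> = p ** (S ** p) + p ** (S ** j) + j ** (S ** p) + j ** (S ** j)"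
    by (simp add: matrix_mult_simps)
  also have "\<dots> = shear S I ** block_diag S I ** transpose (shear S I)"
    unfolding Bt unfolding shear_def B E
    by (simp add: matrix_mult_simps rs flip: matrix_mul_assoc)
  finally show ?thesis .
qed

lemma schur_complement_coord_proj:
  "coord_proj (-I) ** schur_complement S I = schur_complement S I"
  "schur_complement S I ** coord_proj (-I) = schur_complement S I"
proof -
  define p j where "p = coord_proj I" and "j = coord_proj (-I)"
  have jj: "j ** j = j" "j ** (j ** X) = j ** X" for X
    unfolding j_def by (simp_all only: coord_proj_idem matrix_mul_assoc)
  show "coord_proj (-I) ** schur_complement S I = schur_complement S I"
    "schur_complement S I ** coord_proj (-I) = schur_complement S I"
    by (simp_all add: schur_complement_def submat_eq jj matrix_mult_simps
        flip: p_def j_def matrix_mul_assoc)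
qed

lemma submat_schur_complement: "submat (-I) (-I) (schur_complement S I) = schur_complement S I"
  by (simp only: submat_eq schur_complement_coord_proj)

lemma coord_proj_schur_complement:
  "coord_proj I ** schur_complement S I = 0" "schur_complement S I ** coord_proj I = 0"
  by (metis schur_complement_coord_proj coord_proj_compl matrix_mul_assoc times0_left times0_right)+

lemma block_diag_eq_pad_one_mult:
  "block_diag S I = pad_one I S ** pad_one (-I) (schur_complement S I)"
proof -
  define p j where "p = coord_proj I" and "j = coord_proj (-I)"
  have ab: "X ** (Y ** Z) = V ** Z" if "X ** Y = V" for X Y V Z :: "real ^ 'n ^ 'n"
    using that by (simp add: matrix_mul_assoc)
  have r0: "p ** p = p" "j ** j = j" "p ** j = 0" "j ** p = 0"
    unfolding p_def j_def by (simp_all only: coord_proj_idem coord_proj_compl)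
  have pad: "pad_one (-I) (schur_complement S I) = schur_complement S I + p"
    unfolding pad_one_eq submat_eq[symmetric] submat_schur_complement by (simp add: p_def)
  have "p ** schur_complement S I = 0" "j ** schur_complement S I = schur_complement S I"
    unfolding p_def j_def by (simp_all only: coord_proj_schur_complement schur_complement_coord_proj)
  then show ?thesis
    unfolding pad by (simp add: block_diag_def pad_one_eq submat_eq r0 r0[THEN ab] matrix_mult_simps
        flip: p_def j_def matrix_mul_assoc)
qed

lemma subinv_sum_mult_block_diag:
  assumes "invertible (pad_one I S)" "invertible (pad_one (-I) (schur_complement S I))"
  shows "(subinv I S + subinv (-I) (schur_complement S I)) ** block_diag S I = mat 1"
proof -
  let ?C = "schur_complement S I"
  have "subinv I S ** ?C = subinv I S ** (coord_proj I ** ?C)"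
    by (simp only: matrix_mul_assoc subinv_coord_proj)
  then have 1: "subinv I S ** ?C = 0"
    by (simp add: coord_proj_schur_complement)
  have "subinv (-I) ?C ** submat I I S = subinv (-I) ?C ** (coord_proj (-I) ** coord_proj I) ** S ** coord_proj I"
    by (simp only: matrix_mul_assoc subinv_coord_proj submat_eq)
  then have 2: "subinv (-I) ?C ** submat I I S = 0"
    by (simp add: coord_proj_compl)
  have 3: "subinv (-I) ?C ** ?C = coord_proj (-I)"
    using subinv_mult(1)[OF assms(2)] unfolding submat_schur_complement .
  show ?thesis
    by (simp add: block_diag_def matrix_mult_simps 1 2 3 subinv_mult(1)[OF assms(1)] coord_proj_add_compl)
qed

text \<open>
  The matrix \<open>W\<close> is \<open>A\<close> transposed and inverted, times the shear. It carries block coordinates to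
  spherical ones: multiplication by the transpose of \<open>A\<close> turns \<open>W\<close> into the shear, while the squared
  length of \<open>W *v v\<close> splits into one quadratic form for each block. Comparing determinants also gives
  the sign of the determinant of the Schur complement.
\<close>

theorem whitening:
  fixes S A :: "real ^ 'n::finite ^ 'n"
  assumes A: "invertible A" "S = transpose A ** A" and S: "pos_def S"
  obtains W where "transpose A ** W = shear S I" "invertible W"
    "transpose W ** W = subinv I S + subinv (-I) (schur_complement S I)"
    "(det W)\<^sup>2 * (subdet I S * subdet (-I) (schur_complement S I)) = 1"
    "subdet I S > 0" "subdet (-I) (schur_complement S I) > 0"
proof
  let ?C = "schur_complement S I" and ?At = "transpose A" and ?E = "block_diag S I" and ?T = "shear S I"
  define W where "W = matrix_inv ?At ** ?T"
  have sym: "transpose S = S"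
    by (simp add: A(2) matrix_transpose_mul)
  have padI: "pos_def (pad_one I S)"
    by (rule pos_def_pad_one[OF S])
  have At: "invertible ?At"
    using A(1) by (simp add: invertible_det_nz det_transpose)
  show AW: "?At ** W = ?T"
    by (simp add: W_def matrix_mul_assoc matrix_inv_mult At)
  have TW: "transpose ?T = transpose W ** A"
    by (simp add: matrix_transpose_mul flip: AW)
  have "mat 1 = matrix_inv ?At ** (?At ** A) ** matrix_inv A"
    by (simp add: matrix_mul_assoc matrix_inv_mult At)
       (simp add: matrix_inv_mult A flip: matrix_mul_assoc)
  also have "?At ** A = ?T ** ?E ** transpose ?T"
    using block_ldl[OF pos_def_invertible[OF padI] sym] A(2) by simp
  also have "matrix_inv ?At ** (?T ** ?E ** transpose ?T) ** matrix_inv A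
      = W ** ?E ** (transpose W ** (A ** matrix_inv A))"
    unfolding TW by (simp only: W_def matrix_mul_assoc)
  finally have 1: "W ** ?E ** transpose W = mat 1"
    by (simp add: matrix_inv_mult A)
  then have "transpose W ** W ** ?E = mat 1"
    unfolding matrix_left_right_inverse[of "W ** ?E"] by (simp only: matrix_mul_assoc)
  then have 3: "?E ** (transpose W ** W) = mat 1"
    unfolding matrix_left_right_inverse[of "transpose W ** W"] .
  have detE: "det ?E = subdet I S * subdet (-I) ?C"
    by (simp add: block_diag_eq_pad_one_mult det_mul subdet_def)
  show detW: "(det W)\<^sup>2 * (subdet I S * subdet (-I) ?C) = 1"
    using arg_cong[OF 1, of det] by (simp add: det_mul det_transpose detE power2_eq_square mult_ac)
  then have nz: "subdet (-I) ?C \<noteq> 0" "det W \<noteq> 0"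
    by auto
  then show "invertible W"
    by (simp add: invertible_det_nz)
  show pos: "subdet I S > 0"
    unfolding subdet_def by (rule pos_def_det[OF padI])
  show "subdet (-I) ?C > 0"
  proof (rule ccontr)
    assume "\<not> subdet (-I) ?C > 0"
    then have "(det W)\<^sup>2 * (subdet I S * subdet (-I) ?C) \<le> 0"
      using pos by (intro mult_nonneg_nonpos) (auto intro: mult_nonneg_nonpos)
    then show False using detW by simp
  qed
  have "invertible (pad_one (-I) ?C)"
    using nz by (simp add: invertible_det_nz subdet_def)
  from subinv_sum_mult_block_diag[OF pos_def_invertible[OF padI] this]
  have 4: "(subinv I S + subinv (-I) ?C) ** ?E = mat 1" .
  have "transpose W ** W = (subinv I S + subinv (-I) ?C) ** ?E ** (transpose W ** W)"
    by (simp only: 4 matrix_mul_lid)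
  also have "\<dots> = (subinv I S + subinv (-I) ?C) ** (?E ** (transpose W ** W))"
    by (simp only: matrix_mul_assoc)
  finally show "transpose W ** W = subinv I S + subinv (-I) ?C"
    by (simp only: 3 matrix_mul_rid)
qed

lemma regression_mult_subvec: "regression S I *v subvec I y = regression S I *v y"
  by (simp add: regression_def coord_proj_vec[symmetric] matrix_vector_mul_assoc
      subinv_coord_proj flip: matrix_mul_assoc)

lemma regression_vec:
  "regression S I *v y = submat (-I) I S *v (subinv I S *v y)"
  by (simp add: regression_def matrix_vector_mul_assoc)

lemma shear_vec_nth:
  "(shear S I *v y) $ i = (if i \<in> I then y $ i else y $ i + (regression S I *v subvec I y) $ i)"
proof -
  have "(regression S I *v z) $ i = 0" if "i \<in> I" for z
    using that by (simp add: regression_vec) (simp add: matrix_vector_mult_def submat_def)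
  then show ?thesis
    by (simp add: shear_def matrix_vector_mult_add_rdistrib regression_mult_subvec)
qed

lemma subinv_mult_subvec: "subinv K M *v subvec K y = subinv K M *v y"
  by (simp add: coord_proj_vec[symmetric] matrix_vector_mul_assoc subinv_coord_proj)

lemma subvec_subinv: "subvec K (subinv K M *v y) = subinv K M *v y"
  by (simp add: coord_proj_vec[symmetric] matrix_vector_mul_assoc subinv_coord_proj)

section \<open>Lebesgue measure under linear maps\<close>

lemma Basis_cart: "(Basis :: (real ^ 'n::finite) set) = range (\<lambda>i. axis i 1)"
  by (auto simp: Basis_vec_def)

lemma prod_Basis_cart:
  fixes g :: "real ^ 'n::finite \<Rightarrow> 'b::comm_monoid_mult"
  shows "(\<Prod>b\<in>Basis. g b) = (\<Prod>i\<in>UNIV. g (axis i 1))"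
  unfolding Basis_cart by (subst prod.reindex) (auto simp: inj_on_def axis_eq_axis)

lemma measurable_vec_lambda [measurable (raw)]:
  fixes f :: "'b \<Rightarrow> 'n::finite \<Rightarrow> real"
  assumes "\<And>i. (\<lambda>x. f x i) \<in> borel_measurable M"
  shows "(\<lambda>x. \<chi> i. f x i) \<in> borel_measurable (M :: 'b measure)"
  unfolding borel_measurable_euclidean_space[where f = "\<lambda>x. \<chi> i. f x i"]
  using assms by (auto simp: Basis_cart inner_axis)

lemma measurable_vec_nth [measurable (raw)]:
  "f \<in> borel_measurable M \<Longrightarrow> (\<lambda>x. f x $ i) \<in> borel_measurable M"
  for f :: "'b \<Rightarrow> real ^ 'n::finite"
  by (rule measurable_compose[where N = borel])
     (auto intro!: borel_measurable_continuous_onI continuous_intros)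

lemma measurable_matrix_vector_mult [measurable (raw)]:
  fixes M :: "real ^ 'n::finite ^ 'm::finite"
  assumes "f \<in> borel_measurable N"
  shows "(\<lambda>x. M *v f x) \<in> borel_measurable N"
  using assms unfolding matrix_vector_mult_def by measurable

text \<open>
  This identification with a product measure makes Fubini's theorem available one coordinate, or one
  block of coordinates, at a time.
\<close>

lemma lborel_cart_eq_PiM:
  "(lborel :: (real ^ 'n::finite) measure) = distr (Pi\<^sub>M UNIV (\<lambda>_. lborel)) borel (\<lambda>f. \<chi> i. f i)"
proof (rule lborel_eqI)
  interpret product_sigma_finite "\<lambda>_ :: 'n. lborel :: real measure" ..
  fix l u :: "real ^ 'n"
  assume lu: "\<And>b. b \<in> Basis \<Longrightarrow> l \<bullet> b \<le> u \<bullet> b"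
  have le: "l $ i \<le> u $ i" for i
    using lu[of "axis i 1"] by (simp add: inner_axis)
  have "(\<lambda>f. \<chi> i. f i) -` box l u \<inter> space (Pi\<^sub>M UNIV (\<lambda>_. lborel)) = (\<Pi>\<^sub>E i\<in>UNIV. {l $ i <..< u $ i})"
    by (auto simp: space_PiM mem_box_cart PiE_iff)
  then have "emeasure (distr (Pi\<^sub>M UNIV (\<lambda>_. lborel)) borel (\<lambda>f. \<chi> i. f i)) (box l u)
      = (\<Prod>i\<in>UNIV. emeasure lborel {l $ i <..< u $ i})"
    by (subst emeasure_distr) (simp_all add: emeasure_PiM)
  also have "\<dots> = ennreal (\<Prod>i\<in>UNIV. u $ i - l $ i)"
    by (simp add: le prod_ennreal)
  also have "(\<Prod>i\<in>UNIV. u $ i - l $ i) = (\<Prod>b\<in>Basis. (u - l) \<bullet> b)"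
    by (simp add: prod_Basis_cart inner_axis)
  finally show "emeasure (distr (Pi\<^sub>M UNIV (\<lambda>_. lborel)) borel (\<lambda>f. \<chi> i. f i)) (box l u) =
    ennreal (\<Prod>b\<in>Basis. (u - l) \<bullet> b)" .
qed simp

lemma nn_integral_lborel_cart:
  fixes f :: "real ^ 'n::finite \<Rightarrow> ennreal"
  assumes [measurable]: "f \<in> borel_measurable borel"
  shows "(\<integral>\<^sup>+y. f y \<partial>lborel) = (\<integral>\<^sup>+h. f (\<chi> i. h i) \<partial>Pi\<^sub>M UNIV (\<lambda>_. lborel))"
  by (subst lborel_cart_eq_PiM) (simp add: nn_integral_distr)

lemma nn_integral_lborel_permute:
  fixes f :: "real ^ 'n::finite \<Rightarrow> ennreal"
  assumes [measurable]: "f \<in> borel_measurable borel" and p: "p permutes UNIV"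
  shows "(\<integral>\<^sup>+y. f y \<partial>lborel) = (\<integral>\<^sup>+y. f (\<chi> i. y $ p i) \<partial>lborel)"
proof -
  have "(lborel :: (real ^ 'n) measure) = distr lborel borel (\<lambda>y. \<chi> i. y $ p i)"
  proof (rule lborel_eqI)
    fix l u :: "real ^ 'n"
    assume lu: "\<And>b. b \<in> Basis \<Longrightarrow> l \<bullet> b \<le> u \<bullet> b"
    define q where "q = inv p"
    have qp: "q (p i) = i" "p (q i) = i" for i
      using p by (simp_all add: q_def permutes_inverses)
    have le: "l $ i \<le> u $ i" for i
      using lu[of "axis i 1"] by (simp add: inner_axis)
    have "(\<lambda>y. \<chi> i. y $ p i) -` box l u = box (\<chi> i. l $ q i) (\<chi> i. u $ q i)"
      by (auto simp: mem_box_cart) (metis qp)+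
    then have "emeasure (distr lborel borel (\<lambda>y. \<chi> i. y $ p i)) (box l u)
        = emeasure lborel (box (\<chi> i. l $ q i) (\<chi> i. u $ q i))"
      by (subst emeasure_distr) simp_all
    also have "\<dots> = ennreal (\<Prod>i\<in>UNIV. u $ q i - l $ q i)"
      by (subst emeasure_lborel_box; (subst prod_Basis_cart)?) (auto simp: inner_axis le Basis_cart)
    also have "(\<Prod>i\<in>UNIV. u $ q i - l $ q i) = (\<Prod>i\<in>UNIV. u $ i - l $ i)"
      using permutes_bij[OF permutes_inv[OF p]]
      by (intro prod.reindex_bij_betw) (simp add: q_def)
    also have "\<dots> = (\<Prod>b\<in>Basis. (u - l) \<bullet> b)"
      by (simp add: prod_Basis_cart inner_axis)
    finally show "emeasure (distr lborel borel (\<lambda>y. \<chi> i. y $ p i)) (box l u) =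
      ennreal (\<Prod>b\<in>Basis. (u - l) \<bullet> b)" .
  qed simp
  then have "(\<integral>\<^sup>+y. f y \<partial>lborel) = (\<integral>\<^sup>+y. f y \<partial>distr lborel borel (\<lambda>y. \<chi> i. y $ p i))"
    by simp
  then show ?thesis
    by (simp add: nn_integral_distr)
qed

text \<open>
  Integrate over coordinate \<open>m\<close> first: for fixed other coordinates the map is a translation.
\<close>

lemma nn_integral_lborel_shear:
  fixes f :: "real ^ 'n::finite \<Rightarrow> ennreal"
  assumes [measurable]: "f \<in> borel_measurable borel" and mn: "m \<noteq> n"
  shows "(\<integral>\<^sup>+y. f y \<partial>lborel) = (\<integral>\<^sup>+y. f (\<chi> i. if i = m then y $ m + c * y $ n else y $ i) \<partial>lborel)"
proof -
  interpret product_sigma_finite "\<lambda>_ :: 'n. lborel :: real measure" ..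
  let ?J = "UNIV - {m}" and ?F = "\<lambda>h. f (\<chi> i. h i)"
  have un: "insert m ?J = UNIV" by auto
  have m1: "?F \<in> borel_measurable (Pi\<^sub>M (insert m ?J) (\<lambda>_. lborel))"
    unfolding un by simp
  have m2: "(\<lambda>h. ?F (\<lambda>i. if i = m then h m + c * h n else h i)) \<in> borel_measurable (Pi\<^sub>M (insert m ?J) (\<lambda>_. lborel))"
    unfolding un by simp
  have "(\<integral>\<^sup>+y. f y \<partial>lborel) = (\<integral>\<^sup>+h. ?F h \<partial>Pi\<^sub>M UNIV (\<lambda>_. lborel))"
    by (simp add: nn_integral_lborel_cart)
  also have "\<dots> = (\<integral>\<^sup>+h. (\<integral>\<^sup>+t. ?F (h(m := t)) \<partial>lborel) \<partial>Pi\<^sub>M ?J (\<lambda>_. lborel))"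
    using product_nn_integral_insert[OF _ _ m1] by (simp add: un)
  also have "\<dots> = (\<integral>\<^sup>+h. (\<integral>\<^sup>+t. ?F (h(m := c * h n + t)) \<partial>lborel) \<partial>Pi\<^sub>M ?J (\<lambda>_. lborel))"
  proof (rule nn_integral_cong)
    fix h :: "'n \<Rightarrow> real"
    have "(\<lambda>t. ?F (h(m := t))) \<in> borel_measurable borel"
      by (simp add: fun_upd_def)
    from nn_integral_real_affine[OF this, of 1 "c * h n"]
    show "(\<integral>\<^sup>+t. ?F (h(m := t)) \<partial>lborel) = (\<integral>\<^sup>+t. ?F (h(m := c * h n + t)) \<partial>lborel)"
      by simp
  qed
  also have "\<dots> = (\<integral>\<^sup>+h. (\<integral>\<^sup>+t. ?F (\<lambda>i. if i = m then (h(m := t)) m + c * (h(m := t)) n else (h(m := t)) i) \<partial>lborel)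
      \<partial>Pi\<^sub>M ?J (\<lambda>_. lborel))"
  proof (intro nn_integral_cong)
    fix h :: "'n \<Rightarrow> real" and t
    have "(\<chi> i. (h(m := c * h n + t)) i) = (\<chi> i. if i = m then (h(m := t)) m + c * (h(m := t)) n else (h(m := t)) i)"
      using mn by (auto simp: vec_eq_iff)
    then show "?F (h(m := c * h n + t)) = ?F (\<lambda>i. if i = m then (h(m := t)) m + c * (h(m := t)) n else (h(m := t)) i)"
      by (simp only:)
  qed
  also have "\<dots> = (\<integral>\<^sup>+h. ?F (\<lambda>i. if i = m then h m + c * h n else h i) \<partial>Pi\<^sub>M UNIV (\<lambda>_. lborel))"
    using product_nn_integral_insert[OF _ _ m2] by (simp add: un)
  also have "\<dots> = (\<integral>\<^sup>+y. f (\<chi> i. if i = m then y $ m + c * y $ n else y $ i) \<partial>lborel)"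
    by (subst nn_integral_lborel_cart) (simp_all cong: if_cong)
  finally show ?thesis .
qed

text \<open>
  Every square matrix is a product of elementary ones, and the formula is multiplicative. It remains
  to check diagonal matrices, transpositions of two coordinates and elementary shears; a matrix with
  a zero row is excluded by its determinant.
\<close>

theorem nn_integral_lborel_linear:
  fixes M :: "real ^ 'n::finite ^ 'n" and f :: "real ^ 'n::finite \<Rightarrow> ennreal"
  assumes "f \<in> borel_measurable borel" and "det M \<noteq> 0"
  shows "(\<integral>\<^sup>+y. f y \<partial>lborel) = ennreal \<bar>det M\<bar> * (\<integral>\<^sup>+y. f (M *v y) \<partial>lborel)"
  using assms
proof (induction M arbitrary: f rule: induct_matrix_elementary[case_names mult zero_row diagonal swap1 idplus])
  case (mult A B)
  have [measurable]: "f \<in> borel_measurable borel" by fact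
  have "det A \<noteq> 0" "det B \<noteq> 0"
    using mult.prems by (auto simp: det_mul)
  then have "(\<integral>\<^sup>+y. f y \<partial>lborel)
      = ennreal \<bar>det A\<bar> * (ennreal \<bar>det B\<bar> * (\<integral>\<^sup>+y. f (A *v (B *v y)) \<partial>lborel))"
    using mult.IH(1)[of f] mult.IH(2)[of "\<lambda>y. f (A *v y)"] by simp
  then show ?case
    by (simp add: det_mul abs_mult ennreal_mult matrix_vector_mul_assoc mult.assoc)
next
  case (zero_row A i)
  then show ?case
    using det_zero_row(2) by blast
next
  case (diagonal A)
  have [measurable]: "f \<in> borel_measurable borel" by fact
  have det: "det A = (\<Prod>i\<in>UNIV. A $ i $ i)"
    by (rule det_diagonal) (use diagonal in auto)
  with diagonal.prems have nz: "A $ i $ i \<noteq> 0" for i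
    by auto
  define c where "c b = (\<Sum>i\<in>UNIV. A $ i $ i * b $ i)" for b :: "real ^ 'n"
  have c: "c (axis i 1) = A $ i $ i" for i
    by (simp add: c_def axis_def if_distrib[where f = "\<lambda>x. _ * x"] cong: if_cong)
  have T: "0 + (\<Sum>j\<in>Basis. (c j * (y \<bullet> j)) *\<^sub>R j) = A *v y" for y
  proof -
    have "(\<Sum>j\<in>Basis. (c j * (y \<bullet> j)) *\<^sub>R j) = (\<Sum>i\<in>UNIV. (A $ i $ i * y $ i) *\<^sub>R axis i 1)"
      unfolding Basis_cart by (subst sum.reindex) (auto simp: inj_on_def axis_eq_axis c inner_axis)
    also have "\<dots> = A *v y"
    proof -
      have "(A *v y) $ k = A $ k $ k * y $ k" for k
      proof -
        have "(\<Sum>j\<in>UNIV. A $ k $ j * y $ j) = (\<Sum>j\<in>UNIV. if j = k then A $ k $ k * y $ k else 0)"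
          using diagonal(1) by (intro sum.cong) auto
        then show ?thesis by (simp add: matrix_vector_mult_def)
      qed
      then show ?thesis
        by (simp add: vec_eq_iff sum_component axis_def if_distrib[where f = "\<lambda>x. _ * x"] cong: if_cong)
    qed
    finally show ?thesis by simp
  qed
  have "(lborel :: (real ^ 'n) measure) = density (distr lborel borel (\<lambda>y. 0 + (\<Sum>j\<in>Basis. (c j * (y \<bullet> j)) *\<^sub>R j)))
      (\<lambda>_. (\<Prod>j\<in>Basis. \<bar>c j\<bar>))"
    by (rule lborel_affine_euclidean) (auto simp: Basis_cart c nz)
  also have "\<dots> = density (distr lborel borel (\<lambda>y. A *v y)) (\<lambda>_. ennreal \<bar>det A\<bar>)"
    unfolding T by (simp add: prod_Basis_cart c det abs_prod)
  finally have "(\<integral>\<^sup>+y. f y \<partial>lborel) = (\<integral>\<^sup>+y. f y \<partial>density (distr lborel borel (\<lambda>y. A *v y)) (\<lambda>_. ennreal \<bar>det A\<bar>))"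
    by simp
  also have "\<dots> = ennreal \<bar>det A\<bar> * (\<integral>\<^sup>+y. f (A *v y) \<partial>lborel)"
    by (simp add: nn_integral_density nn_integral_distr nn_integral_cmult)
  finally show ?case .
next
  case (swap1 m n)
  let ?p = "Transposition.transpose m n"
  have p: "?p permutes UNIV"
    by (simp add: permutes_swap_id)
  have d: "\<bar>det ((\<chi> i j. mat 1 $ i $ ?p j) :: real ^ 'n ^ 'n)\<bar> = 1"
    using det_permute_columns[OF p, of "mat 1 :: real ^ 'n ^ 'n"] by (simp add: sign_def)
  have "(\<chi> i j. mat 1 $ i $ ?p j) *v y = (\<chi> i. y $ ?p i)" for y :: "real ^ 'n"
  proof -
    have "(\<Sum>j\<in>UNIV. (if i = ?p j then 1 else 0) * y $ j) = (\<Sum>j\<in>UNIV. if j = ?p i then y $ j else 0)" for i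
      by (intro sum.cong) (auto simp: transpose_eq_iff)
    then show ?thesis
      by (simp add: vec_eq_iff matrix_vector_mult_def mat_def)
  qed
  then show ?case
    using nn_integral_lborel_permute[OF swap1(2) p] by (simp add: d)
next
  case (idplus m n c)
  let ?A = "(\<chi> i j. if i = m \<and> j = n then c else of_bool (i = j)) :: real ^ 'n ^ 'n"
  have "?A = (\<chi> k. if k = m then row m (mat 1) + c *s row n (mat 1) else row k (mat 1))"
    using idplus(1) by (auto simp: vec_eq_iff row_def mat_def)
  then have d: "det ?A = 1"
    using det_row_operation[OF idplus(1), of "mat 1 :: real ^ 'n ^ 'n" c] by simp
  have "?A *v y = (\<chi> i. if i = m then y $ m + c * y $ n else y $ i)" for y
  proof -
    have "(\<Sum>j\<in>UNIV. (if i = m \<and> j = n then c else of_bool (i = j)) * y $ j)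
      = (\<Sum>j\<in>UNIV. (if i = m \<and> j = n then c * y $ j else 0) + (if j = i then y $ j else 0))" for i
      using idplus(1) by (intro sum.cong) auto
    then show ?thesis
      by (simp add: vec_eq_iff matrix_vector_mult_def sum.distrib)
  qed
  then show ?case
    using nn_integral_lborel_shear[OF idplus(2,1), of c] by (simp add: d)
qed

lemma nn_integral_lborel_affine:
  fixes M :: "real ^ 'n::finite ^ 'n" and f :: "real ^ 'n::finite \<Rightarrow> ennreal"
  assumes [measurable]: "f \<in> borel_measurable borel" and M: "det M \<noteq> 0"
  shows "(\<integral>\<^sup>+y. f y \<partial>lborel) = ennreal \<bar>det M\<bar> * (\<integral>\<^sup>+y. f (c + M *v y) \<partial>lborel)"
proof -
  have "(\<integral>\<^sup>+y. f y \<partial>lborel) = (\<integral>\<^sup>+y. f y \<partial>distr lborel borel ((+) c))"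
    by (simp add: lborel_distr_plus)
  also have "\<dots> = (\<integral>\<^sup>+y. f (c + y) \<partial>lborel)"
    by (simp add: nn_integral_distr)
  also have "\<dots> = ennreal \<bar>det M\<bar> * (\<integral>\<^sup>+y. f (c + M *v y) \<partial>lborel)"
    by (rule nn_integral_lborel_linear) (use M in auto)
  finally show ?thesis .
qed

section \<open>Polar coordinates for the uniform law on the sphere\<close>

lemma nn_integral_lborel_scale:
  fixes f :: "'a::euclidean_space \<Rightarrow> ennreal"
  assumes [measurable]: "f \<in> borel_measurable borel" and "s > 0"
  shows "(\<integral>\<^sup>+y. f y \<partial>lborel) = ennreal (s ^ DIM('a)) * (\<integral>\<^sup>+y. f (s *\<^sub>R y) \<partial>lborel)"
  using \<open>s > 0\<close> by (subst lborel_affine[of s 0])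
    (simp_all add: nn_integral_density nn_integral_distr nn_integral_cmult)

lemma nn_integral_inverse_power:
  assumes "a > 0" "n > 0"
  shows "(\<integral>\<^sup>+s. ennreal (1 / s ^ Suc n) * indicator {a<..} s \<partial>lborel) = ennreal (1 / (real n * a ^ n))"
proof -
  have "(\<integral>\<^sup>+s. ennreal (1 / s ^ Suc n) * indicator {a<..} s \<partial>lborel)
      = (\<integral>\<^sup>+s. ennreal (1 / s ^ Suc n) * indicator {a..} s \<partial>lborel)"
    using AE_lborel_singleton[of a]
    by (intro nn_integral_cong_AE) (auto simp: indicator_def elim!: eventually_mono)
  also have "\<dots> = ennreal (0 - (- (1 / (real n * a ^ n))))"
  proof (rule nn_integral_FTC_atLeast)
    show "DERIV (\<lambda>s. - (1 / (real n * s ^ n))) s :> 1 / s ^ Suc n" if "a \<le> s" for s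
    proof -
      have "s > 0" using that assms by simp
      obtain l where "n = Suc l" using assms by (cases n) auto
      have "DERIV (\<lambda>s. - (1 / real n) * inverse s ^ n) s :> - (1 / real n) * (real n * inverse s ^ l * - (inverse s)\<^sup>2)"
        using DERIV_cmult[OF DERIV_power[OF DERIV_inverse, of s n], of "- (1 / real n)"] \<open>s > 0\<close> \<open>n = Suc l\<close>
        by (simp add: power2_eq_square mult_ac)
      also have "- (1 / real n) * (real n * inverse s ^ l * - (inverse s)\<^sup>2) = 1 / s ^ Suc n"
        using assms \<open>n = Suc l\<close> by (simp add: field_simps power2_eq_square)
      finally show ?thesis
        using assms by (simp add: field_simps)
    qed
    have "((\<lambda>s. - (1 / real n * inverse s ^ n)) \<longlongrightarrow> - (1 / real n * 0 ^ n)) at_top"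
      by (intro tendsto_intros tendsto_inverse_0_at_top filterlim_ident)
    then show "((\<lambda>s. - (1 / (real n * s ^ n))) \<longlongrightarrow> 0) at_top"
      using assms by (simp add: field_simps power_0_left)
  qed (use assms in auto)
  finally show ?thesis by simp
qed

text \<open>
  Polar coordinates, with the uniform law of the sphere obtained by normalising a uniform point \<open>x\<close>
  of the ball. Substituting \<open>r = s * norm x\<close> removes the normalisation; after exchanging the
  integrals, \<open>y = s *\<^sub>R x\<close> turns the inner integral into one over the ball of radius \<open>s\<close>, and the
  remaining integral over \<open>s > norm y\<close> of an inverse power of \<open>s\<close> cancels the weight \<open>norm y ^ d\<close>.
\<close>

theorem nn_integral_polar:
  fixes h :: "real ^ 'n::finite \<Rightarrow> ennreal"
  assumes [measurable]: "h \<in> borel_measurable borel"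
  defines "d \<equiv> CARD('n)"
  shows "ennreal (real d * unit_ball_vol d) *
      (\<integral>\<^sup>+u. (\<integral>\<^sup>+r. indicator {0<..} r * ennreal (r ^ (d - 1)) * h (r *\<^sub>R u) \<partial>lborel) \<partial>uniform_sphere)
    = (\<integral>\<^sup>+z. h z \<partial>lborel)"
proof -
  have d: "d > 0" "DIM(real ^ 'n) = d"
    by (simp_all add: d_def)
  have pd: "x * x ^ (d - Suc 0) = x ^ d" for x :: real
    using d by (simp add: power_eq_if)
  let ?B = "ball 0 1 :: (real ^ 'n) set"
  let ?P = "\<lambda>s x. indicator {0<..} s * ennreal (s ^ (d - 1)) * ennreal (norm x ^ d) * h (s *\<^sub>R x) * indicator ?B x"
    and ?Q = "\<lambda>s y. indicator {0<..} s * ennreal (1 / s ^ Suc d) * ennreal (norm y ^ d) * h y * (if norm y < s then 1 else 0)"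
  have vol: "emeasure lborel ?B = ennreal (unit_ball_vol d)" "unit_ball_vol d > 0"
    using emeasure_ball[of 1 "0 :: real ^ 'n"] by (simp_all add: d_def)
  have [measurable]: "?B \<in> sets borel" by simp
  define F where "F u = (\<integral>\<^sup>+r. indicator {0<..} r * ennreal (r ^ (d - 1)) * h (r *\<^sub>R u) \<partial>lborel)" for u
  have [measurable]: "F \<in> borel_measurable borel"
    unfolding F_def by measurable
  have "(\<integral>\<^sup>+u. F u \<partial>uniform_sphere) = (\<integral>\<^sup>+x. F (x /\<^sub>R norm x) * indicator ?B x \<partial>lborel) / ennreal (unit_ball_vol d)"
    unfolding uniform_sphere_def by (subst nn_integral_distr) (simp_all add: nn_integral_uniform_measure vol)
  moreover have v: "ennreal (unit_ball_vol d) * (I / ennreal (unit_ball_vol d)) = I" for I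
  proof -
    have "ennreal (unit_ball_vol d) \<noteq> 0"
      using vol(2) by (metis ennreal_eq_0_iff not_le)
    then show ?thesis
      by (simp add: ennreal_times_divide mult.commute[of _ I] ennreal_mult_divide_eq)
  qed
  ultimately have "ennreal (real d * unit_ball_vol d) * (\<integral>\<^sup>+u. F u \<partial>uniform_sphere)
      = ennreal d * (\<integral>\<^sup>+x. F (x /\<^sub>R norm x) * indicator ?B x \<partial>lborel)"
    using vol(2) by (simp add: ennreal_mult mult.assoc v)
  also have "(\<integral>\<^sup>+x. F (x /\<^sub>R norm x) * indicator ?B x \<partial>lborel)
      = (\<integral>\<^sup>+x. (\<integral>\<^sup>+s. ?P s x \<partial>lborel) \<partial>lborel)"
  proof (rule nn_integral_cong_AE)
    show "AE x in lborel. F (x /\<^sub>R norm x) * indicator ?B x = (\<integral>\<^sup>+s. ?P s x \<partial>lborel)"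
      using AE_lborel_singleton[of 0]
    proof eventually_elim
      case (elim x)
      then have nx: "norm x > 0" by simp
      have "F (x /\<^sub>R norm x) = ennreal (norm x) * (\<integral>\<^sup>+s. indicator {0<..} (norm x * s) * ennreal ((norm x * s) ^ (d - 1)) * h (s *\<^sub>R x) \<partial>lborel)"
        unfolding F_def using elim by (subst nn_integral_real_affine[of _ "norm x" 0]) (simp_all add: field_simps)
      also have "\<dots> = (\<integral>\<^sup>+s. ennreal (norm x) * (indicator {0<..} (norm x * s) * ennreal ((norm x * s) ^ (d - 1)) * h (s *\<^sub>R x)) \<partial>lborel)"
        by (simp add: nn_integral_cmult)
      also have "\<dots> = (\<integral>\<^sup>+s. indicator {0<..} s * ennreal (s ^ (d - 1)) * ennreal (norm x ^ d) * h (s *\<^sub>R x) \<partial>lborel)"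
      proof (intro nn_integral_cong)
        fix s :: real
        show "ennreal (norm x) * (indicator {0<..} (norm x * s) * ennreal ((norm x * s) ^ (d - 1)) * h (s *\<^sub>R x))
          = indicator {0<..} s * ennreal (s ^ (d - 1)) * ennreal (norm x ^ d) * h (s *\<^sub>R x)"
        proof (cases "s > 0")
          case True
          have "ennreal (norm x) * ennreal ((norm x * s) ^ (d - 1)) = ennreal (s ^ (d - 1)) * ennreal (norm x ^ d)"
            using True by (simp add: power_mult_distrib pd mult_ac flip: ennreal_mult)
          then show ?thesis
            using True nx by (simp add: indicator_def flip: mult.assoc)
        qed (use nx in \<open>simp add: indicator_def zero_less_mult_iff\<close>)
      qed
      finally show ?case
        by (simp add: nn_integral_multc)
    qed
  qed
  also have "\<dots> = (\<integral>\<^sup>+s. (\<integral>\<^sup>+x. ?P s x \<partial>lborel) \<partial>lborel)"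
    by (intro lborel_pair.Fubini') measurable
  also have "\<dots> = (\<integral>\<^sup>+s. (\<integral>\<^sup>+y. ?Q s y \<partial>lborel) \<partial>lborel)"
  proof (rule nn_integral_cong)
    fix s :: real
    show "(\<integral>\<^sup>+x. ?P s x \<partial>lborel)
      = (\<integral>\<^sup>+y. ?Q s y \<partial>lborel)"
    proof (cases "s > 0")
      case True
      have "(\<integral>\<^sup>+y. ?Q s y \<partial>lborel)
        = ennreal (s ^ d) * (\<integral>\<^sup>+y. ?Q s (s *\<^sub>R y) \<partial>lborel)"
        using True by (subst nn_integral_lborel_scale[of _ s]) (simp_all flip: d_def)
      also have "\<dots> = (\<integral>\<^sup>+y. ennreal (s ^ d) * (?Q s (s *\<^sub>R y)) \<partial>lborel)"
        by (simp add: nn_integral_cmult)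
      also have "\<dots> = (\<integral>\<^sup>+x. ?P s x \<partial>lborel)"
      proof (intro nn_integral_cong)
        fix y :: "real ^ 'n"
        have "s ^ d * (1 / s ^ Suc d * norm (s *\<^sub>R y) ^ d) = s ^ (d - 1) * norm y ^ d"
          using True d by (cases d) (auto simp: power_mult_distrib field_simps)
        then have "ennreal (s ^ d) * (ennreal (1 / s ^ Suc d) * ennreal (norm (s *\<^sub>R y) ^ d)) = ennreal (s ^ (d - 1)) * ennreal (norm y ^ d)"
          using True by (simp flip: ennreal_mult)
        moreover have "(if norm (s *\<^sub>R y) < s then 1 else 0) = (indicator ?B y :: ennreal)"
          using True by (auto simp: indicator_def)
        ultimately show "ennreal (s ^ d) * (?Q s (s *\<^sub>R y))
          = ?P s y"
          using True by (simp only: indicator_simps greaterThan_iff mult_1_left mult.assoc[symmetric])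
      qed
      finally show ?thesis by simp
    qed simp
  qed
  also have "\<dots> = (\<integral>\<^sup>+y. (\<integral>\<^sup>+s. ?Q s y \<partial>lborel) \<partial>lborel)"
    by (intro lborel_pair.Fubini'[symmetric]) measurable
  also have "\<dots> = (\<integral>\<^sup>+y. ennreal (1 / d) * h y \<partial>lborel)"
  proof (rule nn_integral_cong_AE)
    show "AE y in lborel. (\<integral>\<^sup>+s. ?Q s y \<partial>lborel) = ennreal (1 / d) * h y"
      using AE_lborel_singleton[of 0]
    proof eventually_elim
      case (elim y)
      then have ny: "norm y > 0" by simp
      have "(\<integral>\<^sup>+s. ?Q s y \<partial>lborel)
        = (\<integral>\<^sup>+s. (ennreal (norm y ^ d) * h y) * (ennreal (1 / s ^ Suc d) * indicator {norm y<..} s) \<partial>lborel)"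
        using order.strict_trans[OF ny] by (intro nn_integral_cong) (auto simp: indicator_def mult_ac)
      also have "\<dots> = ennreal (norm y ^ d) * h y * ennreal (1 / (d * norm y ^ d))"
        using ny d by (simp add: nn_integral_cmult nn_integral_inverse_power del: power_Suc)
      also have "\<dots> = ennreal (norm y ^ d * (1 / (d * norm y ^ d))) * h y"
        by (subst ennreal_mult) (auto simp: mult_ac)
      also have "norm y ^ d * (1 / (d * norm y ^ d)) = 1 / d"
        using ny by (simp add: field_simps)
      finally show ?case .
    qed
  qed
  also have "ennreal d * \<dots> = (\<integral>\<^sup>+y. h y \<partial>lborel)"
    using d by (simp add: nn_integral_cmult flip: ennreal_mult mult.assoc)
  finally show ?thesis
    unfolding F_def .
qed

lemma AE_uniform_sphere: "AE u in (uniform_sphere :: (real ^ 'n::finite) measure). norm u = 1"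
proof -
  have "AE x in uniform_measure lborel (ball 0 1 :: (real ^ 'n) set). x \<noteq> 0"
    by (rule AE_uniform_measureI) (use AE_lborel_singleton[of 0] in auto)
  then have "AE x in uniform_measure lborel (ball 0 1 :: (real ^ 'n) set). norm (x /\<^sub>R norm x) = 1"
    by eventually_elim simp
  then show ?thesis
    unfolding uniform_sphere_def by (subst AE_distr_iff) auto
qed

section \<open>Comparison of radial laws with equivalent tails\<close>

lemma upward_closed_cases:
  fixes V :: "real set"
  assumes up: "\<And>x y. x \<in> V \<Longrightarrow> x \<le> y \<Longrightarrow> y \<in> V" and V: "V \<subseteq> {r<..}"
  obtains "V = {}" | l where "V = {l<..}" "r \<le> l" | l where "V = {l..}" "r < l"
proof (cases "V = {}")
  case False
  define l where "l = Inf V"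
  have bdd: "bdd_below V"
    using V by (intro bdd_belowI[of _ r]) auto
  have gt: "{l<..} \<subseteq> V"
  proof
    fix y assume "y \<in> {l<..}"
    then obtain x where "x \<in> V" "x < y"
      using cInf_lessD[OF False, of y] by (auto simp: l_def)
    then show "y \<in> V" using up by simp
  qed
  have lower: "V \<subseteq> {l..}"
    using cInf_lower[OF _ bdd] by (auto simp: l_def)
  show ?thesis
  proof (cases "l \<in> V")
    case True
    then have "V = {l..}"
      using up lower by auto
    with True V show ?thesis
      by (intro that(3)[of l]) auto
  next
    case l: False
    then have eq: "V = {l<..}"
      using gt lower by (force simp: order.order_iff_strict)
    have "r \<le> l"
      using V unfolding eq by auto
    with eq show ?thesis by (rule that(2))
  qed
qed (rule that(1))

text \<open>
  For open half-lines this is the hypothesis; a closed half-line is a decreasing limit of open ones.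
\<close>

lemma tails_close_upward_closed:
  fixes \<alpha> \<mu> :: "real measure"
  assumes fin: "finite_measure \<alpha>" "finite_measure \<mu>" and sets[measurable_cong, simp]: "sets \<alpha> = sets borel" "sets \<mu> = sets borel"
    and tail: "\<And>u. u \<ge> r \<Longrightarrow> \<bar>measure \<alpha> {u<..} - measure \<mu> {u<..}\<bar> \<le> \<epsilon> * measure \<mu> {u<..}"
    and up: "\<And>x y. x \<in> V \<Longrightarrow> x \<le> y \<Longrightarrow> y \<in> V" and V: "V \<subseteq> {r<..}"
  shows "\<bar>measure \<alpha> V - measure \<mu> V\<bar> \<le> \<epsilon> * measure \<mu> V"
proof -
  consider "V = {}" | l where "V = {l<..}" "r \<le> l" | l where "V = {l..}" "r < l"
    by (rule upward_closed_cases[of V r]) (use up V in blast)+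
  then show ?thesis
  proof cases
    case (2 l)
    then show ?thesis using tail by simp
  next
    case (3 l)
    interpret \<alpha>: finite_measure \<alpha> by fact
    interpret \<mu>: finite_measure \<mu> by fact
    define u where "u n = l - (l - r) / real (Suc n)" for n
    have u: "u n < l" "r \<le> u n" for n
      using 3 by (auto simp: u_def field_simps intro!: mult_right_mono)
    have lim: "u \<longlonglongrightarrow> l"
    proof -
      have "(\<lambda>n. l - (l - r) / real (Suc n)) \<longlonglongrightarrow> l - 0"
        by (intro tendsto_diff tendsto_const) (rule LIMSEQ_Suc, rule lim_const_over_n)
      then show ?thesis by (simp add: u_def[abs_def])
    qed
    have dec: "decseq (\<lambda>n. {u n<..})"
    proof -
      have "u i \<le> u j" if "i \<le> j" for i j
        using 3 that by (auto simp: u_def intro!: divide_left_mono)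
      then show ?thesis
        by (auto simp: decseq_def intro: order.strict_trans1)
    qed
    have int: "(\<Inter>n. {u n<..}) = {l..}"
    proof (intro equalityI subsetI)
      fix x assume x: "x \<in> (\<Inter>n. {u n<..})"
      have "l \<le> x"
        by (rule LIMSEQ_le_const2[OF lim]) (use x in \<open>auto intro: less_imp_le\<close>)
      then show "x \<in> {l..}" by simp
    qed (auto intro: order.strict_trans2[OF u(1)])
    have rs: "range (\<lambda>n. {u n<..}) \<subseteq> sets borel" by auto
    have "(\<lambda>n. measure \<alpha> {u n<..}) \<longlonglongrightarrow> measure \<alpha> {l..}"
      using \<alpha>.finite_Lim_measure_decseq[OF _ dec] int rs by simp
    moreover have "(\<lambda>n. measure \<mu> {u n<..}) \<longlonglongrightarrow> measure \<mu> {l..}"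
      using \<mu>.finite_Lim_measure_decseq[OF _ dec] int rs by simp
    ultimately have "(\<lambda>n. \<bar>measure \<alpha> {u n<..} - measure \<mu> {u n<..}\<bar>) \<longlonglongrightarrow> \<bar>measure \<alpha> {l..} - measure \<mu> {l..}\<bar>"
      and "(\<lambda>n. \<epsilon> * measure \<mu> {u n<..}) \<longlonglongrightarrow> \<epsilon> * measure \<mu> {l..}"
      by (auto intro!: tendsto_intros)
    then show ?thesis
      unfolding 3 by (rule LIMSEQ_le) (use tail u in auto)
  qed simp
qed

text \<open>
  An interval is the difference of two upward closed sets: its upper closure \<open>V\<close>, and the part of \<open>V\<close>
  above the interval. The error is bounded by the mass of \<open>V\<close>, which can exceed that of the interval.
\<close>

lemma tails_close_interval:
  fixes \<alpha> \<mu> :: "real measure" and T :: "real set"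
  defines "V \<equiv> {r. \<exists>r'\<in>T. r' \<le> r}"
  assumes fin: "finite_measure \<alpha>" "finite_measure \<mu>" and sets[measurable_cong, simp]: "sets \<alpha> = sets borel" "sets \<mu> = sets borel"
    and tail: "\<And>u. u \<ge> r \<Longrightarrow> \<bar>measure \<alpha> {u<..} - measure \<mu> {u<..}\<bar> \<le> \<epsilon> * measure \<mu> {u<..}"
    and \<epsilon>: "\<epsilon> \<ge> 0"
    and T: "\<And>x y z. x \<in> T \<Longrightarrow> z \<in> T \<Longrightarrow> x \<le> y \<Longrightarrow> y \<le> z \<Longrightarrow> y \<in> T" and Tr: "T \<subseteq> {r<..}"
  shows "emeasure \<alpha> T \<le> emeasure \<mu> T + ennreal (2 * \<epsilon>) * emeasure \<mu> V"
    and "emeasure \<mu> T \<le> emeasure \<alpha> T + ennreal (2 * \<epsilon>) * emeasure \<mu> V"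
proof -
  interpret \<alpha>: finite_measure \<alpha> by fact
  interpret \<mu>: finite_measure \<mu> by fact
  have TV: "T \<subseteq> V" by (auto simp: V_def)
  have up: "y \<in> V" if "x \<in> V" "x \<le> y" for x y
  proof -
    obtain r' where "r' \<in> T" "r' \<le> x" using \<open>x \<in> V\<close> by (auto simp: V_def)
    then show ?thesis using \<open>x \<le> y\<close> by (auto simp: V_def intro!: bexI[of _ r'])
  qed
  have up': "y \<in> V - T" if "x \<in> V - T" "x \<le> y" for x y
  proof -
    obtain r' where r': "r' \<in> T" "r' \<le> x" using \<open>x \<in> V - T\<close> by (auto simp: V_def)
    have "y \<notin> T"
      using T[OF r'(1) _ r'(2) \<open>x \<le> y\<close>] that by blast
    then show ?thesis using up that by blast
  qed
  have Vr: "V \<subseteq> {r<..}"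
    using Tr by (auto simp: V_def)
  have meas: "V \<in> sets borel" "V - T \<in> sets borel"
  proof -
    have "is_interval V" "is_interval (V - T)"
      unfolding is_interval_1 using up up' by blast+
    then show "V \<in> sets borel" "V - T \<in> sets borel"
      by (auto intro: real_interval_borel_measurable)
  qed
  have "\<bar>measure \<alpha> V - measure \<mu> V\<bar> \<le> \<epsilon> * measure \<mu> V"
    by (rule tails_close_upward_closed[OF fin _ _ tail up Vr]) simp_all
  moreover have "\<bar>measure \<alpha> (V - T) - measure \<mu> (V - T)\<bar> \<le> \<epsilon> * measure \<mu> (V - T)"
    by (rule tails_close_upward_closed[OF fin _ _ tail up']) (use Vr in auto)
  moreover have "\<epsilon> * measure \<mu> (V - T) \<le> \<epsilon> * measure \<mu> V"
    using meas \<epsilon> by (intro mult_left_mono \<mu>.finite_measure_mono) auto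
  moreover have "T = V - (V - T)" using TV by auto
  then have "T \<in> sets borel" using meas by (metis sets.Diff)
  then have "measure \<alpha> (V - T) = measure \<alpha> V - measure \<alpha> T" "measure \<mu> (V - T) = measure \<mu> V - measure \<mu> T"
    using meas TV by (auto intro!: \<alpha>.finite_measure_Diff \<mu>.finite_measure_Diff)
  ultimately have "measure \<alpha> T \<le> measure \<mu> T + 2 * \<epsilon> * measure \<mu> V" "measure \<mu> T \<le> measure \<alpha> T + 2 * \<epsilon> * measure \<mu> V"
    by linarith+
  then show "emeasure \<alpha> T \<le> emeasure \<mu> T + ennreal (2 * \<epsilon>) * emeasure \<mu> V"
    and "emeasure \<mu> T \<le> emeasure \<alpha> T + ennreal (2 * \<epsilon>) * emeasure \<mu> V"
    using \<epsilon> by (simp_all add: \<alpha>.emeasure_eq_measure \<mu>.emeasure_eq_measure flip: ennreal_mult ennreal_plus)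
qed

text \<open>
  The mass of \<open>B\<close> under the law of \<open>r *\<^sub>R u\<close> for independent \<open>r > 0\<close> and \<open>u\<close> with laws \<open>\<alpha>\<close> and \<open>\<sigma>\<close>. Here \<open>\<alpha>\<close>
  will be the law of \<open>R\<close>, or a finite measure with an explicit density and nearly the same tail.
\<close>

definition radial_mass :: "real measure \<Rightarrow> 'a::euclidean_space measure \<Rightarrow> 'a set \<Rightarrow> ennreal" where
  "radial_mass \<alpha> \<sigma> B = (\<integral>\<^sup>+u. emeasure \<alpha> {r. 0 < r \<and> r *\<^sub>R u \<in> B} \<partial>\<sigma>)"

text \<open>
  The points of \<open>B\<close> and those behind \<open>B\<close>, as seen from the origin.
\<close>

definition shadow :: "'a::real_vector set \<Rightarrow> 'a set" where
  "shadow B = {z. \<exists>\<tau>. 0 < \<tau> \<and> \<tau> \<le> 1 \<and> \<tau> *\<^sub>R z \<in> B}"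

lemma subset_shadow: "B \<subseteq> shadow B"
  by (auto simp: shadow_def intro!: exI[of _ 1])

lemma open_shadow:
  fixes B :: "'a::real_normed_vector set"
  assumes "open B"
  shows "open (shadow B)"
proof -
  have "shadow B = (\<Union>\<tau>\<in>{0<..1}. (\<lambda>z. \<tau> *\<^sub>R z) -` B)"
    by (auto simp: shadow_def)
  then show ?thesis
    using assms by (auto intro!: open_UN open_vimage continuous_intros)
qed

lemma measurable_radial_section:
  fixes B :: "'a::euclidean_space set"
  assumes "sigma_finite_measure \<alpha>" "sets \<alpha> = sets borel" "B \<in> sets borel"
  shows "(\<lambda>u. emeasure \<alpha> {r. 0 < r \<and> r *\<^sub>R u \<in> B}) \<in> borel_measurable borel"
proof -
  interpret \<alpha>: sigma_finite_measure \<alpha> by fact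
  note assms(2)[measurable_cong] assms(3)[measurable]
  have "{p \<in> space (borel \<Otimes>\<^sub>M \<alpha>). 0 < snd p \<and> snd p *\<^sub>R fst p \<in> B} \<in> sets (borel \<Otimes>\<^sub>M \<alpha>)"
    by measurable
  from \<alpha>.measurable_emeasure_Pair[OF this] show ?thesis
    by (simp add: vimage_def space_pair_measure sets_eq_imp_space_eq[OF assms(2)])
qed

text \<open>
  Along each ray a convex set cuts out an interval, and the upper closure of that interval is the ray's
  section of the shadow. So two radial laws with close tails give close masses, with an error
  controlled by the mass of the shadow. The mass of \<open>B\<close> itself would not do: along a ray that leaves
  \<open>B\<close> again, the error is a fraction of the whole tail beyond the point of entry.
\<close>

theorem radial_mass_comparison:
  fixes \<alpha> \<mu> :: "real measure" and \<sigma> :: "'a::euclidean_space measure"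
  assumes fin: "finite_measure \<alpha>" "finite_measure \<mu>" and sets: "sets \<alpha> = sets borel" "sets \<mu> = sets borel" "sets \<sigma> = sets borel"
    and sphere: "AE u in \<sigma>. norm u = 1"
    and tail: "\<And>u. u \<ge> r \<Longrightarrow> \<bar>measure \<alpha> {u<..} - measure \<mu> {u<..}\<bar> \<le> \<epsilon> * measure \<mu> {u<..}"
    and \<epsilon>: "\<epsilon> \<ge> 0" and B: "open B" "convex B" "\<And>z. z \<in> B \<Longrightarrow> norm z > r"
  shows "radial_mass \<alpha> \<sigma> B \<le> radial_mass \<mu> \<sigma> B + ennreal (2 * \<epsilon>) * radial_mass \<mu> \<sigma> (shadow B)"
    and "radial_mass \<mu> \<sigma> B \<le> radial_mass \<alpha> \<sigma> B + ennreal (2 * \<epsilon>) * radial_mass \<mu> \<sigma> (shadow B)"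
proof -
  define T where "T u = {r. 0 < r \<and> r *\<^sub>R u \<in> B}" for u
  have V: "{r. \<exists>r'\<in>T u. r' \<le> r} = {r. 0 < r \<and> r *\<^sub>R u \<in> shadow B}" for u
  proof (intro equalityI subsetI)
    fix x assume "x \<in> {r. \<exists>r'\<in>T u. r' \<le> r}"
    then obtain r' where "0 < r'" "r' *\<^sub>R u \<in> B" "r' \<le> x" by (auto simp: T_def)
    then show "x \<in> {r. 0 < r \<and> r *\<^sub>R u \<in> shadow B}"
      by (auto simp: shadow_def intro!: exI[of _ "r' / x"])
  next
    fix x assume "x \<in> {r. 0 < r \<and> r *\<^sub>R u \<in> shadow B}"
    then obtain \<tau> where "0 < x" "0 < \<tau>" "\<tau> \<le> 1" "(\<tau> * x) *\<^sub>R u \<in> B" by (auto simp: shadow_def)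
    then show "x \<in> {r. \<exists>r'\<in>T u. r' \<le> r}"
      by (auto simp: T_def intro!: exI[of _ "\<tau> * x"] mult_left_le_one_le)
  qed
  have Tint: "y \<in> T u" if "x \<in> T u" "z \<in> T u" "x \<le> y" "y \<le> z" for x y z u
  proof -
    define c where "c = (if x = z then 0 else (y - x) / (z - x))"
    have c: "0 \<le> c" "c \<le> 1" "y = (1 - c) * x + c * z"
      using that by (auto simp: c_def field_simps)
    then have "(1 - c) *\<^sub>R (x *\<^sub>R u) + c *\<^sub>R (z *\<^sub>R u) \<in> B"
      using that B(2) by (intro convexD) (auto simp: T_def)
    then have "y *\<^sub>R u \<in> B"
      by (simp add: c(3) scaleR_add_left)
    then show ?thesis using that by (auto simp: T_def)
  qed
  have Tr: "AE u in \<sigma>. T u \<subseteq> {r<..}"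
    using sphere by eventually_elim (use B(3) in \<open>force simp: T_def\<close>)
  have sh: "shadow B \<in> sets borel" "B \<in> sets borel"
    using open_shadow[OF B(1)] B(1) by auto
  note meas = measurable_radial_section[OF finite_measure.axioms(1)[OF fin(1)] sets(1)]
    measurable_radial_section[OF finite_measure.axioms(1)[OF fin(2)] sets(2)]
  note [measurable] = meas(1)[OF sh(1)] meas(1)[OF sh(2)] meas(2)[OF sh(1)] meas(2)[OF sh(2)]
  note sets(3)[measurable_cong]
  have ineq: "radial_mass \<alpha>' \<sigma> B \<le> radial_mass \<mu>' \<sigma> B + ennreal (2 * \<epsilon>) * radial_mass \<mu> \<sigma> (shadow B)"
    if *: "AE u in \<sigma>. emeasure \<alpha>' (T u) \<le> emeasure \<mu>' (T u) + ennreal (2 * \<epsilon>) * emeasure \<mu> {r. \<exists>r'\<in>T u. r' \<le> r}"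
      and [measurable]: "(\<lambda>u. emeasure \<mu>' (T u)) \<in> borel_measurable borel" for \<alpha>' \<mu>'
  proof -
    have m: "(\<lambda>u. emeasure \<mu> {r. \<exists>r'\<in>T u. r' \<le> r}) \<in> borel_measurable \<sigma>"
      unfolding V by measurable
    have sh_eq: "radial_mass \<mu> \<sigma> (shadow B) = (\<integral>\<^sup>+u. emeasure \<mu> {r. \<exists>r'\<in>T u. r' \<le> r} \<partial>\<sigma>)"
      unfolding V radial_mass_def ..
    have T_eq: "radial_mass \<mu>' \<sigma> B = (\<integral>\<^sup>+u. emeasure \<mu>' (T u) \<partial>\<sigma>)"
      by (simp add: radial_mass_def T_def)
    have "radial_mass \<alpha>' \<sigma> B = (\<integral>\<^sup>+u. emeasure \<alpha>' (T u) \<partial>\<sigma>)"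
      by (simp add: radial_mass_def T_def)
    also have "\<dots> \<le> (\<integral>\<^sup>+u. emeasure \<mu>' (T u) + ennreal (2 * \<epsilon>) * emeasure \<mu> {r. \<exists>r'\<in>T u. r' \<le> r} \<partial>\<sigma>)"
      by (rule nn_integral_mono_AE[OF *])
    also have "\<dots> = radial_mass \<mu>' \<sigma> B + ennreal (2 * \<epsilon>) * radial_mass \<mu> \<sigma> (shadow B)"
      unfolding sh_eq T_eq using m by (simp add: nn_integral_add nn_integral_cmult)
    finally show ?thesis .
  qed
  show "radial_mass \<alpha> \<sigma> B \<le> radial_mass \<mu> \<sigma> B + ennreal (2 * \<epsilon>) * radial_mass \<mu> \<sigma> (shadow B)"
  proof (rule ineq)
    show "AE u in \<sigma>. emeasure \<alpha> (T u) \<le> emeasure \<mu> (T u) + ennreal (2 * \<epsilon>) * emeasure \<mu> {r. \<exists>r'\<in>T u. r' \<le> r}"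
      using Tr by eventually_elim (rule tails_close_interval(1)[OF fin sets(1,2) tail \<epsilon> Tint])
  qed (simp add: T_def)
  show "radial_mass \<mu> \<sigma> B \<le> radial_mass \<alpha> \<sigma> B + ennreal (2 * \<epsilon>) * radial_mass \<mu> \<sigma> (shadow B)"
  proof (rule ineq)
    show "AE u in \<sigma>. emeasure \<mu> (T u) \<le> emeasure \<alpha> (T u) + ennreal (2 * \<epsilon>) * emeasure \<mu> {r. \<exists>r'\<in>T u. r' \<le> r}"
      using Tr by eventually_elim (rule tails_close_interval(2)[OF fin sets(1,2) tail \<epsilon> Tint])
  qed (simp add: T_def)
qed

lemma radial_mass_distr:
  fixes R :: "'v \<Rightarrow> real" and U :: "'v \<Rightarrow> 'a::euclidean_space"
  assumes N: "prob_space N" and [measurable]: "R \<in> borel_measurable N" "U \<in> borel_measurable N"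
    and pos: "AE \<omega> in N. R \<omega> > 0" and ind: "indep_rv N R U" and [measurable]: "B \<in> sets borel"
  shows "emeasure N {\<omega> \<in> space N. R \<omega> *\<^sub>R U \<omega> \<in> B} = radial_mass (distr N borel R) (distr N borel U) B"
proof -
  interpret N: prob_space N by fact
  interpret R: prob_space "distr N borel R" by (rule N.prob_space_distr) simp
  interpret U: prob_space "distr N borel U" by (rule N.prob_space_distr) simp
  interpret RU: pair_sigma_finite "distr N borel R" "distr N borel U" ..
  have prod: "distr N borel R \<Otimes>\<^sub>M distr N borel U = distr N (borel \<Otimes>\<^sub>M borel) (\<lambda>\<omega>. (R \<omega>, U \<omega>))"
  proof (rule pair_measure_eqI)
    fix E F assume EF[measurable]: "E \<in> sets (distr N borel R)" "F \<in> sets (distr N borel U)"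
    then have EF'[measurable]: "E \<in> sets borel" "F \<in> sets borel" by simp_all
    have "N.prob ((R -` E \<inter> space N) \<inter> (U -` F \<inter> space N)) = N.prob (R -` E \<inter> space N) * N.prob (U -` F \<inter> space N)"
      using ind EF' unfolding indep_rv_def by (intro N.indep_setD) auto
    moreover have "(R -` E \<inter> space N) \<inter> (U -` F \<inter> space N) = (\<lambda>\<omega>. (R \<omega>, U \<omega>)) -` (E \<times> F) \<inter> space N"
      by auto
    ultimately show "emeasure (distr N borel R) E * emeasure (distr N borel U) F =
        emeasure (distr N (borel \<Otimes>\<^sub>M borel) (\<lambda>\<omega>. (R \<omega>, U \<omega>))) (E \<times> F)"
      by (simp add: emeasure_distr N.emeasure_eq_measure flip: ennreal_mult)
  qed (auto intro: R.sigma_finite_measure_axioms U.sigma_finite_measure_axioms)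
  let ?S = "{(r, u). 0 < r \<and> r *\<^sub>R u \<in> B} :: (real \<times> 'a) set"
  have "{p \<in> space (borel \<Otimes>\<^sub>M borel). 0 < fst p \<and> fst p *\<^sub>R snd p \<in> B} \<in> sets (borel \<Otimes>\<^sub>M borel)"
    by measurable
  also have "{p \<in> space (borel \<Otimes>\<^sub>M borel). 0 < fst p \<and> fst p *\<^sub>R snd p \<in> B} = ?S"
    by (auto simp: space_pair_measure)
  finally have S: "?S \<in> sets (borel \<Otimes>\<^sub>M borel)" .
  have "emeasure N {\<omega> \<in> space N. R \<omega> *\<^sub>R U \<omega> \<in> B} = emeasure N {\<omega> \<in> space N. (R \<omega>, U \<omega>) \<in> ?S}"
    using pos by (intro emeasure_eq_AE) auto
  also have "\<dots> = emeasure (distr N (borel \<Otimes>\<^sub>M borel) (\<lambda>\<omega>. (R \<omega>, U \<omega>))) ?S"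
    using S by (subst emeasure_distr) (auto simp: vimage_def Int_def conj_commute)
  also have "\<dots> = radial_mass (distr N borel R) (distr N borel U) B"
    unfolding prod[symmetric] radial_mass_def
    using S by (subst RU.emeasure_pair_measure_alt2) (simp_all add: vimage_def)
  finally show ?thesis .
qed

lemma radial_mass_density:
  fixes g :: "real \<Rightarrow> real" and B :: "(real ^ 'n::finite) set"
  assumes [measurable]: "g \<in> borel_measurable borel" "B \<in> sets borel" and g: "\<And>r. g r \<ge> 0"
  defines "d \<equiv> CARD('n)"
  shows "ennreal (real d * unit_ball_vol d) * radial_mass (density lborel (\<lambda>r. ennreal (g r))) uniform_sphere B
    = (\<integral>\<^sup>+z. indicator B z * ennreal (g (norm z) / norm z ^ (d - 1)) \<partial>lborel)"
proof -
  have "(\<integral>\<^sup>+z. indicator B z * ennreal (g (norm z) / norm z ^ (d - 1)) \<partial>lborel)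
    = ennreal (real d * unit_ball_vol d) *
      (\<integral>\<^sup>+u. (\<integral>\<^sup>+r. indicator {0<..} r * ennreal (r ^ (d - 1)) * (indicator B (r *\<^sub>R u) *
         ennreal (g (norm (r *\<^sub>R u)) / norm (r *\<^sub>R u) ^ (d - 1))) \<partial>lborel) \<partial>uniform_sphere)"
    unfolding d_def by (rule nn_integral_polar[symmetric]) measurable
  also have "(\<integral>\<^sup>+u. (\<integral>\<^sup>+r. indicator {0<..} r * ennreal (r ^ (d - 1)) * (indicator B (r *\<^sub>R u) *
         ennreal (g (norm (r *\<^sub>R u)) / norm (r *\<^sub>R u) ^ (d - 1))) \<partial>lborel) \<partial>uniform_sphere)
    = radial_mass (density lborel (\<lambda>r. ennreal (g r))) uniform_sphere B"
    unfolding radial_mass_def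
  proof (rule nn_integral_cong_AE)
    show "AE u in uniform_sphere. (\<integral>\<^sup>+r. indicator {0<..} r * ennreal (r ^ (d - 1)) * (indicator B (r *\<^sub>R u) *
         ennreal (g (norm (r *\<^sub>R u)) / norm (r *\<^sub>R u) ^ (d - 1))) \<partial>lborel)
      = emeasure (density lborel (\<lambda>r. ennreal (g r))) {r. 0 < r \<and> r *\<^sub>R u \<in> B}"
      using AE_uniform_sphere
    proof eventually_elim
      case (elim u)
      have "emeasure (density lborel (\<lambda>r. ennreal (g r))) {r. 0 < r \<and> r *\<^sub>R u \<in> B}
        = (\<integral>\<^sup>+r. ennreal (g r) * indicator {r. 0 < r \<and> r *\<^sub>R u \<in> B} r \<partial>lborel)"
        by (rule emeasure_density) measurable
      also have "\<dots> = (\<integral>\<^sup>+r. indicator {0<..} r * ennreal (r ^ (d - 1)) * (indicator B (r *\<^sub>R u) *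
         ennreal (g (norm (r *\<^sub>R u)) / norm (r *\<^sub>R u) ^ (d - 1))) \<partial>lborel)"
        using elim g by (intro nn_integral_cong) (auto simp: indicator_def simp flip: ennreal_mult)
      finally show ?case by simp
    qed
  qed
  finally show ?thesis by simp
qed

section \<open>The rescaled radial density\<close>

text \<open>
  Take the radial density \<open>-G'\<close> for the tail \<open>G u = p * u powr \<nu> * exp (- q * u powr \<delta>)\<close>, convert it to
  a Lebesgue density, and divide its value at distance \<open>s * r\<close> by the leading term of its value at
  distance \<open>s\<close>. What remains depends on \<open>s\<close> only through \<open>\<eta> = 1 / (q * \<delta> * s powr \<delta>)\<close>, as
  \<open>tail_density_scale\<close> shows.
\<close>

definition radial_ratio :: "real \<Rightarrow> real \<Rightarrow> real \<Rightarrow> real \<Rightarrow> real \<Rightarrow> real" where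
  "radial_ratio \<delta> \<beta> \<nu> \<eta> r =
     r powr \<beta> * (1 - \<nu> * \<eta> * r powr (- \<delta>)) * exp (- ((r powr \<delta> - 1) / (\<delta> * \<eta>)))"

text \<open>
  The exponent is a difference quotient at \<open>0\<close> of the \<open>\<delta>\<close>-th power of the radius, as a function of \<open>\<eta>\<close>.
\<close>

lemma radial_ratio_tendsto:
  assumes \<delta>: "\<delta> > 0" and \<eta>: "\<eta> \<longlonglongrightarrow> 0" "\<And>n. \<eta> n > 0"
  shows "(\<lambda>n. radial_ratio \<delta> \<beta> \<nu> (\<eta> n) (sqrt (1 + 2 * \<eta> n * l + (\<eta> n)\<^sup>2 * \<kappa>))) \<longlonglongrightarrow> exp (- l)"
proof -
  define H where "H x = 1 + 2 * x * l + x\<^sup>2 * \<kappa>" for x :: real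
  have H0: "H 0 = 1" by (simp add: H_def)
  have Hlim: "(\<lambda>n. H (\<eta> n)) \<longlonglongrightarrow> 1"
  proof -
    have "(\<lambda>n. 1 + 2 * \<eta> n * l + (\<eta> n)\<^sup>2 * \<kappa>) \<longlonglongrightarrow> 1 + 2 * 0 * l + 0\<^sup>2 * \<kappa>"
      by (intro tendsto_intros \<eta>)
    then show ?thesis by (simp add: H_def)
  qed
  then have rlim: "(\<lambda>n. sqrt (H (\<eta> n))) \<longlonglongrightarrow> 1"
    using tendsto_real_sqrt[OF Hlim] by simp
  have D: "((\<lambda>x. H x powr (\<delta> / 2)) has_real_derivative \<delta> * l) (at 0)"
  proof -
    have "(H has_real_derivative 2 * l) (at 0)"
      unfolding H_def by (auto intro!: derivative_eq_intros)
    from DERIV_chain2[OF has_real_derivative_powr this, of "\<delta> / 2"] show ?thesis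
      by (simp add: H0)
  qed
  have at0: "filterlim \<eta> (at 0) sequentially"
  proof -
    have "\<eta> n \<noteq> 0" for n using \<eta>(2)[of n] by simp
    then show ?thesis by (intro filterlim_atI \<eta>(1)) simp
  qed
  have "(\<lambda>n. (H (\<eta> n) powr (\<delta> / 2) - 1) / \<eta> n) \<longlonglongrightarrow> \<delta> * l"
    using filterlim_compose[OF D[unfolded has_field_derivative_iff] at0] by (simp add: H0)
  moreover have "sqrt (H x) powr \<delta> = H x powr (\<delta> / 2)" if "H x > 0" for x
  proof -
    have "sqrt (H x) powr \<delta> = (H x powr (1 / 2)) powr \<delta>"
      using that by (subst powr_half_sqrt) auto
    then show ?thesis by (simp only: powr_powr) simp
  qed
  then have "\<forall>\<^sub>F n in sequentially. (H (\<eta> n) powr (\<delta> / 2) - 1) / \<eta> n = (sqrt (H (\<eta> n)) powr \<delta> - 1) / \<eta> n"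
    using order_tendstoD(1)[OF Hlim, of 0] by (auto elim!: eventually_mono)
  ultimately have "(\<lambda>n. (sqrt (H (\<eta> n)) powr \<delta> - 1) / \<eta> n) \<longlonglongrightarrow> \<delta> * l"
    by (simp only: tendsto_cong)
  then have "(\<lambda>n. (sqrt (H (\<eta> n)) powr \<delta> - 1) / \<eta> n / \<delta>) \<longlonglongrightarrow> \<delta> * l / \<delta>"
    using \<delta> by (intro tendsto_intros) auto
  then have "(\<lambda>n. (sqrt (H (\<eta> n)) powr \<delta> - 1) / (\<delta> * \<eta> n)) \<longlonglongrightarrow> l"
    using \<delta> by (simp add: mult.commute)
  then have "(\<lambda>n. radial_ratio \<delta> \<beta> \<nu> (\<eta> n) (sqrt (H (\<eta> n)))) \<longlonglongrightarrow> 1 powr \<beta> * (1 - \<nu> * 0 * 1 powr (- \<delta>)) * exp (- l)"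
    unfolding radial_ratio_def by (intro tendsto_intros rlim \<eta>) auto
  then show ?thesis
    by (simp add: H_def)
qed

text \<open>
  The inequality \<open>ln z \<le> z - 1\<close> at \<open>z = r powr \<delta>\<close>. It replaces the exponential by a power that is
  decreasing in \<open>r\<close> for small \<open>\<eta>\<close>, so that a lower bound on \<open>r\<close> is enough afterwards, whatever the
  size of \<open>\<delta>\<close>.
\<close>

lemma powr_exp_le:
  fixes r :: real
  assumes "r > 0" "\<delta> > 0" "\<eta> > 0"
  shows "r powr \<beta> * exp (- ((r powr \<delta> - 1) / (\<delta> * \<eta>))) \<le> r powr (\<beta> - 1 / \<eta>)"
proof -
  have "\<delta> * ln r \<le> r powr \<delta> - 1"
    using ln_le_minus_one[of "r powr \<delta>"] assms by (simp add: ln_powr)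
  then have "\<delta> * ln r / (\<delta> * \<eta>) \<le> (r powr \<delta> - 1) / (\<delta> * \<eta>)"
    using assms by (intro divide_right_mono) auto
  then have "exp (- ((r powr \<delta> - 1) / (\<delta> * \<eta>))) \<le> r powr (- (1 / \<eta>))"
    using assms by (simp add: powr_def)
  then show ?thesis
    using assms by (simp add: powr_diff powr_minus mult_left_mono divide_inverse)
qed

text \<open>
  Bernoulli's inequality for real exponents, which is concavity of the logarithm.
\<close>

lemma one_plus_powr_ge:
  fixes a h :: real
  assumes "a \<ge> 1" "h \<ge> 0"
  shows "1 + a * h \<le> (1 + h) powr a"
proof -
  have "concave_on {0<..} (ln :: real \<Rightarrow> real)"
    by (rule ln_concave)
  then have "(1 - 1 / a) * ln 1 + (1 / a) * ln (1 + a * h) \<le> ln ((1 - 1 / a) *\<^sub>R 1 + (1 / a) *\<^sub>R (1 + a * h))"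
    using assms by (intro concave_onD) (auto intro: add_pos_nonneg)
  also have "(1 - 1 / a) *\<^sub>R 1 + (1 / a) *\<^sub>R (1 + a * h) = 1 + h"
    using assms by (simp add: field_simps)
  finally have "ln (1 + a * h) \<le> a * ln (1 + h)"
    using assms by (simp add: field_simps)
  then have "exp (ln (1 + a * h)) \<le> exp (a * ln (1 + h))"
    by simp
  then show ?thesis
    using assms by (simp add: powr_def add_pos_nonneg)
qed

text \<open>
  As \<open>\<eta>\<close> decreases, \<open>(1 + 2 * \<eta> * m) powr (1 / (2 * \<eta>))\<close> increases to \<open>exp m\<close>. Hence the power on the
  left decays in \<open>m\<close> at least polynomially of any prescribed order \<open>P\<close>, uniformly in small \<open>\<eta>\<close>. The
  shift by \<open>K\<close> only costs the constant factor.
\<close>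

lemma radial_power_bound:
  fixes r :: real
  assumes r: "r > 0" and \<eta>: "\<eta> > 0" "\<bar>\<beta>\<bar> * \<eta> \<le> 1/2" "4 * K * \<eta> \<le> 1" "4 * P * \<eta> \<le> 1"
    and K: "K \<ge> 0" and P: "P > 0" and m: "m \<ge> 0" and r2: "r\<^sup>2 \<ge> 1 + 2 * \<eta> * (m - K)"
  shows "r powr (\<beta> - 1 / \<eta>) \<le> exp (4 * K) * (1 + m / (2 * P)) powr (- P)"
proof -
  \<comment> \<open>Half of \<open>e\<close> is between \<open>1 / (4 * \<eta>)\<close> and \<open>1 / \<eta>\<close>.\<close>
  define e where "e = 1 / \<eta> - \<beta>"
  define h where "h = 2 * \<eta> * K"
  have h: "0 \<le> h" "h \<le> 1/2" using \<eta>(1,3) K by (simp_all add: h_def mult_ac)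
  have "\<bar>\<beta>\<bar> \<le> 1 / (2 * \<eta>)"
    using \<eta> by (simp add: field_simps)
  moreover have "1 / \<eta> = 2 * (1 / (2 * \<eta>))" "2 / \<eta> = 4 * (1 / (2 * \<eta>))"
    "1 / (2 * \<eta>) > 0" using \<eta> by auto
  ultimately have e: "1 / (2 * \<eta>) \<le> e" "e \<le> 2 / \<eta>"
    unfolding e_def by linarith+
  have e0: "e > 0"
    using e(1) \<eta>(1) by (smt (verit) divide_pos_pos)
  have prod: "(1 - h) * (1 + 2 * \<eta> * m) \<le> r\<^sup>2"
  proof -
    have "0 \<le> h * (2 * \<eta> * m)" using h m \<eta> by simp
    then show ?thesis using r2 by (simp add: h_def algebra_simps)
  qed
  have pos: "0 < 1 - h" "0 < 1 + 2 * \<eta> * m"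
    using h m \<eta> by (auto intro: add_pos_nonneg)
  have "(r\<^sup>2) powr (- (e / 2)) = r powr (- e)"
    using r by (simp add: powr_powr flip: powr_numeral)
  then have "r powr (\<beta> - 1 / \<eta>) = (r\<^sup>2) powr (- (e / 2))"
    by (simp add: e_def)
  also have "\<dots> \<le> ((1 - h) * (1 + 2 * \<eta> * m)) powr (- (e / 2))"
    using prod pos e0 by (intro powr_mono2') auto
  also have "\<dots> = (1 - h) powr (- (e / 2)) * (1 + 2 * \<eta> * m) powr (- (e / 2))"
    using pos by (simp add: powr_mult)
  also have "\<dots> \<le> exp (4 * K) * (1 + m / (2 * P)) powr (- P)"
  proof (rule mult_mono)
    have "- ln (1 - h) \<le> 1 / (1 - h) - 1"
      using ln_le_minus_one[of "1 / (1 - h)"] pos by (simp add: ln_div)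
    also have "\<dots> \<le> 2 * h"
    proof -
      have "h * h \<le> h * (1/2)" using h by (intro mult_left_mono) auto
      then show ?thesis using pos by (simp add: field_simps)
    qed
    finally have "- ln (1 - h) * (e / 2) \<le> 2 * h * (1 / \<eta>)"
      using e e0 h \<eta> by (intro mult_mono) auto
    also have "\<dots> = 4 * K" using \<eta> by (simp add: h_def)
    finally show "(1 - h) powr (- (e / 2)) \<le> exp (4 * K)"
      using pos by (simp add: powr_def mult.commute)
    have "(1 + 2 * \<eta> * m) powr (- (e / 2)) \<le> (1 + 2 * \<eta> * m) powr (- (1 / (4 * \<eta>)))"
      using e m \<eta> by (intro powr_mono) auto
    also have "\<dots> = ((1 + 2 * \<eta> * m) powr (1 / (4 * \<eta> * P))) powr (- P)"
      using P by (simp add: powr_powr)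
    also have "\<dots> \<le> (1 + m / (2 * P)) powr (- P)"
    proof (rule powr_mono2')
      have "1 + 1 / (4 * \<eta> * P) * (2 * \<eta> * m) \<le> (1 + 2 * \<eta> * m) powr (1 / (4 * \<eta> * P))"
        using \<eta> P m by (intro one_plus_powr_ge) (auto simp: field_simps)
      then show "1 + m / (2 * P) \<le> (1 + 2 * \<eta> * m) powr (1 / (4 * \<eta> * P))"
        using \<eta> P by (simp add: field_simps)
    qed (use P m in \<open>auto intro: add_pos_nonneg\<close>)
    finally show "(1 + 2 * \<eta> * m) powr (- (e / 2)) \<le> (1 + m / (2 * P)) powr (- P)" .
  qed auto
  finally show ?thesis .
qed

lemma radial_ratio_bound:
  assumes \<delta>: "\<delta> > 0" and K: "K \<ge> 0" and P: "P > 0"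
  obtains \<eta>0 where "\<eta>0 > 0"
    "\<And>\<eta> m r. 0 < \<eta> \<Longrightarrow> \<eta> \<le> \<eta>0 \<Longrightarrow> m \<ge> 0 \<Longrightarrow> r > 0 \<Longrightarrow> r\<^sup>2 \<ge> 1 + 2 * \<eta> * (m - K) \<Longrightarrow>
      radial_ratio \<delta> \<beta> \<nu> \<eta> r \<le> 2 * exp (4 * K) * (1 + m / (2 * P)) powr (- P)"
proof -
  \<comment> \<open>The factor \<open>1 - \<nu> * \<eta> * r powr (- \<delta>)\<close> produces a second power, with exponent \<open>\<beta> - \<delta>\<close>.\<close>
  define Z where "Z = 4 * K + 4 * P + 2 * \<bar>\<beta>\<bar> + 2 * \<bar>\<beta> - \<delta>\<bar> + \<bar>\<nu>\<bar> + 1"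
  have Z: "Z > 0" using K P by (simp add: Z_def add_nonneg_pos add_pos_nonneg)
  show ?thesis
  proof (rule that[of "1 / Z"])
    show "1 / Z > 0" using Z by simp
    fix \<eta> m r :: real
    assume \<eta>: "0 < \<eta>" "\<eta> \<le> 1 / Z" and m: "m \<ge> 0" and r: "r > 0" and r2: "r\<^sup>2 \<ge> 1 + 2 * \<eta> * (m - K)"
    have "Z * \<eta> \<le> 1" using \<eta> Z by (simp add: field_simps)
    moreover have "a * \<eta> \<le> Z * \<eta>" if "a \<le> Z" for a
      using that \<eta> by (intro mult_right_mono) auto
    ultimately have small: "a * \<eta> \<le> 1" if "a \<le> Z" for a
      using that by (meson order_trans)
    have s: "4 * K * \<eta> \<le> 1" "4 * P * \<eta> \<le> 1" "2 * \<bar>\<beta>\<bar> * \<eta> \<le> 1" "2 * \<bar>\<beta> - \<delta>\<bar> * \<eta> \<le> 1" "\<bar>\<nu>\<bar> * \<eta> \<le> 1"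
      by (rule small; use K P in \<open>simp add: Z_def\<close>)+
    define b where "b = exp (4 * K) * (1 + m / (2 * P)) powr (- P)"
    let ?E = "exp (- ((r powr \<delta> - 1) / (\<delta> * \<eta>)))"
    have b1: "r powr \<beta> * ?E \<le> b"
      unfolding b_def using s \<eta> r K P m r2
      by (intro order_trans[OF powr_exp_le radial_power_bound] \<delta>) auto
    have b2: "r powr (\<beta> - \<delta>) * ?E \<le> b"
      unfolding b_def using s \<eta> r K P m r2
      by (intro order_trans[OF powr_exp_le radial_power_bound] \<delta>) auto
    have "radial_ratio \<delta> \<beta> \<nu> \<eta> r = r powr \<beta> * ?E + (- \<nu> * \<eta>) * (r powr (\<beta> - \<delta>) * ?E)"
      by (simp add: radial_ratio_def algebra_simps powr_diff powr_minus divide_inverse)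
    also have "\<dots> \<le> b + 1 * b"
    proof (rule add_mono[OF b1 mult_mono[OF _ b2]])
      have "- \<nu> * \<eta> \<le> \<bar>\<nu>\<bar> * \<eta>" using \<eta> by (intro mult_right_mono) auto
      then show "- \<nu> * \<eta> \<le> 1" using s by linarith
    qed auto
    finally show "radial_ratio \<delta> \<beta> \<nu> \<eta> r \<le> 2 * exp (4 * K) * (1 + m / (2 * P)) powr (- P)"
      by (simp add: b_def)
  qed
qed

text \<open>
  The derivative of \<open>- p * r powr \<nu> * exp (- q * r powr \<delta>)\<close>, cut off below \<open>r0\<close> because it may be
  negative near \<open>0\<close>. Beyond \<open>r0\<close> the tail of this density is exact, not only asymptotic.
\<close>

definition tail_density :: "real \<Rightarrow> real \<Rightarrow> real \<Rightarrow> real \<Rightarrow> real \<Rightarrow> real \<Rightarrow> real" where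
  "tail_density p q \<delta> \<nu> r0 r = (if r \<ge> r0
     then p * (q * \<delta> * r powr (\<nu> + \<delta> - 1) - \<nu> * r powr (\<nu> - 1)) * exp (- q * r powr \<delta>) else 0)"

lemma tail_density_borel [measurable]: "tail_density p q \<delta> \<nu> r0 \<in> borel_measurable borel"
  unfolding tail_density_def by measurable

lemma tail_density_nonneg:
  assumes "p > 0" "q > 0" "\<delta> > 0"
  obtains r0 where "r0 > 0" "\<And>r. tail_density p q \<delta> \<nu> r0 r \<ge> 0"
proof -
  have "filterlim (\<lambda>r. q * \<delta> * r powr \<delta>) at_top at_top"
    using assms by real_asymp
  then have "\<forall>\<^sub>F r in at_top. \<nu> \<le> q * \<delta> * r powr \<delta> \<and> r > 0"
    using eventually_gt_at_top[of 0] by (auto simp: filterlim_at_top eventually_conj_iff)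
  then obtain r0 where r0: "\<And>r. r \<ge> r0 \<Longrightarrow> \<nu> \<le> q * \<delta> * r powr \<delta> \<and> r > 0"
    by (auto simp: eventually_at_top_linorder)
  show ?thesis
  proof (rule that[of r0])
    show "r0 > 0" using r0[of r0] by simp
    fix r
    show "tail_density p q \<delta> \<nu> r0 r \<ge> 0"
    proof (cases "r \<ge> r0")
      case True
      have "\<nu> * r powr (\<nu> - 1) \<le> q * \<delta> * r powr \<delta> * r powr (\<nu> - 1)"
        using r0[OF True] by (intro mult_right_mono) auto
      also have "\<dots> = q * \<delta> * r powr (\<nu> + \<delta> - 1)"
        by (simp add: algebra_simps flip: powr_add)
      finally show ?thesis
        using assms True by (simp add: tail_density_def)
    qed (simp add: tail_density_def)
  qed
qed

lemma emeasure_tail_density: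
  assumes pos: "p > 0" "q > 0" "\<delta> > 0" "r0 > 0" and nn: "\<And>r. tail_density p q \<delta> \<nu> r0 r \<ge> 0" and u: "u \<ge> r0"
  shows "emeasure (density lborel (\<lambda>r. ennreal (tail_density p q \<delta> \<nu> r0 r))) {u<..}
    = ennreal (p * u powr \<nu> * exp (- q * u powr \<delta>))"
proof -
  let ?g = "tail_density p q \<delta> \<nu> r0"
  have "emeasure (density lborel (\<lambda>r. ennreal (?g r))) {u<..} = (\<integral>\<^sup>+r. ennreal (?g r) * indicator {u<..} r \<partial>lborel)"
    by (rule emeasure_density) measurable
  also have "\<dots> = (\<integral>\<^sup>+r. ennreal (?g r) * indicator {u..} r \<partial>lborel)"
    using AE_lborel_singleton[of u]
    by (intro nn_integral_cong_AE) (auto simp: indicator_def elim!: eventually_mono)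
  also have "\<dots> = ennreal (0 - (- (p * u powr \<nu> * exp (- q * u powr \<delta>))))"
  proof (rule nn_integral_FTC_atLeast)
    show "DERIV (\<lambda>r. - (p * r powr \<nu> * exp (- q * r powr \<delta>))) r :> ?g r" if "u \<le> r" for r
    proof -
      have r: "r > 0" "r \<ge> r0" using that u pos by auto
      have e: "r powr (\<nu> + \<delta> - 1) = r powr \<nu> * r powr (\<delta> - 1)"
        by (simp add: algebra_simps flip: powr_add)
      have D: "DERIV (\<lambda>r. - (p * r powr \<nu> * exp (- q * r powr \<delta>))) r :>
         - (p * (\<nu> * r powr (\<nu> - 1)) * exp (- q * r powr \<delta>) + p * r powr \<nu> * (exp (- q * r powr \<delta>) * (- q * (\<delta> * r powr (\<delta> - 1)))))"
        using r by (auto intro!: derivative_eq_intros)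
      have "- (p * (\<nu> * r powr (\<nu> - 1)) * exp (- q * r powr \<delta>) + p * r powr \<nu> * (exp (- q * r powr \<delta>) * (- q * (\<delta> * r powr (\<delta> - 1))))) = ?g r"
        unfolding tail_density_def e using r by (simp add: algebra_simps)
      with D show ?thesis by simp
    qed
    show "((\<lambda>r. - (p * r powr \<nu> * exp (- q * r powr \<delta>))) \<longlongrightarrow> 0) at_top"
      using pos by real_asymp
  qed (use nn in auto)
  finally show ?thesis by simp
qed

lemma tail_density_scale:
  assumes pos: "q > 0" "\<delta> > 0" "s > 0" "r > 0" and r: "s * r \<ge> r0" and d: "d \<ge> 1"
  defines "\<eta> \<equiv> 1 / (q * \<delta> * s powr \<delta>)"
  shows "tail_density p q \<delta> \<nu> r0 (s * r) / (s * r) ^ (d - 1)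
    = p * q * \<delta> * s powr (\<nu> + \<delta> - real d) * exp (- q * s powr \<delta>) *
      radial_ratio \<delta> (\<nu> + \<delta> - real d) \<nu> \<eta> r"
proof -
  have dd: "real d = 1 + real (d - 1)" using d by simp
  let ?u = "s * r" and ?\<beta> = "\<nu> + \<delta> - (1 + real (d - 1))"
  have u: "?u > 0" using pos by simp
  have \<eta>: "\<eta> > 0" "q * \<delta> * s powr \<delta> * \<eta> = 1" using pos by (auto simp: \<eta>_def)
  have "tail_density p q \<delta> \<nu> r0 ?u / ?u ^ (d - 1)
     = p * (q * \<delta> * (?u powr (\<nu> + \<delta> - 1) / ?u powr real (d - 1)) - \<nu> * (?u powr (\<nu> - 1) / ?u powr real (d - 1))) * exp (- q * ?u powr \<delta>)"
  proof -
    define D where "D = ?u ^ (d - 1)"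
    have D: "?u powr real (d - 1) = D"
      unfolding D_def by (rule powr_realpow[OF u])
    show ?thesis
      unfolding D D_def[symmetric] tail_density_def using r
      by (simp add: diff_divide_distrib algebra_simps)
  qed
  also have "\<dots> = p * (q * \<delta> * ?u powr ?\<beta> - \<nu> * (?u powr ?\<beta> * ?u powr (- \<delta>))) * exp (- q * ?u powr \<delta>)"
    by (simp add: algebra_simps flip: powr_add powr_diff)
  also have "?u powr (- \<delta>) = q * \<delta> * \<eta> * r powr (- \<delta>)"
    using pos by (simp add: powr_mult powr_minus \<eta>_def field_simps)
  also have "?u powr ?\<beta> = s powr ?\<beta> * r powr ?\<beta>"
    using pos by (simp add: powr_mult)
  also have "- q * ?u powr \<delta> = - q * s powr \<delta> + - ((r powr \<delta> - 1) / (\<delta> * \<eta>))"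
    using pos by (simp add: powr_mult \<eta>_def field_simps)
  finally show ?thesis
    unfolding dd exp_add radial_ratio_def by (simp add: algebra_simps)
qed

section \<open>Integrability and the limit integral\<close>

text \<open>
  In the coordinates of \<open>I\<close>, the rescaled shadow is the union over \<open>\<theta> \<ge> 0\<close> of the orthants with corner
  \<open>x + \<theta> * (a + \<eta> * x)\<close>. The weights \<open>lam\<close> take the value about \<open>\<theta>\<close> at the corner, up to a constant, so
  they control \<open>\<theta>\<close>; then every coordinate is bounded below in terms of the weighted sum, and, the
  weights being positive, also above.
\<close>

lemma shifted_cone_bound:
  fixes a x lam :: "real ^ 'n::finite"
  assumes lam: "\<And>i. i \<in> I \<Longrightarrow> lam $ i > 0" and norm: "(\<Sum>i\<in>I. lam $ i * a $ i) = 1"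
  obtains \<eta>0 c K where "\<eta>0 > 0" "c > 0"
    "\<And>\<eta> \<tau> y. 0 < \<eta> \<Longrightarrow> \<eta> \<le> \<eta>0 \<Longrightarrow> 0 < \<tau> \<Longrightarrow> \<tau> \<le> 1 \<Longrightarrow>
       (\<And>i. i \<in> I \<Longrightarrow> \<tau> * (a $ i + \<eta> * y $ i) > a $ i + \<eta> * x $ i) \<Longrightarrow>
       c * (\<Sum>i\<in>I. \<bar>y $ i\<bar>) - K \<le> (\<Sum>i\<in>I. lam $ i * y $ i)"
proof -
  define X where "X = (\<Sum>i\<in>I. lam $ i * x $ i)"
  define M where "M = (\<Sum>i\<in>I. \<bar>a $ i\<bar> + \<bar>x $ i\<bar>)"
  define \<Lambda> where "\<Lambda> = (\<Sum>i\<in>I. lam $ i)"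
  define \<mu> where "\<mu> = Min (insert 1 ((\<lambda>i. lam $ i) ` I))"
  have I: "finite I" by simp
  have \<mu>: "\<mu> > 0" "\<And>i. i \<in> I \<Longrightarrow> \<mu> \<le> lam $ i"
    using lam by (auto simp: \<mu>_def)
  have M: "M \<ge> 0" "\<And>i. i \<in> I \<Longrightarrow> \<bar>a $ i\<bar> + \<bar>x $ i\<bar> \<le> M"
    unfolding M_def by (auto intro!: sum_nonneg member_le_sum[of _ I "\<lambda>i. \<bar>a $ i\<bar> + \<bar>x $ i\<bar>"])
  have \<Lambda>: "\<Lambda> \<ge> 0" unfolding \<Lambda>_def by (intro sum_nonneg less_imp_le lam)
  define E where "E = (1 + 2 * M * \<Lambda>) / \<mu> + 2 * M"
  define D where "D = 1 + real (card I) * E"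
  have E: "E \<ge> 0" unfolding E_def using M \<Lambda> \<mu> by auto
  have D: "D > 0" unfolding D_def using E by (simp add: add_pos_nonneg)
  define Y where "Y = (\<Sum>i\<in>I. \<bar>x $ i\<bar>)"
  show ?thesis
  proof (rule that[of "1 / (1 + 2 * \<bar>X\<bar>)" "1 / D" "Y / D - X"])
    show "1 / (1 + 2 * \<bar>X\<bar>) > 0" by (simp add: add_pos_nonneg)
    show "1 / D > 0" using D by simp
    fix \<eta> \<tau> :: real and y :: "real ^ 'n"
    assume \<eta>: "0 < \<eta>" "\<eta> \<le> 1 / (1 + 2 * \<bar>X\<bar>)" and \<tau>: "0 < \<tau>" "\<tau> \<le> 1"
      and y: "\<And>i. i \<in> I \<Longrightarrow> \<tau> * (a $ i + \<eta> * y $ i) > a $ i + \<eta> * x $ i"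
    have "\<eta> * (1 + 2 * \<bar>X\<bar>) \<le> 1"
      using \<eta> by (simp add: pos_le_divide_eq add_pos_nonneg)
    moreover have "0 \<le> \<eta> * \<bar>X\<bar>" "\<bar>\<eta> * X\<bar> = \<eta> * \<bar>X\<bar>" using \<eta> by (auto simp: abs_mult)
    ultimately have \<eta>1: "\<eta> \<le> 1" "\<bar>\<eta> * X\<bar> \<le> 1/2"
      using \<eta>(1) by (auto simp: algebra_simps)
    \<comment> \<open>The parameter \<open>\<theta>\<close> of the orthant to which \<open>y\<close> belongs.\<close>
    define \<theta> where "\<theta> = (1 / \<tau> - 1) / \<eta>"
    have \<theta>: "\<theta> \<ge> 0" using \<tau> \<eta> by (simp add: \<theta>_def)
    have y': "y $ i > x $ i + \<theta> * (a $ i + \<eta> * x $ i)" if "i \<in> I" for i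
    proof -
      have "(a $ i + \<eta> * x $ i) / \<tau> < a $ i + \<eta> * y $ i"
        using y[OF that] \<tau> by (simp add: pos_divide_less_eq mult.commute)
      moreover have "1 / \<tau> = 1 + \<eta> * \<theta>" using \<eta> by (simp add: \<theta>_def)
      then have "(a $ i + \<eta> * x $ i) / \<tau> = (a $ i + \<eta> * x $ i) * (1 + \<eta> * \<theta>)"
        by (simp add: divide_inverse)
      ultimately have "\<eta> * (x $ i + \<theta> * (a $ i + \<eta> * x $ i)) < \<eta> * y $ i"
        by (simp add: algebra_simps)
      then show ?thesis using \<eta> by simp
    qed
    define u where "u = (\<Sum>i\<in>I. lam $ i * (y $ i - x $ i))"
    \<comment> \<open>The weighted sum \<open>u\<close> controls \<open>\<theta>\<close>.\<close>
    have "\<theta> * (1 + \<eta> * X) = (\<Sum>i\<in>I. lam $ i * (\<theta> * (a $ i + \<eta> * x $ i)))"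
      by (simp add: X_def norm[symmetric] algebra_simps sum.distrib sum_distrib_left)
    also have "\<dots> \<le> u"
      unfolding u_def using y' lam by (intro sum_mono mult_left_mono) (force intro: less_imp_le)+
    finally have "\<theta> * (1 + \<eta> * X) \<le> u" .
    moreover have "\<theta> * (1/2) \<le> \<theta> * (1 + \<eta> * X)"
      using \<theta> \<eta>1 by (intro mult_left_mono) auto
    ultimately have \<theta>u: "\<theta> \<le> 2 * u" by simp
    then have u: "u \<ge> 0" using \<theta> by simp
    have low: "y $ i - x $ i + 2 * u * M \<ge> 0" if "i \<in> I" for i
    proof -
      have "\<eta> * \<bar>x $ i\<bar> \<le> 1 * \<bar>x $ i\<bar>" using \<eta>1 by (intro mult_right_mono) auto
      then have "\<bar>a $ i + \<eta> * x $ i\<bar> \<le> M"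
        using M(2)[OF that] \<eta>(1) abs_triangle_ineq[of "a $ i" "\<eta> * x $ i"] by (simp add: abs_mult)
      then have "\<theta> * \<bar>a $ i + \<eta> * x $ i\<bar> \<le> 2 * u * M"
        using \<theta>u u \<theta> by (intro mult_mono) auto
      then have "- (2 * u * M) \<le> \<theta> * (a $ i + \<eta> * x $ i)"
      proof -
        have "- \<bar>a $ i + \<eta> * x $ i\<bar> \<le> a $ i + \<eta> * x $ i" by linarith
        from mult_left_mono[OF this \<theta>] show ?thesis
          using \<open>\<theta> * \<bar>a $ i + \<eta> * x $ i\<bar> \<le> 2 * u * M\<close> by simp
      qed
      then show ?thesis using y'[OF that] by simp
    qed
    have up: "\<bar>y $ i\<bar> \<le> \<bar>x $ i\<bar> + u * E" if "i \<in> I" for i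
    proof -
      let ?z = "y $ i - x $ i + 2 * u * M"
      have "\<mu> * ?z \<le> lam $ i * ?z"
        using \<mu>(2)[OF that] low[OF that] by (intro mult_right_mono)
      also have "\<dots> \<le> (\<Sum>i\<in>I. lam $ i * (y $ i - x $ i + 2 * u * M))"
        by (rule member_le_sum[OF that]) (auto intro!: mult_nonneg_nonneg low less_imp_le[OF lam] simp del: zero_le_mult_iff)
      also have "\<dots> = u * (1 + 2 * M * \<Lambda>)"
      proof -
        have "(\<Sum>i\<in>I. lam $ i * (y $ i - x $ i + 2 * u * M))
          = (\<Sum>i\<in>I. lam $ i * (y $ i - x $ i)) + (\<Sum>i\<in>I. lam $ i) * (2 * u * M)"
          by (simp add: distrib_left sum.distrib sum_distrib_right)
        then show ?thesis
          unfolding u_def[symmetric] \<Lambda>_def[symmetric] by (simp add: algebra_simps)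
      qed
      finally have "?z \<le> u * (1 + 2 * M * \<Lambda>) / \<mu>"
        using \<mu> by (simp add: pos_le_divide_eq mult.commute)
      moreover have "0 \<le> 2 * u * M" using u M by simp
      ultimately show ?thesis
        using low[OF that] unfolding E_def by (simp add: distrib_left mult_ac)
    qed
    have "(\<Sum>i\<in>I. \<bar>y $ i\<bar>) \<le> (\<Sum>i\<in>I. \<bar>x $ i\<bar> + u * E)"
      by (intro sum_mono up)
    also have "\<dots> = Y + u * (real (card I) * E)"
      by (simp add: Y_def sum.distrib)
    also have "\<dots> \<le> Y + u * D"
      using u by (simp add: D_def mult_left_mono)
    finally have "(\<Sum>i\<in>I. \<bar>y $ i\<bar>) / D \<le> (Y + u * D) / D"
      using D by (intro divide_right_mono) auto
    then have "(\<Sum>i\<in>I. \<bar>y $ i\<bar>) / D \<le> Y / D + u"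
      using D by (simp add: add_divide_distrib)
    moreover have "u = (\<Sum>i\<in>I. lam $ i * y $ i) - X"
      by (simp add: u_def X_def right_diff_distrib sum_subtractf)
    ultimately show "1 / D * (\<Sum>i\<in>I. \<bar>y $ i\<bar>) - (Y / D - X) \<le> (\<Sum>i\<in>I. lam $ i * y $ i)"
      by simp
  qed
qed

lemma nn_integral_inverse_square:
  fixes c :: real
  assumes c: "c > 0"
  shows "(\<integral>\<^sup>+t. ennreal (1 / (1 + c * \<bar>t\<bar>)\<^sup>2) \<partial>lborel) < \<infinity>"
proof -
  have half: "(\<integral>\<^sup>+t. ennreal (1 / (1 + c * t)\<^sup>2) * indicator {0..} t \<partial>lborel) = ennreal (0 - (- (1 / (c * (1 + c * 0)))))"
  proof (rule nn_integral_FTC_atLeast)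
    show "DERIV (\<lambda>t. - (1 / (c * (1 + c * t)))) t :> 1 / (1 + c * t)\<^sup>2" if "0 \<le> t" for t
    proof -
      have nz: "1 + c * t > 0" using c that by (simp add: add_pos_nonneg)
      then have "c * (1 + c * t) \<noteq> 0" using c by auto
      then have "DERIV (\<lambda>t. - (1 / (c * (1 + c * t)))) t :> (c * c) / (c * (1 + c * t))\<^sup>2"
        by (auto intro!: derivative_eq_intros simp: power2_eq_square)
      also have "(c * c) / (c * (1 + c * t))\<^sup>2 = 1 / (1 + c * t)\<^sup>2"
        using c by (simp add: power_mult_distrib power2_eq_square)
      finally show ?thesis .
    qed
    have "filterlim (\<lambda>t. c * (1 + c * t)) at_top at_top"
      using c by (intro filterlim_tendsto_pos_mult_at_top[OF tendsto_const]
          filterlim_tendsto_add_at_top[OF tendsto_const] filterlim_ident) auto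
    then have "((\<lambda>t. - inverse (c * (1 + c * t))) \<longlongrightarrow> - 0) at_top"
      by (intro tendsto_minus tendsto_inverse_0_at_top)
    then show "((\<lambda>t. - (1 / (c * (1 + c * t)))) \<longlongrightarrow> 0) at_top"
      by (simp add: divide_inverse)
  qed auto
  let ?f = "\<lambda>t. ennreal (1 / (1 + c * t)\<^sup>2) * indicator {0..} t"
  have "(\<integral>\<^sup>+t. ennreal (1 / (1 + c * \<bar>t\<bar>)\<^sup>2) \<partial>lborel) \<le> (\<integral>\<^sup>+t. ?f t + ?f (0 + (-1) * t) \<partial>lborel)"
    by (intro nn_integral_mono) (auto simp: indicator_def)
  also have "\<dots> = (\<integral>\<^sup>+t. ?f t \<partial>lborel) + (\<integral>\<^sup>+t. ?f (0 + (-1) * t) \<partial>lborel)"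
    by (intro nn_integral_add) auto
  also have "(\<integral>\<^sup>+t. ?f (0 + (-1) * t) \<partial>lborel) = (\<integral>\<^sup>+t. ?f t \<partial>lborel)"
    using nn_integral_real_affine[of ?f "-1" 0] by simp
  finally show ?thesis
    unfolding half by (rule le_less_trans) simp
qed

text \<open>
  The exponent \<open>2 * CARD('n)\<close> is chosen such that the integrand is below a product of one-dimensional
  integrable functions, one for each coordinate.
\<close>

lemma nn_integral_power_decay:
  fixes c :: real
  assumes c: "c > 0"
  shows "(\<integral>\<^sup>+y. ennreal ((1 + c * norm (y :: real ^ 'n::finite)) powr (- (2 * real CARD('n)))) \<partial>lborel) < \<infinity>"
proof -
  let ?h = "\<lambda>t::real. ennreal (1 / (1 + c * \<bar>t\<bar>)\<^sup>2)"
  have "(\<integral>\<^sup>+(y :: real ^ 'n). ennreal ((1 + c * norm y) powr (- (2 * real CARD('n)))) \<partial>lborel)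
    \<le> (\<integral>\<^sup>+(y :: real ^ 'n). (\<Prod>b\<in>Basis. ?h (y \<bullet> b)) \<partial>lborel)"
  proof (intro nn_integral_mono)
    fix y :: "real ^ 'n"
    have pos: "1 + c * norm y > 0" "1 + c * \<bar>y \<bullet> b\<bar> > 0" for b
      using c by (auto intro!: add_pos_nonneg)
    have "(1 + c * norm y) powr (- (2 * real CARD('n))) = (\<Prod>b\<in>(Basis :: (real ^ 'n) set). 1 / (1 + c * norm y)\<^sup>2)"
      using pos(1) powr_realpow[OF pos(1), of "2 * CARD('n)"]
      by (simp add: powr_minus power_mult divide_inverse power_inverse)
    also have "\<dots> \<le> (\<Prod>b\<in>(Basis :: (real ^ 'n) set). 1 / (1 + c * \<bar>y \<bullet> b\<bar>)\<^sup>2)"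
      using c pos by (intro prod_mono conjI divide_left_mono power_mono add_left_mono mult_left_mono Basis_le_norm)
        (auto intro!: mult_pos_pos zero_less_power)
    finally show "ennreal ((1 + c * norm y) powr (- (2 * real CARD('n)))) \<le> (\<Prod>b\<in>Basis. ?h (y \<bullet> b))"
      by (simp add: prod_ennreal ennreal_leI)
  qed
  also have "\<dots> = (\<Prod>b\<in>(Basis :: (real ^ 'n) set). \<integral>\<^sup>+t. ?h t \<partial>lborel)"
    by (rule nn_integral_lborel_prod) auto
  also have "\<dots> < \<infinity>"
    using nn_integral_inverse_square[OF c] by (simp add: power_less_top_ennreal)
  finally show ?thesis .
qed

lemma nn_integral_exp_tail:
  assumes "l > 0"
  shows "(\<integral>\<^sup>+t. ennreal (exp (- (l * t))) * indicator {x<..} t \<partial>lborel) = ennreal (exp (- (l * x)) / l)"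
proof -
  have "(\<integral>\<^sup>+t. ennreal (exp (- (l * t))) * indicator {x<..} t \<partial>lborel)
      = (\<integral>\<^sup>+t. ennreal (exp (- (l * t))) * indicator {x..} t \<partial>lborel)"
    using AE_lborel_singleton[of x]
    by (intro nn_integral_cong_AE) (auto simp: indicator_def elim!: eventually_mono)
  also have "\<dots> = ennreal (0 - (- (exp (- (l * x)) / l)))"
  proof (rule nn_integral_FTC_atLeast)
    show "DERIV (\<lambda>t. - (exp (- (l * t)) / l)) t :> exp (- (l * t))" if "x \<le> t" for t
      using assms by (auto intro!: derivative_eq_intros)
    have "filterlim (\<lambda>t. l * t) at_top at_top"
      using assms by (intro filterlim_tendsto_pos_mult_at_top[OF tendsto_const] filterlim_ident) auto
    then have "filterlim (\<lambda>t. - (l * t)) at_bot at_top"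
      by (simp add: filterlim_uminus_at_bot)
    then have "((\<lambda>t. - (exp (- (l * t)) / l)) \<longlongrightarrow> - (0 / l)) at_top"
      using assms by (intro tendsto_intros filterlim_compose[OF exp_at_bot]) auto
    then show "((\<lambda>t. - (exp (- (l * t)) / l)) \<longlongrightarrow> 0) at_top" by simp
  qed auto
  finally show ?thesis by simp
qed

lemma nn_integral_lborel_split:
  fixes g :: "'n::finite \<Rightarrow> real \<Rightarrow> ennreal" and h :: "('n \<Rightarrow> real) \<Rightarrow> ennreal"
  assumes [measurable]: "\<And>i. g i \<in> borel_measurable borel" "h \<in> borel_measurable (Pi\<^sub>M (-I) (\<lambda>_. lborel))"
  shows "(\<integral>\<^sup>+y. (\<Prod>i\<in>I. g i (y $ i)) * h (\<lambda>j\<in>-I. y $ j) \<partial>lborel)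
    = (\<Prod>i\<in>I. \<integral>\<^sup>+t. g i t \<partial>lborel) * (\<integral>\<^sup>+z. h z \<partial>Pi\<^sub>M (-I) (\<lambda>_. lborel))"
proof -
  interpret product_sigma_finite "\<lambda>_ :: 'n. lborel :: real measure" ..
  have un: "I \<union> (-I) = UNIV" by simp
  have res[measurable]: "(\<lambda>f. \<lambda>j\<in>-I. f j) \<in> Pi\<^sub>M UNIV (\<lambda>_. lborel) \<rightarrow>\<^sub>M Pi\<^sub>M (-I) (\<lambda>_. lborel :: real measure)"
    by (intro measurable_restrict) simp
  have res'[measurable]: "(\<lambda>y::real^'n. \<lambda>j\<in>-I. y $ j) \<in> borel \<rightarrow>\<^sub>M Pi\<^sub>M (-I) (\<lambda>_. lborel :: real measure)"
    by (intro measurable_restrict) simp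
  have m: "(\<lambda>f. (\<Prod>i\<in>I. g i (f i)) * h (\<lambda>j\<in>-I. f j)) \<in> borel_measurable (Pi\<^sub>M (I \<union> -I) (\<lambda>_. lborel))"
    unfolding un by measurable
  have "(\<integral>\<^sup>+y. (\<Prod>i\<in>I. g i (y $ i)) * h (\<lambda>j\<in>-I. y $ j) \<partial>lborel)
      = (\<integral>\<^sup>+f. (\<Prod>i\<in>I. g i (f i)) * h (\<lambda>j\<in>-I. f j) \<partial>Pi\<^sub>M (I \<union> -I) (\<lambda>_. lborel))"
  proof -
    have "restrict (($) (vec_lambda f)) (-I) = restrict f (-I)" for f :: "'n \<Rightarrow> real"
      by (rule restrict_ext) simp
    then show ?thesis
      unfolding un by (subst nn_integral_lborel_cart) simp_all
  qed
  also have "\<dots> = (\<integral>\<^sup>+f. (\<integral>\<^sup>+z. (\<Prod>i\<in>I. g i (merge I (-I) (f, z) i)) * h (\<lambda>j\<in>-I. merge I (-I) (f, z) j)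
      \<partial>Pi\<^sub>M (-I) (\<lambda>_. lborel)) \<partial>Pi\<^sub>M I (\<lambda>_. lborel))"
    by (rule product_nn_integral_fold[OF _ _ _ m]) auto
  also have "\<dots> = (\<integral>\<^sup>+f. (\<integral>\<^sup>+z. (\<Prod>i\<in>I. g i (f i)) * h z \<partial>Pi\<^sub>M (-I) (\<lambda>_. lborel)) \<partial>Pi\<^sub>M I (\<lambda>_. lborel))"
  proof (intro nn_integral_cong)
    fix f z :: "'n \<Rightarrow> real"
    assume "z \<in> space (Pi\<^sub>M (-I) (\<lambda>_. lborel))"
    then have "(\<lambda>j\<in>-I. merge I (-I) (f, z) j) = z"
      by (auto simp: space_PiM merge_def fun_eq_iff PiE_def extensional_def)
    moreover have "(\<Prod>i\<in>I. g i (merge I (-I) (f, z) i)) = (\<Prod>i\<in>I. g i (f i))"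
      by (intro prod.cong) (auto simp: merge_def)
    ultimately show "(\<Prod>i\<in>I. g i (merge I (-I) (f, z) i)) * h (\<lambda>j\<in>-I. merge I (-I) (f, z) j) = (\<Prod>i\<in>I. g i (f i)) * h z"
      by simp
  qed
  also have "\<dots> = (\<integral>\<^sup>+f. (\<Prod>i\<in>I. g i (f i)) \<partial>Pi\<^sub>M I (\<lambda>_. lborel)) * (\<integral>\<^sup>+z. h z \<partial>Pi\<^sub>M (-I) (\<lambda>_. lborel))"
    by (simp add: nn_integral_cmult nn_integral_multc)
  also have "(\<integral>\<^sup>+f. (\<Prod>i\<in>I. g i (f i)) \<partial>Pi\<^sub>M I (\<lambda>_. lborel)) = (\<Prod>i\<in>I. \<integral>\<^sup>+t. g i t \<partial>lborel)"
    by (rule product_nn_integral_prod) auto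
  finally show ?thesis .
qed


text \<open>
  The limit integral factorises: the coordinates in \<open>I\<close> give exponential integrals, and the others give
  the unnormalised conditional Gaussian law. The limit set contains the open orthant above \<open>x\<close>, whatever
  \<open>c\<close> is, so the integral is positive.
\<close>

lemma limit_integral:
  fixes S :: "real ^ 'n::finite ^ 'n" and lam c x :: "real ^ 'n"
  assumes lam: "\<And>i. i \<in> I \<Longrightarrow> lam $ i > 0" and c: "\<And>j. j \<notin> I \<Longrightarrow> c $ j \<le> 0"
    and d: "subdet (-I) (schur_complement S I) > 0"
  defines "Q \<equiv> subinv (-I) (schur_complement S I)"
  defines "L \<equiv> (\<integral>\<^sup>+y. ennreal (exp (- ((\<Sum>i\<in>I. lam $ i * y $ i) + subvec (-I) y \<bullet> (Q *v subvec (-I) y) / 2)))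
      * indicator {y. (\<forall>i\<in>I. y $ i > x $ i) \<and> (\<forall>j\<in>-I. c $ j = 0 \<longrightarrow> y $ j > x $ j)} y \<partial>lborel)"
  assumes fin: "L < \<infinity>"
  shows "enn2real L = (\<Prod>i\<in>I. exp (- (lam $ i * x $ i)) / lam $ i) *
      (sqrt ((2 * pi) ^ card (-I) * subdet (-I) (schur_complement S I)) * cond_gaussian_prob S I c x)"
    and "enn2real L > 0"
proof -
  interpret product_sigma_finite "\<lambda>_ :: 'n. lborel :: real measure" ..
  let ?J = "-I" and ?P = "Pi\<^sub>M (-I) (\<lambda>_. lborel) :: ('n \<Rightarrow> real) measure"
  define D where "D = sqrt ((2 * pi) ^ card (-I) * subdet (-I) (schur_complement S I))"
  have D: "D > 0" using d by (simp add: D_def)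
  define V where "V z = subvec (-I) (\<chi> i. z i) \<bullet> (Q *v subvec (-I) (\<chi> i. z i))" for z :: "'n \<Rightarrow> real"
  define A where "A = {z \<in> space ?P. \<forall>j\<in>-I. c $ j = 0 \<longrightarrow> z j > x $ j}"
  define h where "h z = ennreal (exp (- V z / 2)) * indicator A z" for z
  define g where "g i t = ennreal (exp (- (lam $ i * t))) * indicator {x $ i<..} t" for i t
  define B where "B = {y. (\<forall>i\<in>I. y $ i > x $ i) \<and> (\<forall>j\<in>-I. c $ j = 0 \<longrightarrow> y $ j > x $ j)}"
  have comp[measurable]: "(\<lambda>z. z j) \<in> borel_measurable ?P" if "j \<in> -I" for j
    using that measurable_component_singleton[of j "-I" "\<lambda>_. lborel :: real measure"] by simp
  have sv[measurable]: "(\<lambda>z. subvec (-I) (\<chi> i. z i)) \<in> borel_measurable ?P"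
    unfolding subvec_def
  proof (rule measurable_vec_lambda)
    fix i show "(\<lambda>z. if i \<in> - I then (\<chi> i. z i) $ i else 0) \<in> borel_measurable ?P"
      using comp[of i] by (cases "i \<in> -I") simp_all
  qed
  have V[measurable]: "V \<in> borel_measurable ?P"
    unfolding V_def by measurable
  have A[measurable]: "A \<in> sets ?P"
    unfolding A_def
  proof (rule sets.sets_Collect_finite_All, goal_cases)
    case (1 j)
    have "{z \<in> space ?P. z j > x $ j} \<in> sets ?P"
      using comp[OF 1] by measurable
    then show ?case by (cases "c $ j = 0") auto
  qed auto
  have h[measurable]: "h \<in> borel_measurable ?P"
    unfolding h_def by measurable
  have g[measurable]: "g i \<in> borel_measurable borel" for i
    unfolding g_def by measurable
  have "L = (\<integral>\<^sup>+y. (\<Prod>i\<in>I. g i (y $ i)) * h (\<lambda>j\<in>-I. y $ j) \<partial>lborel)"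
    unfolding L_def
  proof (rule nn_integral_cong)
    fix y :: "real ^ 'n"
    have 1: "V (\<lambda>j\<in>-I. y $ j) = subvec (-I) y \<bullet> (Q *v subvec (-I) y)"
    proof -
      have "subvec (-I) (\<chi> i. (\<lambda>j\<in>-I. y $ j) i) = subvec (-I) y"
        by (simp add: subvec_def vec_eq_iff)
      then show ?thesis by (simp only: V_def)
    qed
    have 2: "indicator A (\<lambda>j\<in>-I. y $ j) * (\<Prod>i\<in>I. indicator {x $ i<..} (y $ i)) = (indicator B y :: ennreal)"
    proof (cases "y \<in> B")
      case True
      then show ?thesis
        by (simp add: B_def A_def space_PiM indicator_def)
    next
      case False
      then have "(\<lambda>j\<in>-I. y $ j) \<notin> A \<or> (\<exists>i\<in>I. \<not> y $ i > x $ i)"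
        by (auto simp: B_def A_def)
      then show ?thesis
        using False by (auto simp: indicator_def intro!: prod_zero)
    qed
    have "(\<Prod>i\<in>I. g i (y $ i)) * h (\<lambda>j\<in>-I. y $ j)
      = (\<Prod>i\<in>I. ennreal (exp (- (lam $ i * y $ i)))) * ennreal (exp (- V (\<lambda>j\<in>-I. y $ j) / 2)) *
        (indicator A (\<lambda>j\<in>-I. y $ j) * (\<Prod>i\<in>I. indicator {x $ i<..} (y $ i)))"
      by (simp add: g_def h_def prod.distrib mult_ac)
    also have "(\<Prod>i\<in>I. ennreal (exp (- (lam $ i * y $ i)))) = ennreal (exp (- (\<Sum>i\<in>I. lam $ i * y $ i)))"
      by (simp add: prod_ennreal exp_sum flip: sum_negf)
    also have "\<dots> * ennreal (exp (- V (\<lambda>j\<in>-I. y $ j) / 2)) = ennreal (exp (- ((\<Sum>i\<in>I. lam $ i * y $ i) + V (\<lambda>j\<in>-I. y $ j) / 2)))"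
      by (simp flip: ennreal_mult exp_add)
    finally show "ennreal (exp (- ((\<Sum>i\<in>I. lam $ i * y $ i) + subvec (-I) y \<bullet> (Q *v subvec (-I) y) / 2)))
      * indicator {y. (\<forall>i\<in>I. y $ i > x $ i) \<and> (\<forall>j\<in>-I. c $ j = 0 \<longrightarrow> y $ j > x $ j)} y
      = (\<Prod>i\<in>I. g i (y $ i)) * h (\<lambda>j\<in>-I. y $ j)"
      unfolding 2 B_def[symmetric] 1 by (rule sym)
  qed
  also have "\<dots> = (\<Prod>i\<in>I. \<integral>\<^sup>+t. g i t \<partial>lborel) * (\<integral>\<^sup>+z. h z \<partial>?P)"
    by (rule nn_integral_lborel_split) measurable
  also have "(\<Prod>i\<in>I. \<integral>\<^sup>+t. g i t \<partial>lborel) = (\<Prod>i\<in>I. ennreal (exp (- (lam $ i * x $ i)) / lam $ i))"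
    unfolding g_def using lam by (intro prod.cong nn_integral_exp_tail) auto
  also have "\<dots> = ennreal (\<Prod>i\<in>I. exp (- (lam $ i * x $ i)) / lam $ i)"
    using lam by (intro prod_ennreal) (auto intro: less_imp_le)
  finally have L: "L = ennreal (\<Prod>i\<in>I. exp (- (lam $ i * x $ i)) / lam $ i) * (\<integral>\<^sup>+z. h z \<partial>?P)" .
  have prodpos: "(\<Prod>i\<in>I. exp (- (lam $ i * x $ i)) / lam $ i) > 0"
    using lam by (intro prod_pos) auto
  have prob: "enn2real (\<integral>\<^sup>+z. h z \<partial>?P) = D * cond_gaussian_prob S I c x"
  \<comment> \<open>For empty \<open>-I\<close> the product measure is a point mass and the conditional probability is \<open>1\<close> by convention.\<close>
  proof (cases "-I = {}")
    case True
    have "D = sqrt (det (mat 1 :: real ^ 'n ^ 'n))"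
      unfolding D_def True subdet_def by (simp add: pad_one_def mat_def)
    then have "D = 1" by simp
    moreover have "subvec (-I) v = 0" for v :: "real ^ 'n"
      using True by (simp add: subvec_def vec_eq_iff)
    then have "A = {\<lambda>_. undefined}" "V z = 0" for z
      using True by (auto simp: A_def space_PiM V_def)
    then have "(\<integral>\<^sup>+z. h z \<partial>?P) = 1"
      unfolding h_def by (simp add: True PiM_empty nn_integral_count_space_finite)
    ultimately show ?thesis
      using True by (simp add: cond_gaussian_prob_def)
  next
    case False
    define G where "G = cond_gaussian_law S I"
    have G: "G = density ?P (\<lambda>z. ennreal (exp (- V z / 2) / D))"
      unfolding G_def cond_gaussian_law_def gaussian_law_def Let_def schur_complement_def[symmetric]
        V_def D_def Q_def ..
    have spG: "space G = space ?P" by (simp add: G)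
    have "{z \<in> space G. \<forall>j\<in>-I. ereal (z j) > \<infinity> * ereal (c $ j) + ereal (x $ j)} = A"
    proof -
      have "ereal t > \<infinity> * ereal (c $ j) + ereal (x $ j) \<longleftrightarrow> (c $ j = 0 \<longrightarrow> t > x $ j)" if "j \<in> -I" for j t
        using c[of j] that by (cases "c $ j = 0") (auto simp: ereal_mult_eq_MInfty)
      then show ?thesis
        unfolding A_def spG by auto
    qed
    then have p: "cond_gaussian_prob S I c x = measure G A"
      using False by (simp add: cond_gaussian_prob_def G_def)
    have "(\<integral>\<^sup>+z. h z \<partial>?P) = (\<integral>\<^sup>+z. ennreal D * (ennreal (exp (- V z / 2) / D) * indicator A z) \<partial>?P)"
      unfolding h_def using D by (intro nn_integral_cong) (simp flip: ennreal_mult mult.assoc)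
    also have "\<dots> = ennreal D * emeasure G A"
      unfolding G by (simp add: nn_integral_cmult emeasure_density)
    finally show ?thesis
      using D by (simp add: p enn2real_mult measure_def)
  qed
  show "enn2real L = (\<Prod>i\<in>I. exp (- (lam $ i * x $ i)) / lam $ i) *
      (sqrt ((2 * pi) ^ card (-I) * subdet (-I) (schur_complement S I)) * cond_gaussian_prob S I c x)"
    unfolding L enn2real_mult prob D_def[symmetric] using prodpos by simp
  have "L \<noteq> 0"
  proof
    assume "L = 0"
    have Bm[measurable]: "B \<in> sets borel"
      unfolding B_def by measurable
    have "AE y in lborel. ennreal (exp (- ((\<Sum>i\<in>I. lam $ i * y $ i) + subvec (-I) y \<bullet> (Q *v subvec (-I) y) / 2))) * indicator B y = 0"
      using \<open>L = 0\<close> unfolding L_def B_def[symmetric]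
      by (subst (asm) nn_integral_0_iff_AE) (auto simp: subvec_def)
    then have "AE y in lborel. y \<notin> B"
      by eventually_elim (auto simp: indicator_def split: if_splits)
    then have "AE y in lborel. y \<notin> box x (x + 1)"
      by eventually_elim (auto simp: B_def mem_box_cart)
    then have "emeasure lborel (box x (x + 1)) = 0"
      by (subst (asm) AE_iff_measurable[OF _ refl]) (auto simp: Int_def)
    moreover have "(1 :: real ^ 'n) \<bullet> b = 1" if "b \<in> Basis" for b
      using that by (auto simp: Basis_cart inner_axis)
    ultimately show False
      by (subst (asm) emeasure_lborel_box) (auto simp: inner_add_left)
  qed
  then show "enn2real L > 0"
    using fin by (simp add: enn2real_positive_iff zero_less_iff_neq_zero)
qed

section \<open>Local coordinates at the minimiser of the quadratic program\<close>

text \<open>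
  The geometry at the minimiser. The hypotheses on \<open>a\<close> are the optimality conditions of the quadratic
  program: positive multipliers on \<open>I\<close>, feasibility off \<open>I\<close>.
\<close>

locale whitened_orthant =
  fixes A S W :: "real ^ 'n::finite ^ 'n" and I :: "'n set" and a x :: "real ^ 'n" and nrm :: real
  assumes AW: "transpose A ** W = shear S I"
    and W: "invertible W" "transpose W ** W = subinv I S + subinv (-I) (schur_complement S I)"
    and S: "transpose S = S" "invertible (pad_one I S)"
    and lam_pos: "\<And>i. i \<in> I \<Longrightarrow> (subinv I S *v subvec I a) $ i > 0"
    and nrm: "nrm > 0" "nrm\<^sup>2 = subvec I a \<bullet> (subinv I S *v subvec I a)"
    and feasible: "\<And>j. j \<notin> I \<Longrightarrow> a $ j \<le> (regression S I *v a) $ j"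
begin

abbreviation "QI \<equiv> subinv I S"
abbreviation "QJ \<equiv> subinv (-I) (schur_complement S I)"

text \<open>
  With \<open>\<eta> = 1 / (q * \<delta> * s powr \<delta>)\<close> and \<open>s = t * nrm\<close>, the two scalings of the problem are
  \<open>1 / v\<^sub>i = s * weight \<eta> i\<close>: order \<open>\<eta>\<close> in the directions of \<open>I\<close>, where the norm grows linearly, and order
  \<open>sqrt \<eta>\<close> in the others, where it grows quadratically.
\<close>

definition weight :: "real \<Rightarrow> 'n \<Rightarrow> real" where
  "weight \<eta> i = (if i \<in> I then \<eta> else sqrt \<eta>)"

definition dil :: "real \<Rightarrow> real ^ 'n \<Rightarrow> real ^ 'n" where
  "dil \<eta> y = (\<chi> i. weight \<eta> i * y $ i)"

definition centre :: "real ^ 'n" where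
  "centre = subvec I a /\<^sub>R nrm"

definition lam :: "real ^ 'n" where
  "lam = (QI *v subvec I a) /\<^sub>R nrm"

text \<open>
  The transpose of \<open>A\<close> sends \<open>chart s \<eta> 0\<close> to the minimiser of the quadratic program for \<open>(s / nrm) *\<^sub>R a\<close>.
\<close>

definition chart :: "real \<Rightarrow> real \<Rightarrow> real ^ 'n \<Rightarrow> real ^ 'n" where
  "chart s \<eta> y = s *\<^sub>R (W *v (centre + dil \<eta> y))"

text \<open>
  First-order and second-order coefficients in \<open>\<eta>\<close> of the squared radius, see \<open>rad_square\<close> below; in the
  limit only \<open>ell\<close> survives.
\<close>

definition ell :: "real ^ 'n \<Rightarrow> real" where
  "ell y = (\<Sum>i\<in>I. lam $ i * y $ i) + subvec (-I) y \<bullet> (QJ *v subvec (-I) y) / 2"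

definition kap :: "real ^ 'n \<Rightarrow> real" where
  "kap y = subvec I y \<bullet> (QI *v subvec I y)"

definition orthant :: "real \<Rightarrow> real \<Rightarrow> (real ^ 'n) set" where
  "orthant s \<eta> = {z. \<forall>i. (transpose A *v z) $ i > s * (a $ i / nrm + weight \<eta> i * x $ i)}"

definition rad :: "real \<Rightarrow> real ^ 'n \<Rightarrow> real" where
  "rad \<eta> y = norm (W *v (centre + dil \<eta> y))"

lemma norm_W: "(norm (W *v v))\<^sup>2 = v \<bullet> (QI *v v) + v \<bullet> (QJ *v v)"
proof -
  have "(norm (W *v v))\<^sup>2 = v \<bullet> ((transpose W ** W) *v v)"
    by (simp add: power2_norm_eq_inner dot_lmul_matrix[symmetric] flip: matrix_vector_mul_assoc)
      (simp add: inner_commute dot_lmul_matrix)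
  then show ?thesis
    by (simp add: W(2) matrix_vector_mult_add_rdistrib inner_add_right)
qed

lemma inner_QI: "v \<bullet> (QI *v w) = subvec I v \<bullet> (QI *v subvec I w)"
  by (simp add: inner_subvec subvec_subinv subinv_mult_subvec)

lemma inner_QJ: "v \<bullet> (QJ *v w) = subvec (-I) v \<bullet> (QJ *v subvec (-I) w)"
  by (simp add: inner_subvec subvec_subinv subinv_mult_subvec)

lemma QI_sym: "v \<bullet> (QI *v w) = w \<bullet> (QI *v v)"
proof -
  have "v \<bullet> (QI *v w) = (v v* QI) \<bullet> w"
    by (simp add: dot_lmul_matrix)
  also have "v v* QI = transpose QI *v v"
    by simp
  finally show ?thesis
    by (simp add: transpose_subinv[OF S(2,1)] inner_commute)
qed

lemma subvec_centre: "subvec I centre = centre" "subvec (-I) centre = 0"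
  by (auto simp: centre_def subvec_def vec_eq_iff)

lemma subvec_dil: "subvec I (dil \<eta> y) = \<eta> *\<^sub>R subvec I y" "subvec (-I) (dil \<eta> y) = sqrt \<eta> *\<^sub>R subvec (-I) y"
  by (auto simp: dil_def weight_def subvec_def vec_eq_iff)

lemma subvec_add: "subvec K (u + v) = subvec K u + subvec K v"
  by (simp add: subvec_def vec_eq_iff)

lemma lam_inner: "subvec I y \<bullet> lam = (\<Sum>i\<in>I. lam $ i * y $ i)"
  unfolding inner_vec_def subvec_def
  by (intro sum.mono_neutral_cong_right) (auto simp: mult.commute)

lemma lam_centre: "QI *v centre = lam"
  by (simp add: centre_def lam_def matrix_vector_mult_scaleR)

lemma lam_norm: "(\<Sum>i\<in>I. lam $ i * (a $ i / nrm)) = 1"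
proof -
  have "(\<Sum>i\<in>I. lam $ i * (a $ i / nrm)) = (\<Sum>i\<in>I. lam $ i * a $ i) / nrm"
    by (simp add: sum_divide_distrib)
  also have "\<dots> = subvec I a \<bullet> (QI *v subvec I a) / nrm / nrm"
  proof -
    have "(\<Sum>i\<in>I. lam $ i * a $ i) = subvec I a \<bullet> lam"
      by (simp only: lam_inner)
    then show ?thesis by (simp add: lam_def divide_inverse)
  qed
  finally show ?thesis
    using nrm by (simp flip: nrm(2) add: power2_eq_square)
qed

lemma rad_square:
  assumes "\<eta> \<ge> 0"
  shows "(rad \<eta> y)\<^sup>2 = 1 + 2 * \<eta> * ell y + \<eta>\<^sup>2 * kap y"
proof -
  have c: "centre \<bullet> lam = 1"
    using nrm by (simp add: centre_def lam_def flip: nrm(2)) (simp add: power2_eq_square field_simps)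
  have I: "(centre + \<eta> *\<^sub>R subvec I y) \<bullet> (QI *v (centre + \<eta> *\<^sub>R subvec I y))
    = 1 + 2 * \<eta> * (\<Sum>i\<in>I. lam $ i * y $ i) + \<eta>\<^sup>2 * kap y"
    using QI_sym[of centre "subvec I y"]
    by (simp add: matrix_vector_right_distrib inner_add_left inner_add_right matrix_vector_mult_scaleR
        lam_centre c kap_def lam_inner power2_eq_square algebra_simps)
  have J: "(sqrt \<eta> *\<^sub>R subvec (-I) y) \<bullet> (QJ *v (sqrt \<eta> *\<^sub>R subvec (-I) y)) = \<eta> * (subvec (-I) y \<bullet> (QJ *v subvec (-I) y))"
    using assms by (simp add: matrix_vector_mult_scaleR)
  have "(rad \<eta> y)\<^sup>2 = subvec I (centre + dil \<eta> y) \<bullet> (QI *v subvec I (centre + dil \<eta> y))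
     + subvec (-I) (centre + dil \<eta> y) \<bullet> (QJ *v subvec (-I) (centre + dil \<eta> y))"
    unfolding rad_def norm_W by (metis inner_QI inner_QJ)
  also have "\<dots> = 1 + 2 * \<eta> * ell y + \<eta>\<^sup>2 * kap y"
    unfolding subvec_add subvec_centre subvec_dil add_0_left I J by (simp add: ell_def algebra_simps)
  finally show ?thesis .
qed

lemma kap_nonneg: "kap y \<ge> 0"
proof -
  have "(norm (W *v subvec I y))\<^sup>2 = kap y"
  proof -
    have "subvec (-I) (subvec I y) = 0"
      by (auto simp: subvec_def vec_eq_iff)
    then show ?thesis
      unfolding norm_W kap_def inner_QJ[of "subvec I y"] by simp
  qed
  then show ?thesis by (metis zero_le_power2)
qed

lemma QJ_lower: obtains c where "c > 0" "\<And>y. c * (norm (subvec (-I) y))\<^sup>2 \<le> subvec (-I) y \<bullet> (QJ *v subvec (-I) y)"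
proof -
  have "inj ((*v) W)"
    using W(1) by (simp add: inj_matrix_vector_mult)
  then obtain B where B: "B > 0" "\<And>v. B * norm v \<le> norm (W *v v)"
    using linear_inj_bounded_below_pos[of "(*v) W"] by auto
  show ?thesis
  proof (rule that[of "B\<^sup>2"])
    show "B\<^sup>2 > 0" using B by simp
    fix y
    have "subvec I (subvec (-I) y) = 0"
      by (auto simp: subvec_def vec_eq_iff)
    then have "(norm (W *v subvec (-I) y))\<^sup>2 = subvec (-I) y \<bullet> (QJ *v subvec (-I) y)"
      unfolding norm_W inner_QI[of "subvec (-I) y"] by simp
    moreover have "(B * norm (subvec (-I) y))\<^sup>2 \<le> (norm (W *v subvec (-I) y))\<^sup>2"
      using B by (intro power_mono) auto
    ultimately show "B\<^sup>2 * (norm (subvec (-I) y))\<^sup>2 \<le> subvec (-I) y \<bullet> (QJ *v subvec (-I) y)"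
      by (simp add: power_mult_distrib)
  qed
qed

lemma chart_coord:
  "(transpose A *v chart s \<eta> y) $ i = s * (if i \<in> I then a $ i / nrm + \<eta> * y $ i
     else sqrt \<eta> * y $ i + (regression S I *v a) $ i / nrm + \<eta> * (regression S I *v y) $ i)"
proof -
  let ?v = "centre + dil \<eta> y"
  have "transpose A *v chart s \<eta> y = s *\<^sub>R (shear S I *v ?v)"
    by (simp add: chart_def matrix_vector_mult_scaleR matrix_vector_mul_assoc AW)
  moreover have "regression S I *v subvec I ?v = (regression S I *v a) /\<^sub>R nrm + \<eta> *\<^sub>R (regression S I *v y)"
    unfolding subvec_add subvec_centre subvec_dil
    by (simp add: matrix_vector_right_distrib matrix_vector_mult_scaleR centre_def regression_mult_subvec)
  ultimately show ?thesis
    by (simp add: shear_vec_nth) (simp add: centre_def dil_def weight_def subvec_def divide_inverse mult.commute)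
qed

text \<open>
  The scale \<open>s\<close> cancels, so the rescaled orthant depends on \<open>\<eta>\<close> alone. The conditions for \<open>I\<close> do not
  even depend on \<open>\<eta>\<close>; those for \<open>j \<notin> I\<close> become the constraint \<open>y $ j > x $ j\<close> or disappear in the limit,
  according to whether the constraint \<open>j\<close> of the quadratic program is tight.
\<close>

lemma chart_in_orthant:
  assumes "s > 0" "\<eta> > 0"
  shows "chart s \<eta> y \<in> orthant s \<eta> \<longleftrightarrow> (\<forall>i\<in>I. y $ i > x $ i) \<and>
    (\<forall>j\<in>-I. sqrt \<eta> * (y $ j - x $ j) + \<eta> * (regression S I *v y) $ j > (a $ j - (regression S I *v a) $ j) / nrm)"
proof -
  have "chart s \<eta> y \<in> orthant s \<eta> \<longleftrightarrow> (\<forall>i. (if i \<in> I then y $ i > x $ i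
    else sqrt \<eta> * (y $ i - x $ i) + \<eta> * (regression S I *v y) $ i > (a $ i - (regression S I *v a) $ i) / nrm))"
    unfolding orthant_def mem_Collect_eq chart_coord mult_less_cancel_left_pos[OF assms(1)]
    using assms(2) by (intro all_cong1) (auto simp: weight_def diff_divide_distrib algebra_simps)
  then show ?thesis by auto
qed

text \<open>
  On the shadow, the exponent \<open>ell\<close> grows at least linearly: along \<open>I\<close> by \<open>shifted_cone_bound\<close>, and
  along the other coordinates since it contains a positive definite quadratic form.
\<close>

lemma shadow_bound:
  obtains \<eta>0 c K where "\<eta>0 > 0" "c > 0" "K \<ge> 0"
    "\<And>s \<eta> y. s > 0 \<Longrightarrow> 0 < \<eta> \<Longrightarrow> \<eta> \<le> \<eta>0 \<Longrightarrow> chart s \<eta> y \<in> shadow (orthant s \<eta>) \<Longrightarrow> ell y \<ge> c * norm y - K"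
proof -
  have lp: "lam $ i > 0" if "i \<in> I" for i
    using lam_pos[OF that] nrm by (simp add: lam_def)
  have ln: "(\<Sum>i\<in>I. lam $ i * (a /\<^sub>R nrm) $ i) = 1"
    using lam_norm by (simp add: divide_inverse mult.commute)
  obtain \<eta>0 c1 K1 where c1: "\<eta>0 > 0" "c1 > 0"
    and bound: "\<And>\<eta> \<tau> y. 0 < \<eta> \<Longrightarrow> \<eta> \<le> \<eta>0 \<Longrightarrow> 0 < \<tau> \<Longrightarrow> \<tau> \<le> 1 \<Longrightarrow>
       (\<And>i. i \<in> I \<Longrightarrow> \<tau> * ((a /\<^sub>R nrm) $ i + \<eta> * y $ i) > (a /\<^sub>R nrm) $ i + \<eta> * x $ i) \<Longrightarrow>
       c1 * (\<Sum>i\<in>I. \<bar>y $ i\<bar>) - K1 \<le> (\<Sum>i\<in>I. lam $ i * y $ i)"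
    using shifted_cone_bound[OF lp ln, of x] by blast
  obtain c2 where c2: "c2 > 0" "\<And>y. c2 * (norm (subvec (-I) y))\<^sup>2 \<le> subvec (-I) y \<bullet> (QJ *v subvec (-I) y)"
    using QJ_lower by blast
  define c where "c = min c1 c2"
  show ?thesis
  proof (rule that[of \<eta>0 c "\<bar>K1\<bar> + c2"])
    fix s \<eta> y
    assume s: "s > 0" and \<eta>: "0 < \<eta>" "\<eta> \<le> \<eta>0" and sh: "chart s \<eta> y \<in> shadow (orthant s \<eta>)"
    obtain \<tau> where \<tau>: "0 < \<tau>" "\<tau> \<le> 1" "\<tau> *\<^sub>R chart s \<eta> y \<in> orthant s \<eta>"
      using sh by (auto simp: shadow_def)
    have "\<tau> * ((a /\<^sub>R nrm) $ i + \<eta> * y $ i) > (a /\<^sub>R nrm) $ i + \<eta> * x $ i" if "i \<in> I" for i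
    proof -
      have "\<tau> * (s * (a $ i / nrm + \<eta> * y $ i)) > s * (a $ i / nrm + \<eta> * x $ i)"
        using \<tau>(3) that spec[of _ i] unfolding orthant_def mem_Collect_eq matrix_vector_mult_scaleR vector_scaleR_component chart_coord
        by (auto simp: weight_def dest: spec[of _ i])
      then have "s * (\<tau> * (a $ i / nrm + \<eta> * y $ i)) > s * (a $ i / nrm + \<eta> * x $ i)"
        by (simp add: mult_ac)
      then show ?thesis
        using s by (simp add: divide_inverse mult.commute)
    qed
    from bound[OF \<eta> \<tau>(1,2) this] have 1: "c1 * (\<Sum>i\<in>I. \<bar>y $ i\<bar>) - K1 \<le> (\<Sum>i\<in>I. lam $ i * y $ i)" .
    let ?nJ = "norm (subvec (-I) y)"
    have "0 \<le> (?nJ - 1)\<^sup>2" by simp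
    then have "2 * ?nJ - 1 \<le> ?nJ\<^sup>2" by (simp add: power2_eq_square algebra_simps)
    then have "c2 * (2 * ?nJ - 1) \<le> c2 * ?nJ\<^sup>2" using c2 by (intro mult_left_mono) auto
    with c2(2)[of y] have 2: "c2 * ?nJ - c2 \<le> subvec (-I) y \<bullet> (QJ *v subvec (-I) y) / 2"
      using c2(1) by (simp add: algebra_simps)
    have nI: "norm (subvec I y) \<le> (\<Sum>i\<in>I. \<bar>y $ i\<bar>)"
    proof -
      have "norm (subvec I y) \<le> (\<Sum>i\<in>UNIV. \<bar>subvec I y $ i\<bar>)"
        by (rule norm_le_l1_cart)
      also have "\<dots> = (\<Sum>i\<in>I. \<bar>y $ i\<bar>)"
        by (intro sum.mono_neutral_cong_right) (auto simp: subvec_def)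
      finally show ?thesis .
    qed
    have "norm y \<le> norm (subvec I y) + ?nJ"
      using norm_triangle_ineq[of "subvec I y" "subvec (-I) y"] by (simp add: subvec_add_compl)
    then have "c * norm y \<le> c * (norm (subvec I y) + ?nJ)"
      using c1 c2 by (intro mult_left_mono) (auto simp: c_def)
    also have "\<dots> \<le> c1 * (\<Sum>i\<in>I. \<bar>y $ i\<bar>) + c2 * ?nJ"
      unfolding distrib_left using c1 c2 nI by (intro add_mono mult_mono) (auto simp: c_def)
    finally show "ell y \<ge> c * norm y - (\<bar>K1\<bar> + c2)"
      using 1 2 by (simp add: ell_def)
  qed (use c1 c2 in \<open>auto simp: c_def\<close>)
qed

end

section \<open>Asymptotics of the orthant probability\<close>

lemma measurable_subvec [measurable (raw)]:
  fixes f :: "'b \<Rightarrow> real ^ 'n::finite"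
  assumes "f \<in> borel_measurable M"
  shows "(\<lambda>y. subvec K (f y)) \<in> borel_measurable M"
  using assms unfolding coord_proj_vec[symmetric] by measurable

text \<open>
  The radial law is replaced by the measure with the density \<open>tail_density\<close>. Its mass of the orthant is
  an explicit Lebesgue integral over the chart coordinates.
\<close>

locale kotz_orthant = whitened_orthant A S W I a x nrm
  for A S W :: "real ^ 'n::finite ^ 'n" and I a x nrm +
  fixes p q \<delta> \<nu> r0 :: real
  assumes pos: "p > 0" "q > 0" "\<delta> > 0" "r0 > 0"
    and nonneg: "\<And>r. tail_density p q \<delta> \<nu> r0 r \<ge> 0"
begin


definition eta :: "real \<Rightarrow> real" where
  "eta s = 1 / (q * \<delta> * s powr \<delta>)"

abbreviation cone :: "real \<Rightarrow> (real ^ 'n) set" where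
  "cone s \<equiv> orthant s (eta s)"

definition radial :: "real measure" where
  "radial = density lborel (\<lambda>r. ennreal (tail_density p q \<delta> \<nu> r0 r))"

definition ratio :: "real \<Rightarrow> real ^ 'n \<Rightarrow> real" where
  "ratio \<eta> y = radial_ratio \<delta> (\<nu> + \<delta> - CARD('n)) \<nu> \<eta> (rad \<eta> y)"

definition jacobian :: "real \<Rightarrow> real" where
  "jacobian s = \<bar>det W\<bar> * (\<Prod>i\<in>UNIV. s * weight (eta s) i)"

definition scale :: "real \<Rightarrow> real" where
  "scale s = jacobian s * (p * q * \<delta> * s powr (\<nu> + \<delta> - CARD('n)) * exp (- q * s powr \<delta>)) / (CARD('n) * unit_ball_vol CARD('n))"

text \<open>
  \<open>scale s * chart_mass B s\<close> is the mass of \<open>B\<close> under the comparison law, see \<open>radial_mass_chart\<close> below.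
\<close>

definition chart_mass :: "(real ^ 'n) set \<Rightarrow> real \<Rightarrow> ennreal" where
  "chart_mass B s = (\<integral>\<^sup>+y. indicator B (chart s (eta s) y) * ennreal (ratio (eta s) y) \<partial>lborel)"

definition limit_set :: "(real ^ 'n) set" where
  "limit_set = {y. (\<forall>i\<in>I. y $ i > x $ i) \<and> (\<forall>j\<in>-I. (a - regression S I *v a) $ j = 0 \<longrightarrow> y $ j > x $ j)}"

definition limit_mass :: ennreal where
  "limit_mass = (\<integral>\<^sup>+y. ennreal (exp (- ell y)) * indicator limit_set y \<partial>lborel)"

lemma eta_pos: "s > 0 \<Longrightarrow> eta s > 0"
  using pos by (simp add: eta_def)

lemma weight_pos: "\<eta> > 0 \<Longrightarrow> weight \<eta> i > 0"
  by (simp add: weight_def)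

lemma detW: "det W \<noteq> 0"
  using W(1) by (simp add: invertible_det_nz)

lemma jacobian_pos: "s > 0 \<Longrightarrow> jacobian s > 0"
  unfolding jacobian_def using detW weight_pos[OF eta_pos] by (auto intro!: mult_pos_pos prod_pos)

lemma vol_pos: "real CARD('n) * unit_ball_vol CARD('n) > 0"
  by (simp add: zero_less_mult_iff)

lemma scale_pos: "s > 0 \<Longrightarrow> scale s > 0"
  unfolding scale_def using jacobian_pos pos vol_pos by (auto intro!: divide_pos_pos mult_pos_pos)

lemma measurable_dil [measurable]: "dil \<eta> \<in> borel_measurable borel"
  unfolding dil_def by measurable

lemma measurable_chart [measurable]: "chart s \<eta> \<in> borel_measurable borel"
  unfolding chart_def by measurable

lemma measurable_rad [measurable]: "rad \<eta> \<in> borel_measurable borel"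
  unfolding rad_def by measurable

lemma measurable_ell [measurable]: "ell \<in> borel_measurable borel"
  unfolding ell_def by measurable

lemma measurable_ratio [measurable]: "ratio \<eta> \<in> borel_measurable borel"
  unfolding ratio_def radial_ratio_def by measurable

lemma norm_chart: "s > 0 \<Longrightarrow> norm (chart s \<eta> y) = s * rad \<eta> y"
  by (simp add: chart_def rad_def)

definition chart_matrix :: "real \<Rightarrow> real \<Rightarrow> real ^ 'n ^ 'n" where
  "chart_matrix s \<eta> = W ** (\<chi> i j. if i = j then s * weight \<eta> i else 0)"

lemma chart_affine: "chart s \<eta> y = s *\<^sub>R (W *v centre) + chart_matrix s \<eta> *v y"
proof -
  have "(\<chi> i j. if i = j then s * weight \<eta> i else 0) *v y = s *\<^sub>R dil \<eta> y"
    by (simp add: matrix_vector_mult_def vec_eq_iff dil_def if_distrib[where f = "\<lambda>c. c * _"] cong: if_cong)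
  then show ?thesis
    by (simp add: chart_def chart_matrix_def matrix_vector_right_distrib matrix_vector_mult_scaleR
        scaleR_add_right flip: matrix_vector_mul_assoc)
qed

lemma det_chart_matrix: "det (chart_matrix s \<eta>) = det W * (\<Prod>i\<in>UNIV. s * weight \<eta> i)"
  unfolding chart_matrix_def det_mul by (subst (2) det_diagonal) auto

lemma chart_surj:
  assumes "s > 0"
  obtains y where "z = chart s (eta s) y"
proof -
  have nz: "det (chart_matrix s (eta s)) \<noteq> 0"
    unfolding det_chart_matrix using assms detW weight_pos[OF eta_pos[OF assms]]
    by (auto simp: less_le)
  then have inv: "invertible (chart_matrix s (eta s))"
    by (simp add: invertible_det_nz)
  have "z = chart s (eta s) (matrix_inv (chart_matrix s (eta s)) *v (z - s *\<^sub>R (W *v centre)))"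
    unfolding chart_affine by (simp add: matrix_vector_mul_assoc matrix_inv_mult[OF inv])
  then show ?thesis by (rule that)
qed

text \<open>
  An integrable majorant on the shadow, uniform in small \<open>\<eta>\<close>. The lower bound on \<open>rad\<close> also shows that
  the shadow moves away from the origin as \<open>s\<close> grows, so that only the tail of the radial law matters.
\<close>

lemma domination:
  obtains \<eta>0 w where "\<eta>0 > 0" "w \<in> borel_measurable borel" "(\<integral>\<^sup>+y. ennreal (w y) \<partial>lborel) < \<infinity>"
    "\<And>s \<eta> y. s > 0 \<Longrightarrow> 0 < \<eta> \<Longrightarrow> \<eta> \<le> \<eta>0 \<Longrightarrow> chart s \<eta> y \<in> shadow (orthant s \<eta>) \<Longrightarrow>
      rad \<eta> y \<ge> 1/2 \<and> ratio \<eta> y \<le> w y"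
proof -
  obtain \<eta>1 c K where c: "\<eta>1 > 0" "c > 0" "K \<ge> 0"
    and ell: "\<And>s \<eta> y. s > 0 \<Longrightarrow> 0 < \<eta> \<Longrightarrow> \<eta> \<le> \<eta>1 \<Longrightarrow> chart s \<eta> y \<in> shadow (orthant s \<eta>) \<Longrightarrow> ell y \<ge> c * norm y - K"
    using shadow_bound by blast
  define P where "P = 2 * real CARD('n)"
  have P: "P > 0" by (simp add: P_def)
  obtain \<eta>2 where \<eta>2: "\<eta>2 > 0" and bound: "\<And>\<eta> m r. 0 < \<eta> \<Longrightarrow> \<eta> \<le> \<eta>2 \<Longrightarrow> m \<ge> 0 \<Longrightarrow> r > 0 \<Longrightarrow> r\<^sup>2 \<ge> 1 + 2 * \<eta> * (m - K) \<Longrightarrow>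
      radial_ratio \<delta> (\<nu> + \<delta> - CARD('n)) \<nu> \<eta> r \<le> 2 * exp (4 * K) * (1 + m / (2 * P)) powr (- P)"
    using radial_ratio_bound[OF pos(3) c(3) P, of "\<nu> + \<delta> - CARD('n)" \<nu>] by blast
  \<comment> \<open>Small enough for \<open>2 * \<eta> * K \<le> 3 / 4\<close>, which makes the squared radius at least \<open>1 / 4\<close>.\<close>
  define \<eta>3 where "\<eta>3 = 3 / (8 * (K + 1))"
  define w where "w y = 2 * exp (4 * K) * (1 + c / (2 * P) * norm y) powr (- P)" for y :: "real ^ 'n"
  show ?thesis
  proof (rule that[of "min \<eta>1 (min \<eta>2 \<eta>3)" w])
    show "min \<eta>1 (min \<eta>2 \<eta>3) > 0" using c \<eta>2 by (simp add: \<eta>3_def)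
    show "w \<in> borel_measurable borel" unfolding w_def by measurable
    have "(\<integral>\<^sup>+y. ennreal (w y) \<partial>lborel) = (\<integral>\<^sup>+y. ennreal (2 * exp (4 * K)) * ennreal ((1 + c / (2 * P) * norm (y :: real ^ 'n)) powr (- P)) \<partial>lborel)"
      unfolding w_def by (intro nn_integral_cong) (simp add: ennreal_mult)
    also have "\<dots> = ennreal (2 * exp (4 * K)) * (\<integral>\<^sup>+y. ennreal ((1 + c / (2 * P) * norm (y :: real ^ 'n)) powr (- P)) \<partial>lborel)"
      by (rule nn_integral_cmult) measurable
    also have "\<dots> < \<infinity>"
      using nn_integral_power_decay[of "c / (2 * P)", where 'n = 'n] c P
      by (simp add: P_def ennreal_mult_less_top)
    finally show "(\<integral>\<^sup>+y. ennreal (w y) \<partial>lborel) < \<infinity>" .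
    fix s \<eta> y
    assume s: "s > 0" and \<eta>: "0 < \<eta>" "\<eta> \<le> min \<eta>1 (min \<eta>2 \<eta>3)" and sh: "chart s \<eta> y \<in> shadow (orthant s \<eta>)"
    have e: "ell y \<ge> c * norm y - K"
      using ell[OF s \<eta>(1) _ sh] \<eta> by simp
    have "2 * \<eta> * (c * norm y - K) \<le> 2 * \<eta> * ell y"
      using e \<eta> by (intro mult_left_mono) auto
    moreover have "\<eta>\<^sup>2 * kap y \<ge> 0" using kap_nonneg by simp
    ultimately have r2: "(rad \<eta> y)\<^sup>2 \<ge> 1 + 2 * \<eta> * (c * norm y - K)"
      using rad_square[OF less_imp_le[OF \<eta>(1)], of y] by linarith
    have "\<eta> * (8 * (K + 1)) \<le> 3"
      using \<eta> c by (simp add: \<eta>3_def pos_le_divide_eq)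
    then have "2 * \<eta> * K \<le> 3 / 4" using \<eta> by (simp add: algebra_simps)
    moreover have "0 \<le> 2 * \<eta> * (c * norm y)" using \<eta> c by simp
    ultimately have "(1/2)\<^sup>2 \<le> (rad \<eta> y)\<^sup>2"
      using r2 by (simp add: algebra_simps power2_eq_square)
    then have half: "rad \<eta> y \<ge> 1/2"
      by (rule power2_le_imp_le) (simp add: rad_def)
    moreover have "ratio \<eta> y \<le> 2 * exp (4 * K) * (1 + (c * norm y) / (2 * P)) powr (- P)"
      unfolding ratio_def using \<eta> half r2 c by (intro bound) auto
    ultimately show "rad \<eta> y \<ge> 1/2 \<and> ratio \<eta> y \<le> w y"
      by (simp add: w_def)
  qed
qed

lemma radial_mass_chart:
  assumes s: "s > 0" and [measurable]: "B \<in> sets borel"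
    and far: "\<And>y. chart s (eta s) y \<in> B \<Longrightarrow> rad (eta s) y \<ge> 1/2" and sr: "s \<ge> 2 * r0"
  shows "radial_mass radial uniform_sphere B = ennreal (scale s) * chart_mass B s"
proof -
  let ?\<eta> = "eta s" and ?C = "p * q * \<delta> * s powr (\<nu> + \<delta> - CARD('n)) * exp (- q * s powr \<delta>)"
  let ?f = "\<lambda>z. indicator B z * ennreal (tail_density p q \<delta> \<nu> r0 (norm z) / norm z ^ (CARD('n) - 1))"
  define v where "v = real CARD('n) * unit_ball_vol CARD('n)"
  have v: "v > 0" unfolding v_def by (rule vol_pos)
  have \<eta>: "?\<eta> > 0" by (rule eta_pos[OF s])
  have C: "?C > 0" using pos s by simp
  have nz: "det (chart_matrix s ?\<eta>) \<noteq> 0" "\<bar>det (chart_matrix s ?\<eta>)\<bar> = jacobian s"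
    unfolding det_chart_matrix jacobian_def using s detW weight_pos[OF \<eta>]
    by (auto simp: abs_mult abs_prod less_le intro!: prod.cong)
  have "ennreal v * radial_mass radial uniform_sphere B = (\<integral>\<^sup>+z. ?f z \<partial>lborel)"
    unfolding radial_def v_def by (rule radial_mass_density) (auto simp: nonneg)
  also have "\<dots> = ennreal (jacobian s) * (\<integral>\<^sup>+y. ?f (chart s ?\<eta> y) \<partial>lborel)"
    unfolding chart_affine nz(2)[symmetric] by (rule nn_integral_lborel_affine[OF _ nz(1)]) measurable
  also have "(\<integral>\<^sup>+y. ?f (chart s ?\<eta> y) \<partial>lborel)
      = (\<integral>\<^sup>+y. ennreal ?C * (indicator B (chart s ?\<eta> y) * ennreal (ratio ?\<eta> y)) \<partial>lborel)"
  proof (rule nn_integral_cong)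
    fix y
    show "?f (chart s ?\<eta> y) = ennreal ?C * (indicator B (chart s ?\<eta> y) * ennreal (ratio ?\<eta> y))"
    proof (cases "chart s ?\<eta> y \<in> B")
      case True
      have r: "rad ?\<eta> y \<ge> 1/2" using far[OF True] .
      have "s * (1/2) \<le> s * rad ?\<eta> y" using s r by (intro mult_left_mono) auto
      then have "s * rad ?\<eta> y \<ge> r0" using sr by simp
      then have "tail_density p q \<delta> \<nu> r0 (s * rad ?\<eta> y) / (s * rad ?\<eta> y) ^ (CARD('n) - 1) = ?C * ratio ?\<eta> y"
        using tail_density_scale[OF pos(2,3) s, of "rad ?\<eta> y" r0 "CARD('n)" p \<nu>] r
        by (simp add: ratio_def eta_def Suc_le_eq)
      then show ?thesis
        using True C s by (simp add: norm_chart ennreal_mult')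
    qed simp
  qed
  also have "\<dots> = ennreal ?C * chart_mass B s"
    unfolding chart_mass_def by (rule nn_integral_cmult) measurable
  finally have eq: "ennreal v * radial_mass radial uniform_sphere B = ennreal (jacobian s * ?C) * chart_mass B s"
    using C jacobian_pos[OF s] by (simp add: ennreal_mult mult.assoc)
  have "radial_mass radial uniform_sphere B = ennreal (1 / v) * (ennreal v * radial_mass radial uniform_sphere B)"
    using v by (simp flip: mult.assoc ennreal_mult')
  also have "\<dots> = ennreal (scale s) * chart_mass B s"
    unfolding eq scale_def v_def[symmetric] using v C jacobian_pos[OF s] by (simp flip: mult.assoc ennreal_mult')
  finally show ?thesis .
qed

lemma open_orthant: "open (orthant s \<eta>)" and convex_orthant: "convex (orthant s \<eta>)"
proof -
  have eq: "orthant s \<eta> = (\<Inter>i. {z. s * (a $ i / nrm + weight \<eta> i * x $ i) < (transpose A $ i) \<bullet> z})"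
    unfolding orthant_def matrix_vector_mul_component by auto
  show "open (orthant s \<eta>)"
    unfolding eq by (intro open_INT) (auto intro: open_halfspace_gt)
  show "convex (orthant s \<eta>)"
    unfolding eq by (intro convex_INT) (auto intro: convex_halfspace_gt)
qed

lemma eta_tendsto:
  assumes "filterlim s at_top sequentially"
  shows "(\<lambda>n. eta (s n)) \<longlonglongrightarrow> 0"
proof -
  have "((\<lambda>u. 1 / (q * \<delta> * u powr \<delta>)) \<longlongrightarrow> 0) at_top"
    using pos by real_asymp
  then show ?thesis
    unfolding eta_def by (rule filterlim_compose[OF _ assms])
qed

text \<open>
  A constraint with negative slack \<open>(a - regression S I *v a) $ j\<close> holds eventually, as its other side
  tends to \<open>0\<close>. In a tight constraint \<open>sqrt \<eta>\<close> can be divided out, and the influence of the coordinates in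
  \<open>I\<close> is of lower order; points with \<open>y $ j = x $ j\<close> have to be excluded.
\<close>

lemma indicator_orthant_tendsto:
  assumes s: "filterlim s at_top sequentially" "\<And>n. s n > 0" and y: "\<And>j. y $ j \<noteq> x $ j"
  shows "\<forall>\<^sub>F n in sequentially. chart (s n) (eta (s n)) y \<in> cone (s n) \<longleftrightarrow> y \<in> limit_set"
proof -
  let ?c = "a - regression S I *v a" and ?\<rho> = "regression S I *v y"
  have \<eta>: "(\<lambda>n. eta (s n)) \<longlonglongrightarrow> 0" "\<And>n. eta (s n) > 0"
    using eta_tendsto[OF s(1)] eta_pos[OF s(2)] by auto
  then have r\<eta>: "(\<lambda>n. sqrt (eta (s n))) \<longlonglongrightarrow> 0"
    using tendsto_real_sqrt by fastforce
  have J: "\<forall>\<^sub>F n in sequentially. sqrt (eta (s n)) * (y $ j - x $ j) + eta (s n) * ?\<rho> $ j > ?c $ j / nrm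
      \<longleftrightarrow> (?c $ j = 0 \<longrightarrow> y $ j > x $ j)" if "j \<in> -I" for j
  proof (cases "?c $ j = 0")
    case False
    then have "?c $ j / nrm < 0"
      using feasible[of j] that nrm by (simp add: divide_less_0_iff)
    moreover have "(\<lambda>n. sqrt (eta (s n)) * (y $ j - x $ j) + eta (s n) * ?\<rho> $ j) \<longlonglongrightarrow> 0 * (y $ j - x $ j) + 0 * ?\<rho> $ j"
      by (intro tendsto_intros \<eta> r\<eta>)
    ultimately have "\<forall>\<^sub>F n in sequentially. sqrt (eta (s n)) * (y $ j - x $ j) + eta (s n) * ?\<rho> $ j > ?c $ j / nrm"
      by (intro order_tendstoD(1)) auto
    then show ?thesis
      by (rule eventually_mono) (use False in auto)
  next
    case True
    let ?b = "y $ j - x $ j"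
    have fact: "sqrt (eta (s n)) * ?b + eta (s n) * ?\<rho> $ j > 0 \<longleftrightarrow> ?b + sqrt (eta (s n)) * ?\<rho> $ j > 0" for n
    proof -
      have "sqrt (eta (s n)) * ?b + eta (s n) * ?\<rho> $ j = sqrt (eta (s n)) * (?b + sqrt (eta (s n)) * ?\<rho> $ j)"
        using \<eta>(2)[of n] by (simp add: distrib_left flip: mult.assoc real_sqrt_mult)
      then show ?thesis
        using \<eta>(2)[of n] by (simp add: zero_less_mult_iff)
    qed
    have lim: "(\<lambda>n. ?b + sqrt (eta (s n)) * ?\<rho> $ j) \<longlonglongrightarrow> ?b + 0 * ?\<rho> $ j"
      by (intro tendsto_intros r\<eta>)
    have "\<forall>\<^sub>F n in sequentially. ?b + sqrt (eta (s n)) * ?\<rho> $ j > 0 \<longleftrightarrow> ?b > 0"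
    proof (cases "?b > 0")
      case True
      then have "\<forall>\<^sub>F n in sequentially. ?b + sqrt (eta (s n)) * ?\<rho> $ j > 0"
        using lim by (intro order_tendstoD(1)[OF lim]) auto
      then show ?thesis by (rule eventually_mono) (use True in auto)
    next
      case False
      then have "?b < 0" using y[of j] by simp
      then have "\<forall>\<^sub>F n in sequentially. ?b + sqrt (eta (s n)) * ?\<rho> $ j < 0"
        by (intro order_tendstoD(2)[OF lim]) auto
      then show ?thesis by (rule eventually_mono) (use False in auto)
    qed
    then show ?thesis
      by (rule eventually_mono) (use True fact in auto)
  qed
  have "\<forall>\<^sub>F n in sequentially. \<forall>j\<in>-I. sqrt (eta (s n)) * (y $ j - x $ j) + eta (s n) * ?\<rho> $ j > ?c $ j / nrm
      \<longleftrightarrow> (?c $ j = 0 \<longrightarrow> y $ j > x $ j)"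
    using J by (intro eventually_ball_finite) auto
  then show ?thesis
  proof eventually_elim
    case (elim n)
    then show ?case
      unfolding chart_in_orthant[OF s(2) \<eta>(2)] limit_set_def by auto
  qed
qed

lemma AE_coords_neq: "AE y in lborel. \<forall>j. (y :: real ^ 'n) $ j \<noteq> x $ j"
proof -
  have "AE y in lborel. (y :: real ^ 'n) $ j \<noteq> x $ j" for j
  proof (rule AE_I')
    show "{y. (y :: real ^ 'n) $ j = x $ j} \<in> null_sets lborel"
    proof -
      have "negligible {y. (y :: real ^ 'n) $ j = x $ j}"
        using negligible_hyperplane[of "axis j (1 :: real)" "x $ j"] by (simp add: inner_axis')
      moreover have "{y. (y :: real ^ 'n) $ j = x $ j} \<in> sets borel"
        by measurable
      ultimately show ?thesis
        by (simp add: negligible_iff_null_sets null_sets_completion_iff)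
    qed
  qed auto
  then show ?thesis
    by (simp add: AE_all_countable)
qed

text \<open>
  Dominated convergence. The majorant is valid for \<open>\<eta> \<le> \<eta>0\<close> only, so the integrand is set to \<open>0\<close> for the
  finitely many other indices.
\<close>

lemma chart_mass_bounds:
  assumes s: "filterlim s at_top sequentially" "\<And>n. s n > 0"
  obtains D where "D \<ge> 0" "\<forall>\<^sub>F n in sequentially. chart_mass (shadow (cone (s n))) (s n) \<le> ennreal D"
    "(\<lambda>n. chart_mass (cone (s n)) (s n)) \<longlonglongrightarrow> limit_mass" "limit_mass < \<infinity>"
    "\<forall>\<^sub>F n in sequentially. \<forall>y. chart (s n) (eta (s n)) y \<in> shadow (cone (s n)) \<longrightarrow> rad (eta (s n)) y \<ge> 1/2"
proof -
  obtain \<eta>0 w where \<eta>0: "\<eta>0 > 0" and w[measurable]: "w \<in> borel_measurable borel" and wfin: "(\<integral>\<^sup>+y. ennreal (w y) \<partial>lborel) < \<infinity>"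
    and dom: "\<And>s \<eta> y. s > 0 \<Longrightarrow> 0 < \<eta> \<Longrightarrow> \<eta> \<le> \<eta>0 \<Longrightarrow> chart s \<eta> y \<in> shadow (orthant s \<eta>) \<Longrightarrow>
      rad \<eta> y \<ge> 1/2 \<and> ratio \<eta> y \<le> w y"
    using domination by blast
  define D where "D = enn2real (\<integral>\<^sup>+y. ennreal (w y) \<partial>lborel)"
  have D: "ennreal D = (\<integral>\<^sup>+y. ennreal (w y) \<partial>lborel)"
    using wfin by (simp add: D_def)
  have \<eta>: "(\<lambda>n. eta (s n)) \<longlonglongrightarrow> 0" "\<And>n. eta (s n) > 0"
    using eta_tendsto[OF s(1)] eta_pos[OF s(2)] by auto
  have small: "\<forall>\<^sub>F n in sequentially. eta (s n) \<le> \<eta>0"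
    using order_tendstoD(2)[OF \<eta>(1) \<eta>0] by (rule eventually_mono) simp
  have mass_le: "chart_mass B (s n) \<le> ennreal D"
    if "eta (s n) \<le> \<eta>0" "B \<subseteq> shadow (cone (s n))" for n B
    unfolding chart_mass_def D
    by (intro nn_integral_mono) (use dom[OF s(2) \<eta>(2) that(1)] that(2) in \<open>auto simp: indicator_def intro!: ennreal_leI\<close>)
  define u where "u n y = (if eta (s n) \<le> \<eta>0 then
     indicator (cone (s n)) (chart (s n) (eta (s n)) y) * ennreal (ratio (eta (s n)) y) else 0)" for n y
  have om[measurable]: "orthant s' \<eta>' \<in> sets borel" for s' \<eta>'
    using open_orthant by auto
  have lm[measurable]: "limit_set \<in> sets borel"
    unfolding limit_set_def by measurable
  have "(\<lambda>n. \<integral>\<^sup>+y. u n y \<partial>lborel) \<longlonglongrightarrow> limit_mass"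
    unfolding limit_mass_def
  proof (rule nn_integral_dominated_convergence)
    show "u n \<in> borel_measurable lborel" for n
      unfolding u_def by measurable
    show "AE y in lborel. u n y \<le> ennreal (w y)" for n
      using dom[OF s(2) \<eta>(2)[of n]] subset_shadow[of "cone (s n)"]
      by (auto simp: u_def indicator_def intro!: AE_I2 ennreal_leI)
    show "AE y in lborel. (\<lambda>n. u n y) \<longlonglongrightarrow> ennreal (exp (- ell y)) * indicator limit_set y"
      using AE_coords_neq
    proof eventually_elim
      case (elim y)
      have "(\<lambda>n. radial_ratio \<delta> (\<nu> + \<delta> - CARD('n)) \<nu> (eta (s n)) (sqrt (1 + 2 * eta (s n) * ell y + (eta (s n))\<^sup>2 * kap y))) \<longlonglongrightarrow> exp (- ell y)"
        by (rule radial_ratio_tendsto[OF pos(3) \<eta>])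
      moreover have "sqrt (1 + 2 * eta (s n) * ell y + (eta (s n))\<^sup>2 * kap y) = rad (eta (s n)) y" for n
        using \<eta>(2)[of n] by (simp add: rad_square[symmetric]) (simp add: rad_def)
      ultimately have "(\<lambda>n. ratio (eta (s n)) y) \<longlonglongrightarrow> exp (- ell y)"
        by (simp add: ratio_def)
      then have "(\<lambda>n. indicator limit_set y * ennreal (ratio (eta (s n)) y)) \<longlonglongrightarrow> indicator limit_set y * ennreal (exp (- ell y))"
        by (intro ennreal_tendsto_cmult tendsto_ennrealI) (auto simp: indicator_def)
      moreover have "\<forall>\<^sub>F n in sequentially. indicator limit_set y * ennreal (ratio (eta (s n)) y) = u n y"
        using small indicator_orthant_tendsto[OF s elim[rule_format]]
        by eventually_elim (auto simp: u_def indicator_def)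
      ultimately show ?case
        by (simp add: tendsto_cong mult.commute)
    qed
  qed (use wfin in auto)
  moreover have ev: "\<forall>\<^sub>F n in sequentially. (\<integral>\<^sup>+y. u n y \<partial>lborel) = chart_mass (cone (s n)) (s n)"
    using small by (rule eventually_mono) (simp add: u_def chart_mass_def)
  ultimately have lim: "(\<lambda>n. chart_mass (cone (s n)) (s n)) \<longlonglongrightarrow> limit_mass"
    by (simp only: tendsto_cong)
  have "limit_mass \<le> ennreal D"
    by (rule tendsto_upperbound[OF lim])
      (use small in \<open>auto elim!: eventually_mono intro!: mass_le subset_shadow\<close>)
  then have "limit_mass < \<infinity>"
    by (simp add: order.strict_trans1)
  moreover have "\<forall>\<^sub>F n in sequentially. chart_mass (shadow (cone (s n))) (s n) \<le> ennreal D"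
    using small by (rule eventually_mono) (simp add: mass_le)
  moreover have "\<forall>\<^sub>F n in sequentially. \<forall>y. chart (s n) (eta (s n)) y \<in> shadow (cone (s n)) \<longrightarrow> rad (eta (s n)) y \<ge> 1/2"
    using small by (rule eventually_mono) (use dom[OF s(2) \<eta>(2)] in blast)
  ultimately show ?thesis
    using lim by (intro that[of D]) (auto simp: D_def)
qed


lemma finite_measure_radial: "finite_measure radial"
proof
  have "emeasure radial (space radial) = (\<integral>\<^sup>+r. ennreal (tail_density p q \<delta> \<nu> r0 r) * indicator UNIV r \<partial>lborel)"
    unfolding radial_def by (subst emeasure_density) auto
  also have "\<dots> = (\<integral>\<^sup>+r. ennreal (tail_density p q \<delta> \<nu> r0 r) * indicator {r0<..} r \<partial>lborel)"
    using AE_lborel_singleton[of r0]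
    by (intro nn_integral_cong_AE) (auto simp: indicator_def tail_density_def elim!: eventually_mono)
  also have "\<dots> = emeasure radial {r0<..}"
    unfolding radial_def by (subst emeasure_density) auto
  also have "\<dots> = ennreal (p * r0 powr \<nu> * exp (- q * r0 powr \<delta>))"
    unfolding radial_def by (rule emeasure_tail_density[OF pos nonneg]) simp
  finally show "emeasure radial (space radial) \<noteq> \<infinity>" by simp
qed

lemma measure_radial_tail:
  "u \<ge> r0 \<Longrightarrow> measure radial {u<..} = p * u powr \<nu> * exp (- q * u powr \<delta>)"
  unfolding measure_def radial_def using pos by (subst emeasure_tail_density[OF pos nonneg]) auto

text \<open>
  The tails of \<open>R\<close> and of the comparison law are within a factor \<open>1 \<plusminus> \<epsilon>\<close> of each other far out, and the
  orthant lies far out, so \<open>radial_mass_comparison\<close> applies.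
\<close>

lemma radial_mass_approx:
  assumes N: "prob_space N" and R[measurable]: "R \<in> borel_measurable N"
    and tail: "(\<lambda>u. measure N {\<omega> \<in> space N. R \<omega> > u}) \<sim>[at_top] (\<lambda>u. p * u powr \<nu> * exp (- q * u powr \<delta>))"
    and s: "filterlim s at_top sequentially" "\<And>n. s n > 0" and \<epsilon>: "\<epsilon> > 0"
    and far: "\<forall>\<^sub>F n in sequentially. \<forall>y. chart (s n) (eta (s n)) y \<in> shadow (cone (s n)) \<longrightarrow> rad (eta (s n)) y \<ge> 1/2"
  defines "O' n \<equiv> cone (s n)"
  shows "\<forall>\<^sub>F n in sequentially.
    radial_mass (distr N borel R) uniform_sphere (O' n) \<le> ennreal (scale (s n)) * (chart_mass (O' n) (s n) + ennreal (2 * \<epsilon>) * chart_mass (shadow (O' n)) (s n)) \<and>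
    ennreal (scale (s n)) * chart_mass (O' n) (s n) \<le> radial_mass (distr N borel R) uniform_sphere (O' n) + ennreal (scale (s n)) * (ennreal (2 * \<epsilon>) * chart_mass (shadow (O' n)) (s n))"
proof -
  interpret N: prob_space N by fact
  let ?\<alpha> = "distr N borel R"
  have fin: "finite_measure ?\<alpha>"
    by (rule N.finite_measure_distr) measurable
  have \<alpha>: "measure ?\<alpha> {u<..} = measure N {\<omega> \<in> space N. R \<omega> > u}" for u
    by (subst measure_distr) (auto intro!: arg_cong[where f = "measure N"])
  have "(\<lambda>u. measure N {\<omega> \<in> space N. R \<omega> > u} - p * u powr \<nu> * exp (- q * u powr \<delta>)) \<in> o(\<lambda>u. p * u powr \<nu> * exp (- q * u powr \<delta>))"
    using tail by (simp add: asymp_equiv_altdef)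
  from landau_o.smallD[OF this \<epsilon>] obtain r1 where r1: "\<And>u. u \<ge> r1 \<Longrightarrow>
      \<bar>measure N {\<omega> \<in> space N. R \<omega> > u} - p * u powr \<nu> * exp (- q * u powr \<delta>)\<bar> \<le> \<epsilon> * \<bar>p * u powr \<nu> * exp (- q * u powr \<delta>)\<bar>"
    by (auto simp: eventually_at_top_linorder)
  define r where "r = max r0 r1"
  have close: "\<bar>measure ?\<alpha> {u<..} - measure radial {u<..}\<bar> \<le> \<epsilon> * measure radial {u<..}" if "u \<ge> r" for u
    using r1[of u] that measure_radial_tail[of u] pos by (simp add: r_def \<alpha>)
  have large: "\<forall>\<^sub>F n in sequentially. s n > 2 * r"
    using s(1) by (simp add: filterlim_at_top_dense)
  show ?thesis
    using far large
  proof eventually_elim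
    case (elim n)
    have sr: "s n \<ge> 2 * r0" using elim(2) by (simp add: r_def)
    have op: "open (O' n)" "convex (O' n)"
      unfolding O'_def using open_orthant convex_orthant by blast+
    have bor: "O' n \<in> sets borel" "shadow (O' n) \<in> sets borel"
      by (rule borel_open op(1) open_shadow)+
    have out: "norm z > r" if "z \<in> O' n" for z
    proof -
      obtain y where y: "z = chart (s n) (eta (s n)) y"
        using chart_surj[OF s(2)] by blast
      then have "rad (eta (s n)) y \<ge> 1/2"
        using elim(1) that subset_shadow unfolding O'_def by blast
      then have "s n * (1/2) \<le> norm z"
        unfolding y norm_chart[OF s(2)] using s(2)[of n] by (intro mult_left_mono) auto
      then show ?thesis using elim(2) by simp
    qed
    have mass: "radial_mass radial uniform_sphere (O' n) = ennreal (scale (s n)) * chart_mass (O' n) (s n)"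
      by (rule radial_mass_chart[OF s(2) bor(1) _ sr]) (use elim(1) subset_shadow in \<open>unfold O'_def, blast\<close>)
    have mass': "radial_mass radial uniform_sphere (shadow (O' n)) = ennreal (scale (s n)) * chart_mass (shadow (O' n)) (s n)"
      by (rule radial_mass_chart[OF s(2) bor(2) _ sr]) (use elim(1) in \<open>simp add: O'_def\<close>)
    have sets: "sets ?\<alpha> = sets borel" "sets radial = sets borel" "sets (uniform_sphere :: (real ^ 'n) measure) = sets borel"
      by (simp_all add: radial_def uniform_sphere_def)
    note comparison = radial_mass_comparison[OF fin finite_measure_radial sets AE_uniform_sphere close less_imp_le[OF \<epsilon>] op out]
    show ?case
      using comparison unfolding mass mass' by (simp add: distrib_left mult_ac)
  qed
qed

text \<open>
  After division by \<open>scale\<close>, the error in \<open>radial_mass_approx\<close> is at most \<open>2 * \<epsilon>\<close> times the mass of the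
  shadow, which stays bounded, and \<open>\<epsilon>\<close> is arbitrary.
\<close>

theorem orthant_probability_limit:
  fixes U :: "'v \<Rightarrow> real ^ 'n"
  assumes N: "prob_space N" and R[measurable]: "R \<in> borel_measurable N" and U[measurable]: "U \<in> borel_measurable N"
    and dU: "distr N borel U = uniform_sphere" and Rpos: "AE \<omega> in N. R \<omega> > 0" and ind: "indep_rv N R U"
    and tail: "(\<lambda>u. measure N {\<omega> \<in> space N. R \<omega> > u}) \<sim>[at_top] (\<lambda>u. p * u powr \<nu> * exp (- q * u powr \<delta>))"
    and s: "filterlim s at_top sequentially" "\<And>n. s n > 0"
  shows "(\<lambda>n. measure N {\<omega> \<in> space N. R \<omega> *\<^sub>R U \<omega> \<in> cone (s n)} / scale (s n)) \<longlonglongrightarrow> enn2real limit_mass"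
    and "limit_mass < \<infinity>"
proof -
  interpret N: prob_space N by fact
  define O' where "O' n = cone (s n)" for n
  define P where "P n = measure N {\<omega> \<in> space N. R \<omega> *\<^sub>R U \<omega> \<in> O' n}" for n
  have P: "radial_mass (distr N borel R) uniform_sphere (O' n) = ennreal (P n)" for n
  proof -
    have "O' n \<in> sets borel"
      using open_orthant[of "s n" "eta (s n)"] by (simp add: O'_def)
    from radial_mass_distr[OF N R U Rpos ind this] show ?thesis
      by (simp add: dU P_def N.emeasure_eq_measure)
  qed
  obtain D where D: "D \<ge> 0" "\<forall>\<^sub>F n in sequentially. chart_mass (shadow (O' n)) (s n) \<le> ennreal D"
    and lim: "(\<lambda>n. chart_mass (O' n) (s n)) \<longlonglongrightarrow> limit_mass" and fin: "limit_mass < \<infinity>"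
    and far: "\<forall>\<^sub>F n in sequentially. \<forall>y. chart (s n) (eta (s n)) y \<in> shadow (cone (s n)) \<longrightarrow> rad (eta (s n)) y \<ge> 1/2"
    using chart_mass_bounds[OF s] unfolding O'_def by blast
  show "limit_mass < \<infinity>" by fact
  define f where "f n = enn2real (chart_mass (O' n) (s n))" for n
  have f: "f \<longlonglongrightarrow> enn2real limit_mass"
    unfolding f_def using fin lim by (intro tendsto_enn2real) auto
  have le: "chart_mass (O' n) (s n) \<le> chart_mass (shadow (O' n)) (s n)" for n
    unfolding chart_mass_def using subset_shadow[of "O' n"]
    by (intro nn_integral_mono mult_right_mono) (auto simp: indicator_def)
  have close: "\<forall>\<^sub>F n in sequentially. \<bar>P n / scale (s n) - f n\<bar> \<le> 2 * \<epsilon> * D" if "\<epsilon> > 0" for \<epsilon>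
    using radial_mass_approx[OF N R tail s that far, folded O'_def] D(2)
  proof eventually_elim
    case (elim n)
    have fe: "chart_mass (O' n) (s n) = ennreal (f n)"
      unfolding f_def using le[of n] elim(2) by (intro ennreal_enn2real[symmetric]) (meson ennreal_less_top le_less_trans)
    have f0: "f n \<ge> 0" by (simp add: f_def)
    have sc: "scale (s n) > 0" by (rule scale_pos[OF s(2)])
    have P0: "P n \<ge> 0" by (simp add: P_def)
    have "ennreal (2 * \<epsilon>) * chart_mass (shadow (O' n)) (s n) \<le> ennreal (2 * \<epsilon>) * ennreal D"
      using elim(2) by (intro mult_left_mono) auto
    then have h: "ennreal (2 * \<epsilon>) * chart_mass (shadow (O' n)) (s n) \<le> ennreal (2 * \<epsilon> * D)"
      using that D(1) by (simp add: ennreal_mult)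
    have "ennreal (P n) \<le> ennreal (scale (s n)) * (ennreal (f n) + ennreal (2 * \<epsilon> * D))"
      using elim(1) h unfolding P fe by (meson add_left_mono mult_left_mono order_trans zero_le)
    also have "\<dots> = ennreal (scale (s n) * (f n + 2 * \<epsilon> * D))"
      using f0 sc that D(1) by (simp add: ennreal_mult)
    finally have 1: "P n \<le> scale (s n) * (f n + 2 * \<epsilon> * D)"
      using f0 sc that D(1) by (subst (asm) ennreal_le_iff) auto
    have "ennreal (scale (s n)) * ennreal (f n) \<le> ennreal (P n) + ennreal (scale (s n)) * ennreal (2 * \<epsilon> * D)"
      using elim(1) h unfolding P fe by (meson add_left_mono mult_left_mono order_trans zero_le)
    then have "ennreal (scale (s n) * f n) \<le> ennreal (P n + scale (s n) * (2 * \<epsilon> * D))"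
      using f0 sc that D(1) P0 by (simp add: ennreal_mult)
    then have 2: "scale (s n) * f n \<le> P n + scale (s n) * (2 * \<epsilon> * D)"
      using sc that D(1) P0 by (subst (asm) ennreal_le_iff) auto
    have "P n / scale (s n) \<le> f n + 2 * \<epsilon> * D"
      using 1 sc by (simp add: pos_divide_le_eq mult.commute)
    moreover have "f n - 2 * \<epsilon> * D \<le> P n / scale (s n)"
      using 2 sc by (subst pos_le_divide_eq) (simp_all add: algebra_simps)
    ultimately show ?case by (simp add: abs_le_iff)
  qed
  have "(\<lambda>n. P n / scale (s n) - f n) \<longlonglongrightarrow> 0"
  proof (rule tendstoI)
    fix e :: real assume e: "e > 0"
    define \<epsilon> where "\<epsilon> = e / (4 * (D + 1))"
    have \<epsilon>: "\<epsilon> > 0" using e D by (simp add: \<epsilon>_def)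
    have "2 * \<epsilon> * D \<le> 2 * \<epsilon> * (D + 1)" using \<epsilon> by (intro mult_left_mono) auto
    also have "\<dots> = e / 2" using D by (simp add: \<epsilon>_def field_simps)
    finally have "2 * \<epsilon> * D < e" using e by simp
    with close[OF \<epsilon>] show "\<forall>\<^sub>F n in sequentially. dist (P n / scale (s n) - f n) 0 < e"
      by (auto elim!: eventually_mono simp: dist_real_def)
  qed
  from tendsto_add[OF this f] show "(\<lambda>n. measure N {\<omega> \<in> space N. R \<omega> *\<^sub>R U \<omega> \<in> cone (s n)} / scale (s n)) \<longlonglongrightarrow> enn2real limit_mass"
    by (simp add: P_def O'_def)
qed

end

section \<open>Constants and the theorem\<close>

lemma sqrt_power_powr:
  fixes c :: real
  assumes "c > 0"
  shows "sqrt (c ^ n) = c powr (real n / 2)"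
proof -
  have "sqrt (c ^ n) = (c powr real n) powr (1 / 2)"
    using assms by (simp only: powr_realpow powr_half_sqrt zero_le_power less_imp_le)
  then show ?thesis by (simp only: powr_powr) simp
qed

lemma gaussian_constant:
  fixes k m :: nat
  assumes "m \<le> k"
  shows "sqrt ((2 * pi) ^ (k - m)) / (2 * pi powr (k / 2)) = 2 powr (k / 2 - 1) / (2 * pi) powr (m / 2)"
proof -
  have "sqrt ((2 * pi) ^ (k - m)) = (2 * pi) powr ((real k - real m) / 2)"
    using assms by (subst sqrt_power_powr) (auto simp: of_nat_diff)
  also have "\<dots> = (2 * pi) powr (k / 2) / (2 * pi) powr (m / 2)"
    by (simp add: diff_divide_distrib powr_diff)
  also have "(2 * pi) powr (k / 2) = 2 powr (k / 2) * pi powr (k / 2)"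
    by (simp add: powr_mult)
  finally show ?thesis
    by (simp add: powr_diff)
qed

lemma sphere_area:
  fixes k :: nat
  assumes "k > 0"
  shows "real k * unit_ball_vol k = 2 * pi powr (k / 2) / Gamma (k / 2)"
proof -
  have "Gamma (real k / 2 + 1) = real k / 2 * Gamma (real k / 2)"
    using assms by (intro Gamma_plus1) auto
  then have "real k * unit_ball_vol k = real k * (pi powr (real k / 2) / (real k / 2 * Gamma (real k / 2)))"
    by (simp only: unit_ball_vol_def)
  then show ?thesis
    using assms by simp
qed

text \<open>
  The power of \<open>s\<close> left over from the Jacobian of the chart and from the density at distance \<open>s\<close>, with
  \<open>b = q * \<delta>\<close>.
\<close>

lemma scale_power:
  fixes k m :: nat and s b \<delta> \<nu> :: real
  assumes "m \<le> k" "s > 0" "b > 0"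
  defines "\<eta> \<equiv> 1 / (b * s powr \<delta>)"
  shows "s ^ k * \<eta> ^ m * sqrt \<eta> ^ (k - m) * (b * s powr (\<nu> + \<delta> - k))
    = b powr (1 - (real k + real m) / 2) * s powr (\<nu> + \<delta> * (1 - (real k + real m) / 2))"
proof -
  have \<eta>: "\<eta> > 0" "\<eta> = b powr (- 1) * s powr (- \<delta>)"
    using assms by (auto simp: \<eta>_def powr_minus divide_inverse)
  have "sqrt \<eta> ^ (k - m) = \<eta> powr ((real k - real m) / 2)"
    using assms \<eta>(1) by (simp add: sqrt_power_powr of_nat_diff flip: real_sqrt_power)
  then have "\<eta> ^ m * sqrt \<eta> ^ (k - m) = \<eta> powr ((real k + real m) / 2)"
    using \<eta>(1) by (simp add: field_simps flip: powr_realpow powr_add)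
  also have "\<dots> = b powr (- ((real k + real m) / 2)) * s powr (- (\<delta> * ((real k + real m) / 2)))"
    unfolding \<eta>(2) by (subst powr_mult) (simp_all only: powr_ge_zero powr_powr mult_minus_left mult_1_left)
  finally have e: "\<eta> ^ m * sqrt \<eta> ^ (k - m) = b powr (- ((real k + real m) / 2)) * s powr (- (\<delta> * ((real k + real m) / 2)))" .
  have "s ^ k * \<eta> ^ m * sqrt \<eta> ^ (k - m) * (b * s powr (\<nu> + \<delta> - k))
    = (b powr 1 * b powr (- ((real k + real m) / 2))) * (s powr real k * s powr (- (\<delta> * ((real k + real m) / 2))) * s powr (\<nu> + \<delta> - k))"
    using assms e by (simp add: powr_realpow mult_ac)
  also have "\<dots> = b powr (1 - (real k + real m) / 2) * s powr (\<nu> + \<delta> * (1 - (real k + real m) / 2))"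
    unfolding powr_add[symmetric] by (simp add: algebra_simps)
  finally show ?thesis .
qed

context kotz_orthant
begin

text \<open>
  The shear contributes no determinant: the determinant of \<open>W\<close> only involves the two diagonal blocks, and
  that of the Schur complement cancels against the normalisation of the conditional Gaussian law.
\<close>

lemma scale_eq:
  assumes s: "s > 0" and dets: "(det W)\<^sup>2 * (subdet I S * subdet (-I) (schur_complement S I)) = 1" "subdet I S > 0" "subdet (-I) (schur_complement S I) > 0"
  shows "scale s * sqrt ((2 * pi) ^ card (-I) * subdet (-I) (schur_complement S I))
    = p * (q * \<delta>) powr (1 - (CARD('n) + card I) / 2) * s powr (\<nu> + \<delta> * (1 - (CARD('n) + card I) / 2)) * exp (- q * s powr \<delta>)
      * (Gamma (CARD('n) / 2) * 2 powr (CARD('n) / 2 - 1) / ((2 * pi) powr (card I / 2) * sqrt (subdet I S)))"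
proof -
  let ?k = "CARD('n)" and ?m = "card I" and ?dI = "subdet I S" and ?dJ = "subdet (-I) (schur_complement S I)"
  have mk: "?m \<le> ?k" by (rule card_mono) auto
  have cJ: "card (-I) = ?k - ?m"
    by (simp add: Compl_eq_Diff_UNIV card_Diff_subset)
  have "sqrt ((det W)\<^sup>2 * (?dI * ?dJ)) = 1" using dets(1) by simp
  then have dW: "\<bar>det W\<bar> * (sqrt ?dI * sqrt ?dJ) = 1"
    by (simp add: real_sqrt_mult)
  have "(\<Prod>i\<in>UNIV. s * weight (eta s) i) = s ^ ?k * ((\<Prod>i\<in>I. weight (eta s) i) * (\<Prod>i\<in>-I. weight (eta s) i))"
    by (simp add: prod.distrib Compl_eq_Diff_UNIV prod.subset_diff[of I UNIV] mult.commute)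
  also have "\<dots> = s ^ ?k * eta s ^ ?m * sqrt (eta s) ^ (?k - ?m)"
    by (simp add: weight_def cJ)
  finally have w: "(\<Prod>i\<in>UNIV. s * weight (eta s) i) * (q * \<delta> * s powr (\<nu> + \<delta> - ?k))
      = (q * \<delta>) powr (1 - (real ?k + real ?m) / 2) * s powr (\<nu> + \<delta> * (1 - (real ?k + real ?m) / 2))"
    using scale_power[OF mk s, of "q * \<delta>" \<delta> \<nu>] pos by (simp add: eta_def)
  have "scale s * sqrt ((2 * pi) ^ card (-I) * ?dJ)
    = \<bar>det W\<bar> * sqrt ?dJ * p * ((\<Prod>i\<in>UNIV. s * weight (eta s) i) * (q * \<delta> * s powr (\<nu> + \<delta> - ?k))) * exp (- q * s powr \<delta>)
      * (sqrt ((2 * pi) ^ (?k - ?m)) / (real ?k * unit_ball_vol ?k))"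
    by (simp add: scale_def jacobian_def cJ real_sqrt_mult mult_ac)
  also have "sqrt ((2 * pi) ^ (?k - ?m)) / (real ?k * unit_ball_vol ?k) = Gamma (?k / 2) * 2 powr (?k / 2 - 1) / (2 * pi) powr (?m / 2)"
  proof -
    have flip: "c / (b / g) = g * (c / b)" for b c g :: real by simp
    show ?thesis
      unfolding sphere_area[OF zero_less_card_finite] flip gaussian_constant[OF mk] by simp
  qed
  also have "\<bar>det W\<bar> * sqrt ?dJ = 1 / sqrt ?dI"
    using dW dets(2) by (simp add: field_simps)
  finally show ?thesis
    unfolding w by (simp add: mult_ac)
qed

end

theorem theorem3p1:
  fixes M :: "'w measure" and N :: "'v measure"
    and X :: "'w \<Rightarrow> real ^ 'k::finite"
    and R :: "'v \<Rightarrow> real" and U :: "'v \<Rightarrow> real ^ 'k"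
    and A S :: "real ^ 'k ^ 'k"
    and \<delta> p q \<nu> k m nrm :: real
    and t :: "nat \<Rightarrow> real" and a x :: "real ^ 'k" and v :: "nat \<Rightarrow> real ^ 'k"
    and I :: "'k set"
  assumes "CARD('k) \<ge> 2"
    and "prob_space M" and "prob_space N"
    and "invertible A" and "S = transpose A ** A" and "correlation_matrix S"
    and "X \<in> borel_measurable M" and "R \<in> borel_measurable N" and "U \<in> borel_measurable N"
    and "distr N borel U = uniform_sphere"
    and "AE \<omega> in N. R \<omega> > 0"
    and "indep_rv N R U"
    and "distr M borel X = distr N borel (\<lambda>\<omega>. transpose A *v (R \<omega> *\<^sub>R U \<omega>))"
    and "\<delta> > 0" and "p > 0" and "q > 0"
    and "(\<lambda>u. measure N {\<omega> \<in> space N. R \<omega> > u}) \<sim>[at_top]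
           (\<lambda>u. p * u powr \<nu> * exp (- q * u powr \<delta>))"
    and "\<And>n. n \<ge> 1 \<Longrightarrow> t n > 0" and "filterlim t at_top sequentially"
    and "\<exists>i. a $ i > 0"
    and "minimal_index_set S a I"
    and "k = real CARD('k)" and "m = real (card I)"
    and "nrm = sqrt (subvec I a \<bullet> (subinv I S *v subvec I a))"
    and "\<And>n. v n = (\<chi> i. if i \<in> I then q * \<delta> * (t n * nrm) powr (\<delta> - 1)
                         else sqrt (q * \<delta>) * (t n * nrm) powr (\<delta> / 2 - 1))"
  shows "(\<lambda>n. measure M {\<omega> \<in> space M. \<forall>i. X \<omega> $ i > t n * a $ i + x $ i / v n $ i}) \<sim>[sequentially]
         (\<lambda>n. p * (q * \<delta>) powr (1 - (k + m) / 2)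
              * nrm powr (m + \<nu> + \<delta> * (1 - (k + m) / 2))
              * (Gamma (k / 2) * 2 powr (k / 2 - 1)
                 / ((2 * pi) powr (m / 2) * sqrt (subdet I S)
                    * (\<Prod>i\<in>I. subvec I a \<bullet> (subinv I S *v axis i 1))))
              * exp (- (subvec I x \<bullet> (subinv I S *v subvec I a)) / nrm)
              * cond_gaussian_prob S I
                  (subvec (-I) a - submat (-I) I S *v (subinv I S *v subvec I a)) x
              * t n powr (\<nu> + \<delta> * (1 - (k + m) / 2))
              * exp (- q * nrm powr \<delta> * t n powr \<delta>))"
proof -
  note [measurable] = assms(7-9)
  let ?Q = "subinv I S" and ?c = "subvec (-I) a - submat (-I) I S *v (subinv I S *v subvec I a)"
  have S: "transpose S = S" "pos_def S"
    using assms(6) by (auto simp: correlation_matrix_def pos_def_def)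
  have padI: "invertible (pad_one I S)"
    by (rule pos_def_invertible[OF pos_def_pad_one[OF S(2)]])
  obtain W where AW: "transpose A ** W = shear S I" and W: "invertible W"
      "transpose W ** W = subinv I S + subinv (-I) (schur_complement S I)"
    and dets: "(det W)\<^sup>2 * (subdet I S * subdet (-I) (schur_complement S I)) = 1" "subdet I S > 0" "subdet (-I) (schur_complement S I) > 0"
    using whitening[OF assms(4,5) S(2)] by blast
  obtain r0 where r0: "r0 > 0" "\<And>r. tail_density p q \<delta> \<nu> r0 r \<ge> 0"
    using tail_density_nonneg[OF assms(15,16,14)] by blast
  obtain b where I: "I \<noteq> {}" and b: "\<forall>i\<in>I. b $ i = a $ i \<and> (?Q *v subvec I a) $ i > 0"
      "\<forall>j\<in>-I. b $ j = (submat (-I) I S *v (?Q *v subvec I a)) $ j \<and> b $ j \<ge> a $ j"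
    using assms(21) unfolding minimal_index_set_def by blast
  have mult_pos: "(?Q *v subvec I a) $ i > 0" if "i \<in> I" for i
    using b(1) that by blast
  have feas: "a $ j \<le> (submat (-I) I S *v (?Q *v subvec I a)) $ j" if "j \<notin> I" for j
    using b(2) that by (metis ComplI)
  have reg: "regression S I *v a = submat (-I) I S *v (?Q *v subvec I a)"
    by (simp add: regression_vec subinv_mult_subvec)
  let ?l = "?Q *v subvec I a"
  \<comment> \<open>The squared norm is the value of a positive definite form at the vector of multipliers.\<close>
  have aI: "subvec I a \<bullet> ?l = ?l \<bullet> (S *v ?l)"
  proof -
    have "?l \<bullet> (S *v ?l) = subvec I ?l \<bullet> (S *v ?l)"
      by (simp only: subvec_subinv)
    also have "\<dots> = ?l \<bullet> subvec I (S *v ?l)"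
      by (simp only: inner_subvec)
    also have "subvec I (S *v ?l) = (coord_proj I ** (S ** ?Q)) *v subvec I a"
      by (simp only: coord_proj_vec[symmetric] matrix_vector_mul_assoc matrix_mul_assoc)
    also have "\<dots> = subvec I a"
      by (simp only: subinv_mult_S[OF padI] coord_proj_vec subvec_subvec)
    finally show ?thesis by (simp add: inner_commute)
  qed
  have "?l \<noteq> 0"
    using I mult_pos by fastforce
  then have "subvec I a \<bullet> ?l > 0"
    unfolding aI using S(2) by (simp add: pos_def_def)
  then have nrm: "nrm > 0" "nrm\<^sup>2 = subvec I a \<bullet> ?l"
    using assms(24) by auto
  interpret kotz_orthant A S W I a x nrm p q \<delta> \<nu> r0
    by unfold_locales (use AW W S padI mult_pos nrm feas assms(14-16) r0 reg in auto)
  \<comment> \<open>The value \<open>1\<close> keeps \<open>s\<close> positive at the index \<open>0\<close>, where the sign of \<open>t\<close> is unknown.\<close>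
  define s where "s n = (if t n > 0 then t n * nrm else 1)" for n
  have s_pos: "s n > 0" for n using nrm by (simp add: s_def)
  have ev: "\<forall>\<^sub>F n in sequentially. t n > 0 \<and> s n = t n * nrm"
    using eventually_ge_at_top[of 1] by (rule eventually_mono) (use assms(18) in \<open>auto simp: s_def\<close>)
  have "filterlim (\<lambda>n. t n * nrm) at_top sequentially"
    using nrm(1) by (intro filterlim_at_top_mult_tendsto_pos[OF tendsto_const _ assms(19)])
  then have s_lim: "filterlim s at_top sequentially"
    by (rule filterlim_cong[THEN iffD2, rotated 3]) (use ev in \<open>auto elim: eventually_mono\<close>)
  have limit: "(\<lambda>n. measure N {\<omega> \<in> space N. R \<omega> *\<^sub>R U \<omega> \<in> cone (s n)} / scale (s n)) \<longlonglongrightarrow> enn2real limit_mass"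
    and fin: "limit_mass < \<infinity>"
    using orthant_probability_limit[OF assms(3,8,9,10,11,12,17) s_lim s_pos] by auto
  have event: "\<forall>\<^sub>F n in sequentially. measure M {\<omega> \<in> space M. \<forall>i. X \<omega> $ i > t n * a $ i + x $ i / v n $ i}
      = measure N {\<omega> \<in> space N. R \<omega> *\<^sub>R U \<omega> \<in> cone (s n)}"
    using ev
  proof eventually_elim
    case (elim n)
    \<comment> \<open>The rates \<open>v\<close> are the inverse scalings of the chart.\<close>
    have b: "t n * a $ i + x $ i / v n $ i = s n * (a $ i / nrm + weight (eta (s n)) i * x $ i)" for i
    proof -
      have "1 / v n $ i = s n * weight (eta (s n)) i"
      proof (cases "i \<in> I")
        case True
        then show ?thesis
          using elim s_pos[of n] assms(14,16)
          by (simp add: assms(25) weight_def eta_def powr_diff)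
      next
        case False
        have "sqrt (s n powr \<delta>) = s n powr (\<delta> / 2)"
          using s_pos[of n] by (simp add: powr_half_sqrt[symmetric] powr_powr)
        then show ?thesis
          using elim s_pos[of n] assms(14,16) False
          by (simp add: assms(25) weight_def eta_def powr_diff real_sqrt_divide real_sqrt_mult)
      qed
      then have "x $ i / v n $ i = s n * weight (eta (s n)) i * x $ i"
        by (metis divide_inverse inverse_eq_divide mult.commute)
      then show ?thesis
        using elim nrm(1) by (simp add: algebra_simps)
    qed
    define B where "B = {z :: real ^ 'k. \<forall>i. z $ i > t n * a $ i + x $ i / v n $ i}"
    have [measurable]: "B \<in> sets borel" unfolding B_def by measurable
    have "measure M {\<omega> \<in> space M. \<forall>i. X \<omega> $ i > t n * a $ i + x $ i / v n $ i} = measure (distr M borel X) B"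
      by (subst measure_distr) (auto simp: B_def intro!: arg_cong[where f = "measure M"])
    also have "\<dots> = measure (distr N borel (\<lambda>\<omega>. transpose A *v (R \<omega> *\<^sub>R U \<omega>))) B"
      by (simp only: assms(13))
    also have "\<dots> = measure N {\<omega> \<in> space N. R \<omega> *\<^sub>R U \<omega> \<in> cone (s n)}"
    proof (subst measure_distr)
      show "(\<lambda>\<omega>. transpose A *v (R \<omega> *\<^sub>R U \<omega>)) \<in> borel_measurable N" by measurable
      have "(\<lambda>\<omega>. transpose A *v (R \<omega> *\<^sub>R U \<omega>)) -` B \<inter> space N = {\<omega> \<in> space N. R \<omega> *\<^sub>R U \<omega> \<in> cone (s n)}"
        unfolding B_def orthant_def b by auto
      then show "measure N ((\<lambda>\<omega>. transpose A *v (R \<omega> *\<^sub>R U \<omega>)) -` B \<inter> space N) = measure N {\<omega> \<in> space N. R \<omega> *\<^sub>R U \<omega> \<in> cone (s n)}"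
        by simp
    qed simp
    finally show ?case .
  qed
  have lam_gt: "lam $ i > 0" if "i \<in> I" for i
    using mult_pos[OF that] nrm by (simp add: lam_def)
  have c_le: "?c $ j \<le> 0" if "j \<notin> I" for j
    using feas[OF that] that by (simp add: subvec_def)
  have ls: "limit_set = {y. (\<forall>i\<in>I. y $ i > x $ i) \<and> (\<forall>j\<in>-I. ?c $ j = 0 \<longrightarrow> y $ j > x $ j)}"
    unfolding limit_set_def reg by (auto simp: subvec_def)
  define G where "G = cond_gaussian_prob S I ?c x"
  define E where "E = (\<Prod>i\<in>I. exp (- (lam $ i * x $ i)) / lam $ i)"
  define dJ where "dJ = sqrt ((2 * pi) ^ card (-I) * subdet (-I) (schur_complement S I))"
  note limit_eq = limit_mass_def[unfolded ls ell_def]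
  have L: "enn2real limit_mass = E * (dJ * G)" and Lpos: "enn2real limit_mass > 0"
    using limit_integral[of I lam ?c S x, OF lam_gt c_le dets(3) fin[unfolded limit_eq]]
    unfolding E_def dJ_def G_def limit_eq by auto
  have E: "E = exp (- (subvec I x \<bullet> ?l) / nrm) * nrm powr m / (\<Prod>i\<in>I. subvec I a \<bullet> (?Q *v axis i 1))"
  proof -
    have 1: "subvec I a \<bullet> (?Q *v axis i 1) = ?l $ i" for i
      by (subst QI_sym) (simp add: inner_axis')
    have 2: "(\<Sum>i\<in>I. lam $ i * x $ i) = subvec I x \<bullet> ?l / nrm"
      by (simp add: lam_inner[symmetric]) (simp add: lam_def divide_inverse)
    have 3: "(\<Prod>i\<in>I. lam $ i) = (\<Prod>i\<in>I. ?l $ i) / nrm powr m"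
      using nrm(1) by (simp add: lam_def assms(23) powr_realpow prod.distrib power_inverse divide_inverse)
    have "E = exp (- (\<Sum>i\<in>I. lam $ i * x $ i)) / (\<Prod>i\<in>I. lam $ i)"
      by (simp add: E_def prod_dividef exp_sum flip: sum_negf)
    then show ?thesis
      unfolding 1 2 3 by simp
  qed
  let ?rhs = "\<lambda>n. p * (q * \<delta>) powr (1 - (k + m) / 2)
              * nrm powr (m + \<nu> + \<delta> * (1 - (k + m) / 2))
              * (Gamma (k / 2) * 2 powr (k / 2 - 1)
                 / ((2 * pi) powr (m / 2) * sqrt (subdet I S)
                    * (\<Prod>i\<in>I. subvec I a \<bullet> (subinv I S *v axis i 1))))
              * exp (- (subvec I x \<bullet> (subinv I S *v subvec I a)) / nrm)
              * cond_gaussian_prob S I ?c x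
              * t n powr (\<nu> + \<delta> * (1 - (k + m) / 2))
              * exp (- q * nrm powr \<delta> * t n powr \<delta>)"
  have rhs: "\<forall>\<^sub>F n in sequentially. scale (s n) * enn2real limit_mass = ?rhs n"
    using ev
  proof eventually_elim
    case (elim n)
    let ?e = "\<nu> + \<delta> * (1 - (k + m) / 2)"
    have sp: "s n powr y = t n powr y * nrm powr y" for y
      using elim nrm(1) by (simp add: powr_mult)
    have np: "nrm powr (m + \<nu> + \<delta> * (1 - (k + m) / 2)) = nrm powr m * nrm powr ?e"
      by (simp add: powr_add add.assoc)
    have "scale (s n) * enn2real limit_mass = (scale (s n) * dJ) * E * G"
      by (simp add: L mult_ac)
    also have "scale (s n) * dJ = p * (q * \<delta>) powr (1 - (k + m) / 2) * s n powr ?e * exp (- q * s n powr \<delta>)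
      * (Gamma (k / 2) * 2 powr (k / 2 - 1) / ((2 * pi) powr (m / 2) * sqrt (subdet I S)))"
      unfolding dJ_def using scale_eq[OF s_pos dets] by (simp add: assms(22,23))
    finally show ?case
      unfolding E np sp G_def[symmetric] by (simp add: mult_ac)
  qed
  have "(\<lambda>n. measure N {\<omega> \<in> space N. R \<omega> *\<^sub>R U \<omega> \<in> cone (s n)}) \<sim>[sequentially]
      (\<lambda>n. scale (s n) * enn2real limit_mass)"
  proof (rule asymp_equivI')
    have "(\<lambda>n. measure N {\<omega> \<in> space N. R \<omega> *\<^sub>R U \<omega> \<in> cone (s n)} / scale (s n) / enn2real limit_mass)
      \<longlonglongrightarrow> enn2real limit_mass / enn2real limit_mass"
      using Lpos by (intro tendsto_divide limit tendsto_const) auto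
    then show "(\<lambda>n. measure N {\<omega> \<in> space N. R \<omega> *\<^sub>R U \<omega> \<in> cone (s n)} / (scale (s n) * enn2real limit_mass)) \<longlonglongrightarrow> 1"
      using Lpos by simp
  qed
  then show ?thesis
    by (rule asymp_equiv_transfer[OF _ _ rhs]) (use event in eventually_elim, rule sym)
qed

end
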